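(* Let $k,d\in\mathbb{N}$ with $d\geq 3$, let $\Omega=[0,1]^{d\times d}$, and let $2\leq p\leq\infty$. Suppose $f\in X^{2,p}(\Omega)$ satisfies $\|f\|_{X^{2,p}(\Omega)}\leq 1$. Then there exists $N_0\in\mathbb{N}$, depending only on $d$, such that for every integer $N\geq N_0$ there exists $h\in\mathcal{H}^{W,L}_{2k+1}(\mathbb{R}^{d\times d})$ with width $W=2Nd^2$ and depth $L=2(2\lceil\log_2N\rceil+3)\lceil\log_2d\rceil+6d$ such that $$\|f-h\|_{L^p(\Omega)}\leq \frac{4}{2^{(1-\frac{1}{p})d^2}}\cdot\frac{(\log_2N)^{(3-\frac{1}{p})(d^2-1)}}{N^{2-\frac{1}{p}}},$$ and $\operatorname{size}(h)\leq 24(2k+1)^2d^5N\log_2N$. (Here $f$ and $h$ are compared as functions of $X\in\Omega$, i.e. $f$ is evaluated at $\operatorname{vec}(X)$.)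
   Context: ReLU: $\sigma(x)=\max\{x,0\}$, applied entrywise to tensors. For $c,d\in\mathbb N$, $X\in\mathbb R^{c\times d\times d}$ has entries $[X]_{q,m,n}$, $q\in\{1,\dots,c\}$, $m,n\in\{1,\dots,d\}$; $\mathbb R^{d\times d}$ is identified with $\mathbb R^{1\times d\times d}$. Zero padding: $[\iota(X)]_{q,m,n}=[X]_{q,m,n}$ if $m,n\in\{1,\dots,d\}$ and $0$ for all other $m,n\in\mathbb Z$. For a kernel $K\in\mathbb R^{c'\times c\times(2k+1)\times(2k+1)}$ with entries $[K]_{p,q,s,t}$, $s,t\in\{-k,\dots,k\}$, the zero-padding convolution is $K*X\in\mathbb R^{c'\times d\times d}$, $[K*X]_{p,m,n}=\sum_{q=1}^c\sum_{s,t=-k}^k[K]_{p,q,s,t}[\iota(X)]_{q,m+s,n+t}$. For $\mathbf b\in\mathbb R^{c'}$, $A_{K,\mathbf b}(X)=K*X+\mathbf b\mathbf 1_{d\times d}$ with $[\mathbf b\mathbf 1_{d\times d}]_{p,m,n}=b_p$. An $L$-layer ReLU CNN with channel sizes $c_0,\dots,c_L$ and kernel spatial size $2k+1$ is the map $\sigma\circ A_{K^L,\mathbf b^L}\circ\cdots\circ\sigma\circ A_{K^1,\mathbf b^1}:\mathbb R^{c_0\times d\times d}\to\mathbb R^{c_L\times d\times d}$ with $K^l\in\mathbb R^{c_l\times c_{l-1}\times(2k+1)\times(2k+1)}$, $\mathbf b^l\in\mathbb R^{c_l}$; its width is $\max\{c_1,\dots,c_L\}$ and its depth is $L$. $\mathcal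 C^{W,L}_{2k+1}(\mathbb R^{c_0\times d\times d},\mathbb R^{c_L\times d\times d})$ is the set of maps realized by such CNNs of width $W$ and depth $L$. Vectorization: $\operatorname{vec}(Y)\in\mathbb R^{cd^2}$ for $Y\in\mathbb R^{c\times d\times d}$, $[\operatorname{vec}(Y)]_{(q-1)d^2+(m-1)d+n}=[Y]_{q,m,n}$. Hypothesis space: $\mathcal H^{W,L}_{2k+1}(\mathbb R^{c_0\times d\times d})=\{X\mapsto\beta+\sum_{i=1}^{c_Ld^2}\alpha_i[\operatorname{vec}(\mathbf h(X))]_i:\beta\in\mathbb R,\alpha\in\mathbb R^{c_Ld^2},\mathbf h\in\mathcal C^{W,L}_{2k+1}(\mathbb R^{c_0\times d\times d},\mathbb R^{c_L\times d\times d})\}$ (any $c_L\in\mathbb N$). The size of such an $h$ is the total number of nonzero entries in the kernels $K^l$, biases $\mathbf b^l$, and coefficients $\beta,\alpha$ of its representation. Korobov space: for $D\in\mathbb N$, $\Omega=[0,1]^D$, $X^{2,p}(\Omega)=\{f\in L^p(\Omega): f|_{\partial\Omega}=0,\ \partial^{\alpha}f\in L^p(\Omega)\text{ for all multi-indices }|\alpha|_\infty\le 2\}$ (weak derivatives), with norm $\|f\|_{X^{2,p}}=(\sum_{|\alpha|_\infty\le 2}\|\partial^\alpha f\|_{L^p}^p)^{1/p}$ for $p<\infty$ and $\max_{|\alpha|_\infty\le2}\|\partial^\alpha f\|_{L^\infty}$ for $p=\infty$. Here $D=d^2$ and $[0,1]^{d\times d}$ is identified with $[0,1]^{d^2}$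 via $\operatorname{vec}$. *)

theory Defs
  imports "HOL-Analysis.Analysis"
begin

text \<open>A tensor in R^(c x d x d) is represented by a function of (q,m,n); only the entries
  with q in {1..c}, m,n in {1..d} are meaningful.  A kernel in R^(c' x c x (2k+1) x (2k+1))
  is a function of (p,q,s,t); only p in {1..c'}, q in {1..c}, s,t in {-k..k} are meaningful.\<close>

type_synonym tensor = "nat \<Rightarrow> nat \<Rightarrow> nat \<Rightarrow> real"
type_synonym kernel = "nat \<Rightarrow> nat \<Rightarrow> int \<Rightarrow> int \<Rightarrow> real"

definition relu :: "real \<Rightarrow> real" where
  "relu x = max x 0"

definition zpad :: "nat \<Rightarrow> tensor \<Rightarrow> nat \<Rightarrow> int \<Rightarrow> int \<Rightarrow> real" where
  "zpad d X q i j =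
     (if 1 \<le> i \<and> i \<le> int d \<and> 1 \<le> j \<and> j \<le> int d then X q (nat i) (nat j) else 0)"

definition conv :: "nat \<Rightarrow> nat \<Rightarrow> nat \<Rightarrow> kernel \<Rightarrow> tensor \<Rightarrow> tensor" where
  "conv d k c K X = (\<lambda>p m n.
     (\<Sum>q\<in>{1..c}. \<Sum>s\<in>{-int k..int k}. \<Sum>t\<in>{-int k..int k}.
        K p q s t * zpad d X q (int m + s) (int n + t)))"

definition cnn_layer :: "nat \<Rightarrow> nat \<Rightarrow> nat \<Rightarrow> nat \<Rightarrow> kernel \<times> (nat \<Rightarrow> real) \<Rightarrow> tensor \<Rightarrow> tensor" where
  "cnn_layer d k c c' Kb X = (\<lambda>p m n.
     if p \<in> {1..c'} \<and> m \<in> {1..d} \<and> n \<in> {1..d}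
     then relu (conv d k c (fst Kb) X p m n + snd Kb p) else 0)"

text \<open>A CNN is given by its channel sizes [c_0,...,c_L] and its layers [(K^1,b^1),...,(K^L,b^L)].\<close>
fun cnn_eval :: "nat \<Rightarrow> nat \<Rightarrow> nat list \<Rightarrow> (kernel \<times> (nat \<Rightarrow> real)) list \<Rightarrow> tensor \<Rightarrow> tensor" where
  "cnn_eval d k (c # c' # cs) (Kb # Ls) X = cnn_eval d k (c' # cs) Ls (cnn_layer d k c c' Kb X)"
| "cnn_eval d k cs Ls X = X"

text \<open>well-formed CNN representation with input R^(d x d) = R^(1 x d x d), width W, depth L\<close>
definition cnn_shape :: "nat list \<Rightarrow> (kernel \<times> (nat \<Rightarrow> real)) list \<Rightarrow> nat \<Rightarrow> nat \<Rightarrow> bool" where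
  "cnn_shape cs Ls W L \<longleftrightarrow>
     length cs = length Ls + 1 \<and> hd cs = 1 \<and> (\<forall>c\<in>set cs. c \<ge> 1) \<and>
     length Ls = L \<and> L \<ge> 1 \<and> Max (set (tl cs)) = W"

text \<open>vectorization vec(Y) for Y in R^(c x d x d), index i in {1..c d^2}\<close>
definition tvec :: "nat \<Rightarrow> tensor \<Rightarrow> nat \<Rightarrow> real" where
  "tvec d Y i = Y ((i - 1) div (d * d) + 1) (((i - 1) mod (d * d)) div d + 1) ((i - 1) mod d + 1)"

definition hyp_eval :: "nat \<Rightarrow> nat \<Rightarrow> real \<Rightarrow> (nat \<Rightarrow> real) \<Rightarrow> nat list \<Rightarrow>
    (kernel \<times> (nat \<Rightarrow> real)) list \<Rightarrow> tensor \<Rightarrow> real" where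
  "hyp_eval d k \<beta> \<alpha> cs Ls X =
     \<beta> + (\<Sum>i\<in>{1..last cs * d * d}. \<alpha> i * tvec d (cnn_eval d k cs Ls X) i)"

definition layer_nnz :: "nat \<Rightarrow> nat \<Rightarrow> nat \<Rightarrow> kernel \<times> (nat \<Rightarrow> real) \<Rightarrow> nat" where
  "layer_nnz k c c' Kb =
     card {(p, q, s, t). p \<in> {1..c'} \<and> q \<in> {1..c} \<and> s \<in> {-int k..int k} \<and> t \<in> {-int k..int k}
                         \<and> fst Kb p q s t \<noteq> 0}
     + card {p \<in> {1..c'}. snd Kb p \<noteq> 0}"

definition hyp_size :: "nat \<Rightarrow> nat \<Rightarrow> real \<Rightarrow> (nat \<Rightarrow> real) \<Rightarrow> nat list \<Rightarrow>
    (kernel \<times> (nat \<Rightarrow> real)) list \<Rightarrow> nat" where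
  "hyp_size d k \<beta> \<alpha> cs Ls =
     (\<Sum>l<length Ls. layer_nnz k (cs ! l) (cs ! Suc l) (Ls ! l))
     + (if \<beta> \<noteq> 0 then 1 else 0) + card {i \<in> {1..last cs * d * d}. \<alpha> i \<noteq> 0}"

text \<open>the d x d image X with vec(X) = x, where the index set {1..d^2} of vec is identified
  with the coordinate type 'n by the bijection e\<close>
definition img_of :: "nat \<Rightarrow> (nat \<Rightarrow> 'n) \<Rightarrow> real^'n \<Rightarrow> tensor" where
  "img_of d e x = (\<lambda>q m n. x $ e ((m - 1) * d + n))"

definition partial :: "'n::finite \<Rightarrow> (real^'n \<Rightarrow> real) \<Rightarrow> real^'n \<Rightarrow> real" where
  "partial i \<phi> x = deriv (\<lambda>t. \<phi> (x + t *\<^sub>R axis i 1)) 0"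

fun partials :: "'n::finite list \<Rightarrow> (real^'n \<Rightarrow> real) \<Rightarrow> real^'n \<Rightarrow> real" where
  "partials [] \<phi> = \<phi>"
| "partials (i # is) \<phi> = partial i (partials is \<phi>)"

text \<open>classical mixed partial derivative of multi-index alpha (order irrelevant for smooth functions)\<close>
definition mixed_partial :: "('n::finite \<Rightarrow> nat) \<Rightarrow> (real^'n \<Rightarrow> real) \<Rightarrow> real^'n \<Rightarrow> real" where
  "mixed_partial \<alpha> \<phi> = partials (SOME is. \<forall>i. count_list is i = \<alpha> i) \<phi>"

definition smooth_fun :: "(real^'n::finite \<Rightarrow> real) \<Rightarrow> bool" where
  "smooth_fun \<phi> \<longleftrightarrow>
     (\<forall>is. continuous_on UNIV (partials is \<phi>) \<and>
           (\<forall>i x. (\<lambda>t. partials is \<phi> (x + t *\<^sub>R axis i 1)) differentiable (at 0)))"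

definition test_fun :: "(real^'n::finite) set \<Rightarrow> (real^'n \<Rightarrow> real) \<Rightarrow> bool" where
  "test_fun \<Omega> \<phi> \<longleftrightarrow> smooth_fun \<phi> \<and> compact (closure {x. \<phi> x \<noteq> 0})
      \<and> closure {x. \<phi> x \<noteq> 0} \<subseteq> interior \<Omega>"

definition weak_deriv :: "(real^'n::finite) set \<Rightarrow> ('n \<Rightarrow> nat) \<Rightarrow> (real^'n \<Rightarrow> real) \<Rightarrow>
    (real^'n \<Rightarrow> real) \<Rightarrow> bool" where
  "weak_deriv \<Omega> \<alpha> f g \<longleftrightarrow>
     (\<forall>\<phi>. test_fun \<Omega> \<phi> \<longrightarrow>
        integral\<^sup>L (lebesgue_on \<Omega>) (\<lambda>x. f x * mixed_partial \<alpha> \<phi> x)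
        = (-1) ^ (\<Sum>i\<in>UNIV. \<alpha> i) * integral\<^sup>L (lebesgue_on \<Omega>) (\<lambda>x. g x * \<phi> x))"

definition memLp :: "'a measure \<Rightarrow> ereal \<Rightarrow> ('a \<Rightarrow> real) \<Rightarrow> bool" where
  "memLp M p g \<longleftrightarrow> g \<in> borel_measurable M \<and>
     (if p = \<infinity> then (\<exists>C. AE x in M. \<bar>g x\<bar> \<le> C)
      else integrable M (\<lambda>x. \<bar>g x\<bar> powr real_of_ereal p))"

definition Lp_norm :: "'a measure \<Rightarrow> ereal \<Rightarrow> ('a \<Rightarrow> real) \<Rightarrow> real" where
  "Lp_norm M p g =
     (if p = \<infinity> then Inf {C. C \<ge> 0 \<and> (AE x in M. \<bar>g x\<bar> \<le> C)}
      else (integral\<^sup>L M (\<lambda>x. \<bar>g x\<bar> powr real_of_ereal p)) powr (1 / real_of_ereal p))"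

definition inv_exp :: "ereal \<Rightarrow> real" where
  "inv_exp p = (if p = \<infinity> then 0 else 1 / real_of_ereal p)"

definition mindex2 :: "('n::finite \<Rightarrow> nat) set" where
  "mindex2 = {\<alpha>. \<forall>i. \<alpha> i \<le> 2}"

definition unit_cube :: "(real^'n::finite) set" where
  "unit_cube = cbox 0 1"

text \<open>f in X^{2,p}(Omega) with ||f||_{X^{2,p}} <= 1, Omega = [0,1]^n.
  G alpha is the weak derivative d^alpha f.  The boundary condition f|_{boundary} = 0 is
  understood for the continuous representative of f.\<close>
definition korobov_unit_ball :: "ereal \<Rightarrow> (real^'n::finite \<Rightarrow> real) \<Rightarrow> bool" where
  "korobov_unit_ball p f \<longleftrightarrow>
     memLp (lebesgue_on unit_cube) p f \<and>
     (\<exists>g. continuous_on unit_cube g \<and> (\<forall>x\<in>frontier unit_cube. g x = 0) \<and>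
          (AE x in lebesgue_on unit_cube. f x = g x)) \<and>
     (\<exists>G. (\<forall>\<alpha>\<in>mindex2. weak_deriv unit_cube \<alpha> f (G \<alpha>) \<and> memLp (lebesgue_on unit_cube) p (G \<alpha>)) \<and>
          (if p = \<infinity>
           then (\<forall>\<alpha>\<in>mindex2. Lp_norm (lebesgue_on unit_cube) p (G \<alpha>) \<le> 1)
           else (\<Sum>\<alpha>\<in>mindex2. Lp_norm (lebesgue_on unit_cube) p (G \<alpha>) powr real_of_ereal p)
                  powr (1 / real_of_ereal p) \<le> 1))"

end

theory Submission
  imports Defs "HOL-Library.Multiset" "HOL-Computational_Algebra.Polynomial"
begin

text \<open>Testing the weak derivative of multi-index \<open>(2,\<dots>,2)\<close> against smoothed products of
  one-dimensional Green's functions \<open>\<kappa>(x,t) = min x t * (1 - max x t)\<close>, and using that \<open>f\<close> vanishes on the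
  boundary, gives \<open>f(x) = \<plusminus> \<integral> G(t) \<Prod>\<^sub>j \<kappa>(x\<^sub>j,t\<^sub>j) dt\<close> with \<open>G\<close> in the unit ball of \<open>L\<^sup>p\<close>.
  The self-similarity of \<open>\<kappa>\<close> yields the expansion
  \<open>\<kappa>(x,t) = \<Sum>\<^sub>l 2\<^bsup>-l-2\<^esup> \<Sum>\<^sub>i \<phi>\<^sub>l\<^sub>i(x) \<phi>\<^sub>l\<^sub>i(t)\<close> into hierarchical hat functions; truncating the tensor product of
  these expansions at \<open>l\<^sub>1 + \<dots> + l\<^sub>D < n\<close> gives a sparse grid interpolant with at most
  \<open>n\<^bsup>D-1\<^esup> 2\<^sup>n\<close> terms, and Hoelder's inequality bounds the remaining levels uniformly in \<open>x\<close>.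
  The network devotes a block of channels to each term: convolutions move every pixel to the corner, two layers
  evaluate the hat functions there, and a binary tree of approximate multiplications, based on
  \<open>x y = ((x + y)/2)\<^sup>2 - (\<bar>x - y\<bar>/2)\<^sup>2\<close> and the sawtooth approximation of the square, forms the product.
  The constants leave room to spare, so at most \<open>N/16\<close> terms are used and crude counting suffices.\<close>

subsection \<open>Smooth functions of one real variable\<close>

text \<open>A test function must have compact support in the open cube, whereas a product of Green's
  functions reaches the boundary and has kinks. So each factor is shrunk to an interval inside (0,1)
  and rounded on a scale e; its second derivative is then a combination of three mollifiers, at
  points tending to 0, x and 1. Multiplying out over D coordinates gives 3^D approximate point
  evaluations of f, and every limit point except x itself has a coordinate 0 or 1, where the
  continuous representative vanishes. The rate comes from two powers of 2 for a level vector of sum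
  s: the weights 2^(-l-2) multiply to 2^(-s-2D), and the L^1 bound 2^(-s-D) of the kernel enters
  Hoelder's inequality with exponent 1-1/p. This explains N^(-(2-1/p)) and 2^(-(1-1/p)D); the spare
  factor 4^(-D) absorbs the numerical constants. Once the hats are formed, the values carried by the
  network lie in [0,1], so ReLU passes them on unchanged and multiplication errors add up without
  amplification.\<close>

definition smooth_real :: "(real \<Rightarrow> real) \<Rightarrow> bool" where
  "smooth_real f \<longleftrightarrow> (\<forall>n x. ((deriv ^^ n) f has_real_derivative (deriv ^^ Suc n) f x) (at x))"

text \<open>Uniqueness of derivatives identifies \<open>deriv g\<close> with the witness in
  \<open>S\<close>, so all iterated derivatives stay in \<open>S\<close>. Proving smoothness thus
  amounts to exhibiting a family closed under differentiation.\<close>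

lemma smooth_real_coinduct:
  assumes "f \<in> S" and "\<And>g. g \<in> S \<Longrightarrow> \<exists>g'\<in>S. \<forall>x. (g has_real_derivative g' x) (at x)"
  shows "smooth_real f"
proof -
  have S: "deriv g \<in> S \<and> (\<forall>x. (g has_real_derivative deriv g x) (at x))" if g: "g \<in> S" for g
  proof -
    obtain g' where g': "g' \<in> S" "\<forall>x. (g has_real_derivative g' x) (at x)"
      using assms(2)[OF g] by blast
    then have "deriv g = g'" by (auto intro: DERIV_imp_deriv)
    then show ?thesis using g' by simp
  qed
  have "(deriv ^^ n) f \<in> S" for n
    by (induction n) (use S assms(1) in auto)
  then show ?thesis using S by (auto simp: smooth_real_def)
qed

lemma smooth_real_deriv:
  assumes "smooth_real f"
  shows "smooth_real (deriv f)" "(f has_real_derivative deriv f x) (at x)"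
proof -
  have "((deriv ^^ Suc n) f has_real_derivative (deriv ^^ Suc (Suc n)) f x) (at x)" for n x
    using assms unfolding smooth_real_def by blast
  then show "smooth_real (deriv f)"
    unfolding smooth_real_def by (simp add: funpow_swap1)
  show "(f has_real_derivative deriv f x) (at x)"
    using assms[unfolded smooth_real_def, rule_format, of 0] by simp
qed

lemma smooth_real_funpow_deriv: "smooth_real f \<Longrightarrow> smooth_real ((deriv ^^ n) f)"
  by (induction n) (auto intro: smooth_real_deriv)

lemma smooth_real_continuous: "smooth_real f \<Longrightarrow> continuous_on A f"
  by (meson DERIV_continuous continuous_at_imp_continuous_on smooth_real_deriv(2))

text \<open>By the Leibniz rule, closure under differentiation has to be checked on the generators
  only; this avoids formulas for higher derivatives of products and quotients.\<close>

inductive_set generated_algebra :: "(real \<Rightarrow> real) set \<Rightarrow> (real \<Rightarrow> real) set"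
  for B :: "(real \<Rightarrow> real) set" where
  base: "g \<in> B \<Longrightarrow> g \<in> generated_algebra B"
| add: "g \<in> generated_algebra B \<Longrightarrow> h \<in> generated_algebra B \<Longrightarrow> (\<lambda>x. g x + h x) \<in> generated_algebra B"
| mult: "g \<in> generated_algebra B \<Longrightarrow> h \<in> generated_algebra B \<Longrightarrow> (\<lambda>x. g x * h x) \<in> generated_algebra B"

lemma smooth_real_generated_algebra:
  assumes "\<And>g. g \<in> B \<Longrightarrow> \<exists>g'\<in>generated_algebra B. \<forall>x. (g has_real_derivative g' x) (at x)"
    and "f \<in> generated_algebra B"
  shows "smooth_real f"
proof (rule smooth_real_coinduct[OF assms(2)])
  fix g assume "g \<in> generated_algebra B"
  then show "\<exists>g'\<in>generated_algebra B. \<forall>x. (g has_real_derivative g' x) (at x)"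
  proof (induction rule: generated_algebra.induct)
    case (base g)
    then show ?case using assms(1) by blast
  next
    case (add g h)
    then obtain g' h' where "g' \<in> generated_algebra B" "h' \<in> generated_algebra B"
      "\<forall>x. (g has_real_derivative g' x) (at x)" "\<forall>x. (h has_real_derivative h' x) (at x)" by blast
    then show ?case
      by (intro bexI[of _ "\<lambda>x. g' x + h' x"]) (auto intro: generated_algebra.add DERIV_add)
  next
    case (mult g h)
    then obtain g' h' where "g' \<in> generated_algebra B" "h' \<in> generated_algebra B"
      "\<forall>x. (g has_real_derivative g' x) (at x)" "\<forall>x. (h has_real_derivative h' x) (at x)" by blast
    then show ?case using mult
      by (intro bexI[of _ "\<lambda>x. g' x * h x + h' x * g x"])
         (auto intro!: generated_algebra.add generated_algebra.mult DERIV_mult)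
  qed
qed

lemma smooth_real_mult_add:
  assumes "smooth_real f" "smooth_real g"
  shows smooth_real_mult: "smooth_real (\<lambda>x. f x * g x)"
    and smooth_real_add: "smooth_real (\<lambda>x. f x + g x)"
proof -
  let ?B = "{f. smooth_real f}"
  have B: "\<exists>g'\<in>generated_algebra ?B. \<forall>x. (g has_real_derivative g' x) (at x)" if "g \<in> ?B" for g
    using that smooth_real_deriv[of g] generated_algebra.base[of "deriv g" ?B] by blast
  have "f \<in> generated_algebra ?B" "g \<in> generated_algebra ?B"
    using assms by (auto intro: generated_algebra.base)
  then show "smooth_real (\<lambda>x. f x * g x)" "smooth_real (\<lambda>x. f x + g x)"
    using smooth_real_generated_algebra[of ?B, OF B]
    by (blast intro: generated_algebra.add generated_algebra.mult)+
qed

text \<open>One extra generator w = 1/f suffices: w' = -f' w^2 is again a product of w and smooth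
  functions.\<close>

lemma smooth_real_inverse:
  assumes "smooth_real f" and nz: "\<And>x. f x \<noteq> 0"
  shows "smooth_real (\<lambda>x. inverse (f x))"
proof (rule smooth_real_generated_algebra)
  let ?w = "\<lambda>x. inverse (f x)"
  let ?B = "insert ?w {f. smooth_real f}"
  show "?w \<in> generated_algebra ?B" by (auto intro: generated_algebra.base)
  fix g assume "g \<in> ?B"
  then consider "g = ?w" | "smooth_real g" by auto
  then show "\<exists>g'\<in>generated_algebra ?B. \<forall>x. (g has_real_derivative g' x) (at x)"
  proof cases
    case 1
    have c: "smooth_real (\<lambda>x. -1)"
      by (rule smooth_real_coinduct[of _ "range (\<lambda>c x. c)"]) (auto intro!: derivative_eq_intros)
    have "(\<lambda>x. (-1 * deriv f x) * (?w x * ?w x)) \<in> generated_algebra ?B"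
      by (intro generated_algebra.mult)
         (auto intro!: generated_algebra.base c smooth_real_deriv assms)
    moreover have "(?w has_real_derivative ((-1 * deriv f x) * (?w x * ?w x))) (at x)" for x
      using smooth_real_deriv(2)[OF assms(1)] nz
      by (auto intro!: derivative_eq_intros simp: divide_simps power2_eq_square)
    ultimately show ?thesis using 1
      by (intro bexI[of _ "\<lambda>x. (-1 * deriv f x) * (?w x * ?w x)"]) auto
  next
    case 2
    then show ?thesis
      using smooth_real_deriv[of g] generated_algebra.base[of "deriv g" ?B] by blast
  qed
qed

lemma smooth_real_affine:
  assumes "smooth_real f"
  shows "smooth_real (\<lambda>x. c * f (a * x + b))"
proof (rule smooth_real_coinduct)
  let ?S = "{(\<lambda>x. c * g (a * x + b)) | c g. smooth_real g}"
  show "(\<lambda>x. c * f (a * x + b)) \<in> ?S" using assms by blast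
  fix h assume "h \<in> ?S"
  then obtain c g where h: "h = (\<lambda>x. c * g (a * x + b))" and g: "smooth_real g" by blast
  have "(h has_real_derivative (c * a) * deriv g (a * x + b)) (at x)" for x
  proof -
    have 1: "((\<lambda>x. a * x + b) has_real_derivative a) (at x)"
      by (auto intro!: derivative_eq_intros)
    show ?thesis unfolding h
      using DERIV_cmult[OF DERIV_chain2[OF smooth_real_deriv(2)[OF g] 1], of c] by (simp add: mult_ac)
  qed
  then show "\<exists>h'\<in>?S. \<forall>x. (h has_real_derivative h' x) (at x)"
    using smooth_real_deriv(1)[OF g]
    by (intro bexI[of _ "\<lambda>x. (c * a) * deriv g (a * x + b)"]) auto
qed

lemma smooth_real_id: "smooth_real (\<lambda>x. x)"
  by (rule smooth_real_coinduct[of _ "insert (\<lambda>x. x) (range (\<lambda>c x. c))"])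
     (auto intro!: derivative_eq_intros)

section \<open>A smooth ramp built from exp(-1/t)\<close>

definition flat_exp :: "real poly \<Rightarrow> real \<Rightarrow> real" where
  "flat_exp p t = (if t > 0 then poly p (1 / t) * exp (- (1 / t)) else 0)"

lemma poly_times_exp_minus_tendsto_0:
  "((\<lambda>y::real. poly p y * exp (- y)) \<longlongrightarrow> 0) at_top"
proof -
  have "((\<lambda>y. \<Sum>i\<le>degree p. coeff p i * (y ^ i / exp y)) \<longlongrightarrow> (\<Sum>i\<le>degree p. coeff p i * 0)) at_top"
    by (intro tendsto_intros tendsto_power_div_exp_0)
  then show ?thesis
    by (simp add: poly_altdef exp_minus divide_inverse sum_distrib_right mult.assoc)
qed

lemma flat_exp_tendsto_0: "(flat_exp p \<longlongrightarrow> 0) (at 0)"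
proof -
  have "((\<lambda>t. poly p (1 / t) * exp (- (1 / t))) \<longlongrightarrow> 0) (at_right 0)"
    using filterlim_compose[OF poly_times_exp_minus_tendsto_0[of p] filterlim_inverse_at_top_right]
    by (simp add: divide_inverse)
  then have R: "(flat_exp p \<longlongrightarrow> 0) (at_right 0)"
    by (rule tendsto_cong[THEN iffD1, rotated])
       (auto simp: flat_exp_def eventually_at_filter)
  have L: "(flat_exp p \<longlongrightarrow> 0) (at_left 0)"
    by (rule tendsto_cong[THEN iffD1, OF _ tendsto_const])
       (auto simp: flat_exp_def eventually_at_filter)
  show ?thesis using L R by (simp add: filterlim_split_at)
qed

text \<open>With y = 1/t, the chain rule turns p(y) exp(-y) into y^2 (p(y) - p'(y)) exp(-y), so
  carrying a polynomial along closes the family under differentiation. At 0 the difference quotient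
  is \<open>flat_exp\<close> of y p(y), which tends to 0.\<close>

lemma flat_exp_has_derivative:
  "(flat_exp p has_real_derivative flat_exp ([:0,0,1:] * (p - pderiv p)) x) (at x)"
proof (cases x "0::real" rule: linorder_cases)
  case less
  have "((\<lambda>_. 0) has_real_derivative flat_exp ([:0,0,1:] * (p - pderiv p)) x) (at x)"
    using less by (auto simp: flat_exp_def)
  then show ?thesis
    by (rule has_field_derivative_transform_within_open[of _ _ _ "{..<0}"])
       (use less in \<open>auto simp: flat_exp_def\<close>)
next
  case equal
  have "((\<lambda>h. (flat_exp p (0 + h) - flat_exp p 0) / h) \<longlongrightarrow> 0) (at 0)"
  proof (rule tendsto_cong[THEN iffD1, OF _ flat_exp_tendsto_0[of "[:0,1:] * p"]])
    show "\<forall>\<^sub>F h in at 0. flat_exp ([:0, 1:] * p) h = (flat_exp p (0 + h) - flat_exp p 0) / h"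
      by (auto simp: flat_exp_def eventually_at_filter)
  qed
  then show ?thesis using equal by (simp add: DERIV_def flat_exp_def)
next
  case greater
  have "((\<lambda>t. poly p (1 / t) * exp (- (1 / t))) has_real_derivative
          flat_exp ([:0,0,1:] * (p - pderiv p)) x) (at x)"
    using greater
    by (auto intro!: derivative_eq_intros DERIV_chain2[OF poly_DERIV]
             simp: flat_exp_def field_simps power2_eq_square)
  then show ?thesis
    by (rule has_field_derivative_transform_within_open[of _ _ _ "{0<..}"])
       (use greater in \<open>auto simp: flat_exp_def\<close>)
qed

lemma smooth_real_flat_exp: "smooth_real (flat_exp p)"
  by (rule smooth_real_coinduct[of _ "range flat_exp"]) (use flat_exp_has_derivative in blast)+

text \<open>The ramp is t times the smooth step h(t) / (h(t) + h(1 - t)), which is 0 left of 0 and 1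
  right of 1.\<close>

lemma smooth_ramp_exists:
  obtains U :: "real \<Rightarrow> real" where "smooth_real U"
    "\<And>t. t \<le> 0 \<Longrightarrow> U t = 0" "\<And>t. t \<ge> 1 \<Longrightarrow> U t = t" "\<And>t. \<bar>U t - max t 0\<bar> \<le> 1"
proof -
  define h where "h = flat_exp 1"
  define U where "U t = t * (h t * inverse (h t + h (1 - t)))" for t
  have h: "smooth_real h" unfolding h_def by (rule smooth_real_flat_exp)
  have h0: "h t \<ge> 0" "t \<le> 0 \<Longrightarrow> h t = 0" "t > 0 \<Longrightarrow> h t > 0" for t
    by (auto simp: h_def flat_exp_def)
  have pos: "h t + h (1 - t) > 0" for t
    using h0(1)[of t] h0(1)[of "1 - t"] h0(3)[of t] h0(3)[of "1-t"] by linarith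
  have "smooth_real (\<lambda>t. h (1 - t))" using smooth_real_affine[OF h, of 1 "-1" 1] by simp
  then have "smooth_real U" unfolding U_def
    using pos h by (intro smooth_real_mult smooth_real_id smooth_real_inverse smooth_real_add)
      (auto simp: less_le)
  moreover have "U t = 0" if "t \<le> 0" for t using that by (simp add: U_def h0)
  moreover have "U t = t" if "t \<ge> 1" for t
    using that pos[of t] by (simp add: U_def h0 less_le)
  moreover have "\<bar>U t - max t 0\<bar> \<le> 1" for t
  proof -
    consider "t \<le> 0" | "t \<ge> 1" | "0 < t" "t < 1" by linarith
    then show ?thesis
    proof cases
      case 3
      let ?r = "h t * inverse (h t + h (1 - t))"
      have "0 \<le> ?r" "?r \<le> 1" using pos[of t] h0(1)[of t] h0(1)[of "1-t"]
        by (auto simp: divide_inverse[symmetric] divide_simps)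
      then have "0 \<le> t * ?r" "t * ?r \<le> 1" using 3 mult_mono[of t 1 ?r 1] by auto
      then show ?thesis using 3 by (auto simp: U_def)
    qed (use calculation in auto)
  qed
  ultimately show thesis by (rule that)
qed

subsection \<open>Tensor products as test functions\<close>

lemma tensor_has_derivative_along_axis:
  fixes h :: "'n::finite \<Rightarrow> real \<Rightarrow> real"
  assumes "smooth_real (h i)"
  shows "((\<lambda>s. \<Prod>j\<in>UNIV. h j ((x + s *\<^sub>R axis i 1) $ j)) has_real_derivative
           (\<Prod>j\<in>UNIV. (if j = i then deriv (h j) else h j) (x $ j))) (at 0)"
proof -
  have 1: "(\<Prod>j\<in>UNIV. h j ((x + s *\<^sub>R axis i 1) $ j)) =
      h i (x $ i + s) * (\<Prod>j\<in>UNIV - {i}. h j (x $ j))" for s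
    by (subst prod.remove[of _ i]) (auto simp: axis_def intro!: prod.cong)
  have 2: "(\<Prod>j\<in>UNIV. (if j = i then deriv (h j) else h j) (x $ j)) =
      deriv (h i) (x $ i) * (\<Prod>j\<in>UNIV - {i}. h j (x $ j))"
    by (subst prod.remove[of _ i]) (auto intro!: prod.cong)
  have "((\<lambda>s. h i (x $ i + s)) has_real_derivative deriv (h i) (x $ i)) (at 0)"
    using smooth_real_deriv(2)[OF assms, of "x $ i"] DERIV_shift[of "h i" _ 0 "x $ i"]
    by (simp add: add.commute)
  then show ?thesis unfolding 1 2 by (rule DERIV_cmult_right)
qed

lemma partials_tensor:
  fixes \<psi> :: "'n::finite \<Rightarrow> real \<Rightarrow> real"
  assumes "\<And>j. smooth_real (\<psi> j)"
  shows "partials is (\<lambda>t. \<Prod>j\<in>UNIV. \<psi> j (t $ j)) =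
    (\<lambda>t. \<Prod>j\<in>UNIV. (deriv ^^ count_list is j) (\<psi> j) (t $ j))"
proof (induction "is")
  case Nil
  then show ?case by simp
next
  case (Cons i "is")
  let ?h = "\<lambda>j. (deriv ^^ count_list is j) (\<psi> j)"
  have "deriv (\<lambda>s. \<Prod>j\<in>UNIV. ?h j ((x + s *\<^sub>R axis i 1) $ j)) 0 =
     (\<Prod>j\<in>UNIV. (if j = i then deriv (?h j) else ?h j) (x $ j))" for x
    by (intro DERIV_imp_deriv tensor_has_derivative_along_axis smooth_real_funpow_deriv assms)
  then show ?case
    by (auto simp: Cons.IH partial_def fun_eq_iff intro!: prod.cong)
qed

lemma smooth_fun_tensor:
  fixes \<psi> :: "'n::finite \<Rightarrow> real \<Rightarrow> real"
  assumes "\<And>j. smooth_real (\<psi> j)"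
  shows "smooth_fun (\<lambda>t. \<Prod>j\<in>UNIV. \<psi> j (t $ j))"
  unfolding smooth_fun_def partials_tensor[of \<psi>, OF assms]
proof (intro allI conjI)
  fix "is" :: "'n list" and i and x :: "real^'n"
  let ?h = "\<lambda>j. (deriv ^^ count_list is j) (\<psi> j)"
  have sm: "smooth_real (?h j)" for j by (intro smooth_real_funpow_deriv assms)
  show "continuous_on UNIV (\<lambda>t. \<Prod>j\<in>UNIV. ?h j (t $ j))"
    by (intro continuous_intros continuous_on_compose2[OF smooth_real_continuous[OF sm, of UNIV]]) auto
  show "(\<lambda>s. \<Prod>j\<in>UNIV. ?h j ((x + s *\<^sub>R axis i 1) $ j)) differentiable (at 0)"
    using tensor_has_derivative_along_axis[of ?h i x, OF sm]
    by (auto simp: real_differentiable_def)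
qed

text \<open>Iterated partials of a tensor product depend on the list of indices only through its
  counts, so the choice by \<open>SOME\<close> in \<open>mixed_partial\<close> is harmless once a
  list with these counts exists.\<close>

lemma mixed_partial_tensor:
  fixes \<psi> :: "'n::finite \<Rightarrow> real \<Rightarrow> real"
  assumes "\<And>j. smooth_real (\<psi> j)"
  shows "mixed_partial \<alpha> (\<lambda>t. \<Prod>j\<in>UNIV. \<psi> j (t $ j)) =
    (\<lambda>t. \<Prod>j\<in>UNIV. (deriv ^^ \<alpha> j) (\<psi> j) (t $ j))"
proof -
  obtain xs where xs: "mset xs = (\<Sum>i\<in>UNIV. replicate_mset (\<alpha> i) i)" using ex_mset by blast
  have "count_list xs i = \<alpha> i" for i
    using arg_cong[OF xs, of "\<lambda>M. count M i"]
    by (simp add: count_mset count_sum)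
  then have "\<exists>is. \<forall>i. count_list is i = \<alpha> i" by blast
  then have "\<forall>i. count_list (SOME is. \<forall>i. count_list is i = \<alpha> i) i = \<alpha> i" by (rule someI_ex)
  then show ?thesis unfolding mixed_partial_def partials_tensor[of \<psi>, OF assms] by simp
qed

lemma test_fun_tensor:
  fixes \<psi> :: "'n::finite \<Rightarrow> real \<Rightarrow> real"
  assumes "\<And>j. smooth_real (\<psi> j)" and "0 < a" "b < 1"
    and supp: "\<And>j t. t \<notin> {a..b} \<Longrightarrow> \<psi> j t = 0"
  shows "test_fun unit_cube (\<lambda>t. \<Prod>j\<in>UNIV. \<psi> j (t $ j))"
proof -
  let ?\<Phi> = "\<lambda>t::real^'n. \<Prod>j\<in>UNIV. \<psi> j (t $ j)"
  let ?K = "cbox (\<chi> i. a) (\<chi> i. b) :: (real^'n) set"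
  have "{t. ?\<Phi> t \<noteq> 0} \<subseteq> ?K"
  proof
    fix t assume "t \<in> {t. ?\<Phi> t \<noteq> 0}"
    then have "\<psi> j (t $ j) \<noteq> 0" for j by simp
    then have "t $ j \<in> {a..b}" for j using supp by blast
    then show "t \<in> ?K" by (simp add: mem_box_cart)
  qed
  then have cl: "closure {t. ?\<Phi> t \<noteq> 0} \<subseteq> ?K" by (rule closure_minimal) (rule closed_cbox)
  then have "compact (closure {t. ?\<Phi> t \<noteq> 0})"
    unfolding compact_eq_bounded_closed using bounded_subset[OF bounded_cbox cl] by simp
  moreover have "?K \<subseteq> interior unit_cube"
  proof
    fix t assume "t \<in> ?K"
    then have "a \<le> t $ i" "t $ i \<le> b" for i by (auto simp: mem_box_cart)
    then have "0 < t $ i" "t $ i < 1" for i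
      using assms(2,3) less_le_trans le_less_trans by blast+
    then show "t \<in> interior unit_cube"
      unfolding unit_cube_def interior_cbox by (auto simp: mem_box_cart)
  qed
  ultimately show ?thesis
    using cl smooth_fun_tensor[of \<psi>, OF assms(1)] by (auto simp: test_fun_def)
qed

text \<open>Fubini's theorem in coordinates: \<open>lborel\<close> on the vector type is the image
  of the product measure over \<open>Basis\<close>, whose elements are the axis vectors.\<close>

lemma lborel_tensor:
  fixes f :: "'n::finite \<Rightarrow> real \<Rightarrow> real"
  assumes "\<And>j. integrable lborel (f j)"
  shows integrable_lborel_tensor: "integrable lborel (\<lambda>x::real^'n. \<Prod>j\<in>UNIV. f j (x $ j))"
    and integral_lborel_tensor:
      "integral\<^sup>L lborel (\<lambda>x::real^'n. \<Prod>j\<in>UNIV. f j (x $ j)) = (\<Prod>j\<in>UNIV. integral\<^sup>L lborel (f j))"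
proof -
  interpret product_sigma_finite "\<lambda>_::real^'n. lborel :: real measure" ..
  let ?ax = "\<lambda>j::'n. axis j (1::real)"
  have inj: "inj ?ax" by (auto simp: inj_def axis_eq_axis)
  have B: "Basis = range ?ax" by (auto simp: Basis_vec_def)
  define F where "F b = f (inv ?ax b)" for b
  have F: "F (?ax j) = f j" for j by (simp add: F_def inv_f_f[OF inj])
  have int: "integrable lborel (F b)" for b using assms by (simp add: F_def)
  have meas: "F b \<in> borel_measurable borel" "f j \<in> borel_measurable borel" for b j
    using int[of b] assms[of j] by auto
  have sumB: "(\<Sum>b\<in>Basis. g b *\<^sub>R b) $ j = g (?ax j)" for g :: "real^'n \<Rightarrow> real" and j
  proof -
    have "(\<Sum>b\<in>Basis. g b *\<^sub>R b) $ j = (\<Sum>i\<in>UNIV. g (?ax i) * ?ax i $ j)"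
      unfolding B sum.reindex[OF inj] by (simp only: o_def sum_component vector_scaleR_component real_scaleR_def)
    also have "\<dots> = (\<Sum>i\<in>UNIV. if i = j then g (?ax i) else 0)"
      by (intro sum.cong refl) (auto simp: axis_def)
    finally show ?thesis by simp
  qed
  have eq: "(\<Prod>j\<in>UNIV. f j ((\<Sum>b\<in>Basis. g b *\<^sub>R b) $ j)) = (\<Prod>b\<in>Basis. F b (g b))" for g
    unfolding sumB unfolding B by (simp add: prod.reindex[OF inj] F)
  have T: "(\<lambda>g. \<Sum>b\<in>Basis. g b *\<^sub>R b) \<in> (\<Pi>\<^sub>M b\<in>Basis. (lborel :: real measure)) \<rightarrow>\<^sub>M (borel :: (real^'n) measure)"
    by measurable
  have m: "(\<lambda>x::real^'n. \<Prod>j\<in>UNIV. f j (x $ j)) \<in> borel_measurable borel"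
    by (intro borel_measurable_prod measurable_compose[OF _ meas(2)] borel_measurable_continuous_onI
        continuous_intros)
  show "integrable lborel (\<lambda>x::real^'n. \<Prod>j\<in>UNIV. f j (x $ j))"
    by (subst lborel_eq, subst integrable_distr_eq[OF T m], unfold eq, rule product_integrable_prod)
       (auto intro: int)
  have "integral\<^sup>L lborel (\<lambda>x::real^'n. \<Prod>j\<in>UNIV. f j (x $ j)) = (\<Prod>b\<in>Basis. integral\<^sup>L lborel (F b))"
    by (subst lborel_eq, subst integral_distr[OF T m], unfold eq, rule product_integral_prod)
       (auto intro: int)
  then show "integral\<^sup>L lborel (\<lambda>x::real^'n. \<Prod>j\<in>UNIV. f j (x $ j)) = (\<Prod>j\<in>UNIV. integral\<^sup>L lborel (f j))"
    unfolding B by (simp add: prod.reindex[OF inj] F)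
qed

subsection \<open>The Green representation of Korobov functions\<close>

lemma lborel_integral_affine:
  fixes f :: "'a::euclidean_space \<Rightarrow> real"
  assumes [measurable]: "f \<in> borel_measurable borel" and c: "c > 0"
  shows "integral\<^sup>L lborel f = c ^ DIM('a) * integral\<^sup>L lborel (\<lambda>x. f (t + c *\<^sub>R x))"
proof -
  have 1: "integral\<^sup>L lborel f =
      integral\<^sup>L (density (distr lborel borel (\<lambda>x. t + c *\<^sub>R x)) (\<lambda>_. \<bar>c\<bar> ^ DIM('a))) f"
    using c by (intro arg_cong2[where f = "integral\<^sup>L"] lborel_affine) auto
  show ?thesis
    unfolding 1 using c
    by (subst integral_density, simp_all, subst integral_distr, simp_all)
qed

text \<open>Substituting t = y n + e n * s freezes the kernel and leaves F (y n + e n * s), which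
  converges pointwise by continuity. The dominating function uses the absolute value of
  \<open>\<rho>\<close>, because the second derivative of the ramp takes both signs. The centres
  depend on n because the outer knots do.\<close>

lemma mollifier_limit:
  fixes F :: "real^'n::finite \<Rightarrow> real"
  assumes F: "continuous_on UNIV F" and B: "\<And>x. \<bar>F x\<bar> \<le> B"
    and \<rho>: "continuous_on UNIV \<rho>" "integrable lborel \<rho>" "integral\<^sup>L lborel \<rho> = 1"
    and e: "\<And>n. e n > 0" "e \<longlonglongrightarrow> 0" and y: "y \<longlonglongrightarrow> y0"
  shows "(\<lambda>n. integral\<^sup>L lborel (\<lambda>t. F t * (\<Prod>j\<in>UNIV. \<rho> ((t $ j - y n $ j) / e n) / e n))) \<longlonglongrightarrow> F y0"
proof -
  have [measurable]: "F \<in> borel_measurable borel" "\<rho> \<in> borel_measurable borel"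
    by (auto intro: borel_measurable_continuous_onI F \<rho>)
  have [measurable]: "(\<lambda>t::real^'n. t $ j) \<in> borel_measurable borel" for j
    by (intro borel_measurable_continuous_onI continuous_intros)
  have subst: "integral\<^sup>L lborel (\<lambda>t. F t * (\<Prod>j\<in>UNIV. \<rho> ((t $ j - y n $ j) / e n) / e n)) =
      integral\<^sup>L lborel (\<lambda>s. F (y n + e n *\<^sub>R s) * (\<Prod>j\<in>UNIV. \<rho> (s $ j)))" for n
  proof -
    have en: "e n \<noteq> 0" using e(1)[of n] by simp
    have "integral\<^sup>L lborel (\<lambda>t. F t * (\<Prod>j\<in>UNIV. \<rho> ((t $ j - y n $ j) / e n) / e n)) =
      e n ^ DIM(real^'n) * integral\<^sup>L lborel (\<lambda>s. F (y n + e n *\<^sub>R s) *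
        (\<Prod>j\<in>UNIV. \<rho> (((y n + e n *\<^sub>R s) $ j - y n $ j) / e n) / e n))"
      by (rule lborel_integral_affine) (use e in auto)
    also have "\<dots> = e n ^ CARD('n) * integral\<^sup>L lborel (\<lambda>s. F (y n + e n *\<^sub>R s) *
        (\<Prod>j\<in>UNIV. \<rho> (s $ j)) / e n ^ CARD('n))"
      using en by (simp add: prod_dividef)
    finally show ?thesis using en by simp
  qed
  have "(\<lambda>n. integral\<^sup>L lborel (\<lambda>s. F (y n + e n *\<^sub>R s) * (\<Prod>j\<in>UNIV. \<rho> (s $ j)))) \<longlonglongrightarrow>
      integral\<^sup>L lborel (\<lambda>s::real^'n. F y0 * (\<Prod>j\<in>UNIV. \<rho> (s $ j)))"
  proof (rule integral_dominated_convergence[where w = "\<lambda>s::real^'n. B * (\<Prod>j\<in>UNIV. \<bar>\<rho> (s $ j)\<bar>)"])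
    show "integrable lborel (\<lambda>s::real^'n. B * (\<Prod>j\<in>UNIV. \<bar>\<rho> (s $ j)\<bar>))"
      using \<rho>(2) by (intro integrable_mult_right integrable_lborel_tensor) auto
    have "(\<lambda>n. F (y n + e n *\<^sub>R s)) \<longlonglongrightarrow> F y0" for s
    proof (rule isCont_tendsto_compose[of y0 F])
      show "isCont F y0" using F by (simp add: continuous_on_eq_continuous_at)
      show "(\<lambda>n. y n + e n *\<^sub>R s) \<longlonglongrightarrow> y0"
        using tendsto_add[OF y tendsto_scaleR[OF e(2) tendsto_const[of s]]] by simp
    qed
    then show "AE s in lborel. (\<lambda>n. F (y n + e n *\<^sub>R s) * (\<Prod>j\<in>UNIV. \<rho> (s $ j)))
        \<longlonglongrightarrow> F y0 * (\<Prod>j\<in>UNIV. \<rho> (s $ j))"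
      by (intro AE_I2 tendsto_mult tendsto_const)
    show "AE s in lborel. norm (F (y n + e n *\<^sub>R s) * (\<Prod>j\<in>UNIV. \<rho> (s $ j)))
        \<le> B * (\<Prod>j\<in>UNIV. \<bar>\<rho> (s $ j)\<bar>)" for n
      by (intro AE_I2) (auto simp: abs_mult abs_prod intro!: mult_right_mono B prod_nonneg)
  qed measurable
  also have "integral\<^sup>L lborel (\<lambda>s::real^'n. F y0 * (\<Prod>j\<in>UNIV. \<rho> (s $ j))) = F y0"
    using integral_lborel_tensor[of "\<lambda>_::'n. \<rho>"] \<rho> by simp
  finally show ?thesis unfolding subst .
qed

text \<open>The zero boundary values make the extension continuous across the frontier. This is what
  permits mollifying at boundary points later.\<close>

lemma zero_extension:
  fixes g :: "real^'n::finite \<Rightarrow> real"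
  assumes "continuous_on unit_cube g" "\<forall>x\<in>frontier unit_cube. g x = 0"
  defines "F \<equiv> \<lambda>x. if x \<in> unit_cube then g x else 0"
  shows "continuous_on UNIV F" "\<exists>B. \<forall>x. \<bar>F x\<bar> \<le> B"
proof -
  have "continuous_on (unit_cube \<union> - interior unit_cube) F"
    unfolding F_def
    by (rule continuous_on_cases)
       (use assms in \<open>auto simp: unit_cube_def frontier_def closed_Compl\<close>)
  moreover have "unit_cube \<union> - interior unit_cube = (UNIV :: (real^'n) set)"
    using interior_subset by blast
  ultimately show "continuous_on UNIV F" by simp
  have "bounded (g ` unit_cube)"
    using assms(1) by (intro compact_imp_bounded compact_continuous_image) (auto simp: unit_cube_def)
  then obtain B where "\<forall>x\<in>unit_cube. \<bar>g x\<bar> \<le> B" by (auto simp: bounded_iff)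
  then have "\<forall>x. \<bar>F x\<bar> \<le> max B 0" by (auto simp: F_def max_def)
  then show "\<exists>B. \<forall>x. \<bar>F x\<bar> \<le> B" by blast
qed

section \<open>A ramp whose second derivative is a mollifier\<close>

lemma smooth_ramp_mollifier:
  obtains U \<rho> :: "real \<Rightarrow> real" where "smooth_real U"
    "\<And>t. t \<le> 0 \<Longrightarrow> U t = 0" "\<And>t. t \<ge> 1 \<Longrightarrow> U t = t" "\<And>t. \<bar>U t - max t 0\<bar> \<le> 1"
    "\<And>t. (U has_real_derivative deriv U t) (at t)" "\<And>t. (deriv U has_real_derivative \<rho> t) (at t)"
    "continuous_on UNIV \<rho>" "integrable lborel \<rho>" "integral\<^sup>L lborel \<rho> = 1"
proof -
  obtain U :: "real \<Rightarrow> real" where U: "smooth_real U"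
    "\<And>t. t \<le> 0 \<Longrightarrow> U t = 0" "\<And>t. t \<ge> 1 \<Longrightarrow> U t = t" "\<And>t. \<bar>U t - max t 0\<bar> \<le> 1"
    using smooth_ramp_exists by blast
  define \<rho> where "\<rho> = deriv (deriv U)"
  have U1: "(U has_real_derivative deriv U t) (at t)" for t using smooth_real_deriv[OF U(1)] by auto
  have U2: "(deriv U has_real_derivative \<rho> t) (at t)" for t
    using smooth_real_deriv(2)[OF smooth_real_deriv(1)[OF U(1)]] by (auto simp: \<rho>_def)
  have c: "continuous_on UNIV \<rho>"
    unfolding \<rho>_def by (intro smooth_real_continuous smooth_real_deriv U)
  have l: "deriv U t = 0" if "t < 0" for t
  proof -
    have "((\<lambda>_. 0) has_real_derivative deriv U t) (at t)"
      by (rule has_field_derivative_transform_within_open[OF U1, where S = "{..<0}"]) (use that U in auto)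
    then show ?thesis using DERIV_const DERIV_unique by blast
  qed
  have r: "deriv U t = 1" if "t > 1" for t
  proof -
    have "((\<lambda>t. t) has_real_derivative deriv U t) (at t)"
      by (rule has_field_derivative_transform_within_open[OF U1, where S = "{1<..}"]) (use that U in auto)
    then show ?thesis using DERIV_ident DERIV_unique by blast
  qed
  have \<rho>l: "\<rho> t = 0" if "t < 0" for t
  proof -
    have "((\<lambda>_. 0) has_real_derivative \<rho> t) (at t)"
      by (rule has_field_derivative_transform_within_open[OF U2, where S = "{..<0}"]) (use that l in auto)
    then show ?thesis using DERIV_const DERIV_unique by blast
  qed
  have \<rho>r: "\<rho> t = 0" if "t > 1" for t
  proof -
    have "((\<lambda>_. 1) has_real_derivative \<rho> t) (at t)"
      by (rule has_field_derivative_transform_within_open[OF U2, where S = "{1<..}"]) (use that r in auto)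
    then show ?thesis using DERIV_const DERIV_unique by blast
  qed
  \<comment> \<open>The mass of \<open>\<rho>\<close> is the total increase of the slope of
    \<open>U\<close>, from 0 to 1. The slopes are known strictly outside [0,1] only, hence the
    larger interval.\<close>
  have "has_bochner_integral lborel (\<lambda>x. \<rho> x * indicator {-1..2} x) (deriv U 2 - deriv U (-1))"
    by (rule has_bochner_integral_FTC_Icc_real)
       (use U2 c in \<open>auto simp: continuous_on_eq_continuous_at\<close>)
  moreover have "(\<lambda>x. \<rho> x * indicator {-1..2} x) = \<rho>"
  proof
    fix x show "\<rho> x * indicator {-1..2} x = \<rho> x"
      using \<rho>l[of x] \<rho>r[of x] by (cases "x < 0"; cases "x > 1") (auto simp: indicator_def)
  qed
  ultimately have "has_bochner_integral lborel \<rho> 1" using l[of "-1"] r[of 2] by simp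
  then have "integrable lborel \<rho>" "integral\<^sup>L lborel \<rho> = 1"
    by (auto simp: has_bochner_integral_iff)
  then show thesis using that U U1 U2 c by blast
qed

section \<open>Smoothed Green's functions as test functions\<close>

text \<open>The Green's function of -u'' on (0,1) with zero boundary values, cut off to 0 outside
  the unit square. The cutoff lets rescaled copies on all dyadic subintervals be summed without case
  distinctions.\<close>

definition green :: "real \<Rightarrow> real \<Rightarrow> real" where
  "green x t = max 0 (min x t) * max 0 (1 - max x t)"

text \<open>The knots \<open>e, x, 1 - 2e\<close> of a slightly shrunk Green's function, with the jumps of its slope
  there; a smooth ramp of scale \<open>e\<close> put at each knot gives a test function.\<close>

definition knot :: "real \<Rightarrow> real \<Rightarrow> nat \<Rightarrow> real" where
  "knot e x c = (if c = 0 then e else if c = 1 then x else 1 - 2 * e)"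

definition slope_jump :: "real \<Rightarrow> real \<Rightarrow> nat \<Rightarrow> real" where
  "slope_jump e x c = (if c = 0 then (1 - 2 * e - x) / (1 - 3 * e) else if c = 1 then -1
     else (x - e) / (1 - 3 * e))"

definition smooth_green :: "(real \<Rightarrow> real) \<Rightarrow> real \<Rightarrow> real \<Rightarrow> real \<Rightarrow> real" where
  "smooth_green U e x t = (\<Sum>c<3. slope_jump e x c * (e * U ((t - knot e x c) / e)))"

lemma sum_lessThan_3: "(\<Sum>c<3. f c) = f 0 + f 1 + f (2::nat)" for f :: "nat \<Rightarrow> real"
  by (simp add: numeral_3_eq_3 numeral_2_eq_2)

lemma smooth_real_smooth_green:
  assumes "smooth_real U"
  shows "smooth_real (smooth_green U e x)"
proof -
  have "smooth_real (\<lambda>t. slope_jump e x c * (e * U ((t - knot e x c) / e)))" for c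
    using smooth_real_affine[OF assms, of "slope_jump e x c * e" "1 / e" "- knot e x c / e"]
    by (simp add: mult.assoc diff_divide_distrib)
  then show ?thesis
    unfolding smooth_green_def[abs_def] sum_lessThan_3 by (intro smooth_real_add)
qed

text \<open>The factor e in front of the ramp cancels one of the two factors 1/e from the chain
  rule, which leaves normalised mollifiers at the knots.\<close>

lemma deriv2_smooth_green:
  assumes U: "\<And>t. (U has_real_derivative deriv U t) (at t)"
    and U2: "\<And>t. (deriv U has_real_derivative \<rho> t) (at t)" and e: "e > 0"
  shows "(deriv ^^ 2) (smooth_green U e x) t =
     (\<Sum>c<3. slope_jump e x c * (\<rho> ((t - knot e x c) / e) / e))"
proof -
  have inner: "((\<lambda>t. (t - k) / e) has_real_derivative 1 / e) (at t)" for k t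
    using e by (auto intro!: derivative_eq_intros)
  have 1: "deriv (smooth_green U e x) = (\<lambda>t. \<Sum>c<3. slope_jump e x c * deriv U ((t - knot e x c) / e))"
  proof
    fix t
    have "((\<lambda>t. slope_jump e x c * (e * U ((t - knot e x c) / e))) has_real_derivative
       slope_jump e x c * deriv U ((t - knot e x c) / e)) (at t)" for c
      using DERIV_cmult[OF DERIV_cmult[OF DERIV_chain2[OF U inner], of e], of "slope_jump e x c" "knot e x c" t] e
      by simp
    then show "deriv (smooth_green U e x) t = (\<Sum>c<3. slope_jump e x c * deriv U ((t - knot e x c) / e))"
      unfolding smooth_green_def[abs_def] by (intro DERIV_imp_deriv DERIV_sum)
  qed
  have "((\<lambda>t. slope_jump e x c * deriv U ((t - knot e x c) / e)) has_real_derivative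
       slope_jump e x c * (\<rho> ((t - knot e x c) / e) / e)) (at t)" for c
    using DERIV_cmult[OF DERIV_chain2[OF U2 inner], of "slope_jump e x c" "knot e x c"] by simp
  then have "deriv (deriv (smooth_green U e x)) t =
     (\<Sum>c<3. slope_jump e x c * (\<rho> ((t - knot e x c) / e) / e))"
    unfolding 1 by (intro DERIV_imp_deriv DERIV_sum)
  then show ?thesis by (simp add: numeral_2_eq_2)
qed

text \<open>From distance e past its knot on, each ramp equals t - knot; the slope jumps have sum 0
  and first moment 0, so the combination vanishes there. The last knot is 1 - 2e so that its
  transition ends at 1 - e, still inside the cube.\<close>

lemma smooth_green_support:
  assumes "\<And>t. t \<le> 0 \<Longrightarrow> U t = 0" "\<And>t. t \<ge> 1 \<Longrightarrow> U t = t"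
    and e: "0 < e" "e < x" "x < 1 - 2 * e" and t: "t \<notin> {e..1 - e}"
  shows "smooth_green U e x t = 0"
proof (cases "t < e")
  case True
  then have "(t - knot e x c) / e \<le> 0" for c using e by (auto simp: knot_def divide_simps)
  then show ?thesis using assms(1) by (simp add: smooth_green_def)
next
  case False
  then have t: "t > 1 - e" using t by auto
  have ne: "1 - 3 * e > 0" using e by linarith
  have "(t - knot e x c) / e \<ge> 1" for c using e t by (auto simp: knot_def field_simps)
  then have "smooth_green U e x t = (\<Sum>c<3. slope_jump e x c * (t - knot e x c))"
    using assms(2) e by (simp add: smooth_green_def)
  also have "\<dots> = 0" using ne by (simp add: sum_lessThan_3 knot_def slope_jump_def divide_simps) algebra
  finally show ?thesis .
qed

lemma scaled_ramp_error:
  assumes "\<And>t. \<bar>U t - max t 0\<bar> \<le> 1" and "e > 0"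
  shows "\<bar>e * U (s / e) - max s 0\<bar> \<le> (e::real)"
proof -
  have "max s 0 = e * max (s / e) 0" using assms(2) by (auto simp: max_def divide_simps)
  then have "\<bar>e * U (s / e) - max s 0\<bar> = e * \<bar>U (s / e) - max (s / e) 0\<bar>"
    using assms(2) by (simp add: abs_mult right_diff_distrib[symmetric])
  also have "\<dots> \<le> e * 1" using assms by (intro mult_left_mono) auto
  finally show ?thesis by simp
qed

text \<open>Three knots, each with a jump of size at most 1 and a ramp of size at most 1 + e \<le>
  2. What matters is that the bound is uniform in e, for dominated convergence.\<close>

lemma smooth_green_bound:
  assumes U: "\<And>t. \<bar>U t - max t 0\<bar> \<le> 1"
    and e: "0 < e" "e < x" "x < 1 - 2 * e" and t: "0 \<le> t" "t \<le> 1"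
  shows "\<bar>smooth_green U e x t\<bar> \<le> 6"
proof -
  have ne: "1 - 3 * e > 0" using e by linarith
  have w: "\<bar>slope_jump e x c\<bar> \<le> 1" for c
    using e ne by (auto simp: slope_jump_def abs_le_iff divide_simps)
  have k: "\<bar>t - knot e x c\<bar> \<le> 1" for c using e t by (auto simp: knot_def)
  have "\<bar>e * U ((t - knot e x c) / e)\<bar> \<le> 2" for c
    using scaled_ramp_error[OF U e(1), of "t - knot e x c"] e k[of c] by (auto simp: max_def split: if_splits)
  then have s: "\<bar>slope_jump e x c * (e * U ((t - knot e x c) / e))\<bar> \<le> 1 * 2" for c
    unfolding abs_mult[of "slope_jump e x c"] using w by (intro mult_mono) auto
  show ?thesis
    unfolding smooth_green_def sum_lessThan_3 using s[of 0] s[of 1] s[of 2] by linarith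
qed

text \<open>The scaled ramps converge to positive parts, and (1-x) t^+ - (t-x)^+ + x (t-1)^+ is the
  Green's function for t in [0,1].\<close>

lemma smooth_green_tendsto:
  assumes U: "\<And>t. \<bar>U t - max t 0\<bar> \<le> 1"
    and e: "\<And>n. e n > 0" "e \<longlonglongrightarrow> 0" and x: "0 < x" "x < 1" and t: "0 \<le> t" "t \<le> 1"
  shows "(\<lambda>n. smooth_green U (e n) x t) \<longlonglongrightarrow> green x t"
proof -
  have ramp: "(\<lambda>n. e n * U ((t - k n) / e n)) \<longlonglongrightarrow> max (t - k') 0" if "k \<longlonglongrightarrow> k'" for k k'
  proof -
    have "(\<lambda>n. e n * U ((t - k n) / e n) - max (t - k n) 0) \<longlonglongrightarrow> 0"
      using scaled_ramp_error[OF U e(1)] by (intro Lim_null_comparison[OF _ e(2)]) auto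
    moreover have "(\<lambda>n. max (t - k n) 0) \<longlonglongrightarrow> max (t - k') 0" by (intro tendsto_intros that)
    ultimately show ?thesis using tendsto_add by fastforce
  qed
  have "(\<lambda>n. 1 - 2 * e n) \<longlonglongrightarrow> 1 - 2 * 0" by (intro tendsto_intros e)
  then have k: "(\<lambda>n. 1 - 2 * e n) \<longlonglongrightarrow> 1" by simp
  have "(\<lambda>n. (1 - 2 * e n - x) / (1 - 3 * e n) * (e n * U ((t - e n) / e n))
      + -1 * (e n * U ((t - x) / e n))
      + (x - e n) / (1 - 3 * e n) * (e n * U ((t - (1 - 2 * e n)) / e n)))
    \<longlonglongrightarrow> (1 - 2 * 0 - x) / (1 - 3 * 0) * max (t - 0) 0 + -1 * max (t - x) 0
      + (x - 0) / (1 - 3 * 0) * max (t - 1) 0"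
    by (intro tendsto_intros ramp e k) auto
  moreover have "(1 - 2 * 0 - x) / (1 - 3 * 0) * max (t - 0) 0 + -1 * max (t - x) 0
      + (x - 0) / (1 - 3 * 0) * max (t - 1) 0 = green x t"
    using x t by (auto simp: green_def max_def min_def algebra_simps)
  ultimately show ?thesis
    by (simp add: smooth_green_def sum_lessThan_3 knot_def slope_jump_def)
qed

section \<open>Integrals over the cube and the representation formula\<close>

lemma unit_cube_lebesgue: "(unit_cube :: (real^'n::finite) set) \<in> sets lebesgue"
  "(unit_cube :: (real^'n::finite) set) \<in> sets borel"
  by (auto simp: unit_cube_def)

lemma integral_lebesgue_on_unit_cube:
  fixes h :: "real^'n::finite \<Rightarrow> real"
  assumes "(\<lambda>x. indicator unit_cube x * h x) \<in> borel_measurable borel"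
  shows "integral\<^sup>L (lebesgue_on unit_cube) h = integral\<^sup>L lborel (\<lambda>x. indicator unit_cube x * h x)"
proof -
  have "unit_cube \<inter> space lebesgue \<in> sets (lebesgue :: (real^'n) measure)"
    using unit_cube_lebesgue(1) by simp
  from integral_restrict_space[OF this, of h] show ?thesis
    using integral_completion[of "\<lambda>x. indicator unit_cube x * h x" lborel] assms by simp
qed

lemma measurable_lebesgue_on_continuous:
  fixes h :: "real^'n::finite \<Rightarrow> real"
  assumes "continuous_on unit_cube h"
  shows "h \<in> borel_measurable (lebesgue_on unit_cube)"
  using assms unit_cube_lebesgue by (intro continuous_imp_measurable_on_sets_lebesgue)

lemma integrable_scaled_mollifier:
  assumes "integrable lborel (\<rho> :: real \<Rightarrow> real)" and "e > 0"
  shows "integrable lborel (\<lambda>t. \<rho> ((t - k) / e) / e)"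
proof -
  have "integrable lborel (\<lambda>t. \<rho> (- k / e + (1 / e) * t))"
    using assms lborel_integrable_real_affine_iff[of "1 / e" \<rho> "- k / e"] by auto
  moreover have "(\<lambda>t. \<rho> (- k / e + (1 / e) * t)) = (\<lambda>t. \<rho> ((t - k) / e))"
    by (simp add: diff_divide_distrib)
  ultimately show ?thesis by simp
qed

lemma in_frontier_unit_cube:
  fixes x :: "real^'n::finite"
  assumes "x \<in> unit_cube" "x $ i = 0 \<or> x $ i = 1"
  shows "x \<in> frontier unit_cube"
proof -
  have "x \<notin> box 0 1"
    using assms(2) by (auto simp: mem_box_cart)
       (metis less_irrefl)+
  then show ?thesis using assms(1) by (simp add: frontier_def unit_cube_def interior_cbox)
qed

text \<open>Both sides of the weak derivative identity pass to the limit: the side of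
  \<open>f\<close> by mollification, the side of \<open>G\<close> by dominated convergence. The sign
  comes from the slope jump -1 at the knot x, once per coordinate.\<close>

lemma weak_deriv_green_representation:
  fixes f g G :: "real^'n::finite \<Rightarrow> real"
  assumes g: "continuous_on unit_cube g" "\<forall>x\<in>frontier unit_cube. g x = 0"
    and f: "f \<in> borel_measurable (lebesgue_on unit_cube)" "AE x in lebesgue_on unit_cube. f x = g x"
    and G: "integrable (lebesgue_on unit_cube) G" "weak_deriv unit_cube (\<lambda>_. 2) f G"
    and x: "x \<in> box 0 1"
  shows "g x = (-1) ^ CARD('n) *
    integral\<^sup>L (lebesgue_on unit_cube) (\<lambda>t. G t * (\<Prod>j\<in>UNIV. green (x $ j) (t $ j)))"
proof -
  obtain U \<rho> :: "real \<Rightarrow> real" where U: "smooth_real U"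
    "\<And>t. t \<le> 0 \<Longrightarrow> U t = 0" "\<And>t. t \<ge> 1 \<Longrightarrow> U t = t" "\<And>t. \<bar>U t - max t 0\<bar> \<le> 1"
    "\<And>t. (U has_real_derivative deriv U t) (at t)" "\<And>t. (deriv U has_real_derivative \<rho> t) (at t)"
    and \<rho>: "continuous_on UNIV \<rho>" "integrable lborel \<rho>" "integral\<^sup>L lborel \<rho> = 1"
    using smooth_ramp_mollifier by metis
  have [measurable]: "\<rho> \<in> borel_measurable borel" using \<rho> by simp
  have [measurable]: "(\<lambda>t::real^'n. t $ j) \<in> borel_measurable borel" for j
    by (intro borel_measurable_continuous_onI continuous_intros)
  have x01: "0 < x $ j" "x $ j < 1" for j using x by (auto simp: mem_box_cart)
  define F where "F x = (if x \<in> unit_cube then g x else 0)" for x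
  have F: "continuous_on UNIV F" and "\<exists>B. \<forall>x. \<bar>F x\<bar> \<le> B"
    using zero_extension[OF g] unfolding F_def[abs_def] by auto
  then obtain B where B: "\<And>x. \<bar>F x\<bar> \<le> B" by blast
  have [measurable]: "F \<in> borel_measurable borel" by (rule borel_measurable_continuous_onI[OF F])
  \<comment> \<open>A third of the distance from \<open>x\<close> to the boundary ensures that every
    scale e n satisfies e n < x and x < 1 - 2 e n in each coordinate.\<close>
  define \<delta> where "\<delta> = Min (range (\<lambda>j. min (x $ j) (1 - x $ j))) / 3"
  have \<delta>: "\<delta> > 0" using x01 by (auto simp: \<delta>_def)
  have "3 * \<delta> \<le> min (x $ j) (1 - x $ j)" for j unfolding \<delta>_def by (simp del: min.bounded_iff)
  then have \<delta>x: "3 * \<delta> \<le> x $ j" "3 * \<delta> \<le> 1 - x $ j" for j by auto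
  define e where "e n = \<delta> / real (Suc n)" for n
  have e0: "e n > 0" for n using \<delta> by (simp add: e_def)
  have e\<delta>: "e n \<le> \<delta>" for n using \<delta> by (simp add: e_def divide_simps)
  have elim: "e \<longlonglongrightarrow> 0" unfolding e_def[abs_def] by (rule LIMSEQ_Suc[OF lim_const_over_n])
  have ex: "e n < x $ j" "x $ j < 1 - 2 * e n" for n j
    using e0[of n] e\<delta>[of n] \<delta>x[of j] by linarith+
  let ?\<psi> = "\<lambda>n j. smooth_green U (e n) (x $ j)"
  let ?\<Phi> = "\<lambda>n t. \<Prod>j\<in>UNIV. ?\<psi> n j (t $ j)"
  have sm: "smooth_real (?\<psi> n j)" for n j by (intro smooth_real_smooth_green U)
  have test: "test_fun unit_cube (?\<Phi> n)" for n
    by (rule test_fun_tensor[of _ "e n" "1 - e n"])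
       (use e0 ex U sm in \<open>auto intro!: smooth_green_support\<close>)
  \<comment> \<open>A map \<open>\<sigma>\<close> picks one of the three knots in each coordinate;
    multiplying out the product of three-term sums gives one product of mollifiers for each
    \<open>\<sigma>\<close>.\<close>
  define S where "S = PiE (UNIV::'n set) (\<lambda>_. {..<3::nat})"
  have finS: "finite S" unfolding S_def by (intro finite_PiE) auto
  define Y where "Y n \<sigma> = (\<chi> j. knot (e n) (x $ j) (\<sigma> j))" for n \<sigma>
  define Y0 where "Y0 \<sigma> = (\<chi> j. knot 0 (x $ j) (\<sigma> j))" for \<sigma>
  let ?P = "\<lambda>n \<sigma> t. \<Prod>j\<in>UNIV. \<rho> ((t $ j - Y n \<sigma> $ j) / e n) / e n"
  have mixed: "mixed_partial (\<lambda>_. 2) (?\<Phi> n) t =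
      (\<Sum>\<sigma>\<in>S. (\<Prod>j\<in>UNIV. slope_jump (e n) (x $ j) (\<sigma> j)) * ?P n \<sigma> t)" for n t
    unfolding mixed_partial_tensor[of "?\<psi> n", OF sm] deriv2_smooth_green[OF U(5,6) e0] S_def
    by (subst prod_sum_PiE) (simp_all add: prod.distrib Y_def del: times_divide_eq_right)
  have intP: "integrable lborel (\<lambda>t. F t * ?P n \<sigma> t)" for n \<sigma>
  proof (rule Bochner_Integration.integrable_bound)
    show "integrable lborel (\<lambda>t. B * ?P n \<sigma> t)"
      by (intro integrable_mult_right integrable_lborel_tensor integrable_scaled_mollifier \<rho> e0)
    show "AE t in lborel. norm (F t * ?P n \<sigma> t) \<le> norm (B * ?P n \<sigma> t)"
      using order_trans[OF B abs_ge_self] by (intro AE_I2) (simp add: abs_mult mult_right_mono)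
  qed measurable
  have lhs: "integral\<^sup>L (lebesgue_on unit_cube) (\<lambda>t. f t * mixed_partial (\<lambda>_. 2) (?\<Phi> n) t) =
     (\<Sum>\<sigma>\<in>S. (\<Prod>j\<in>UNIV. slope_jump (e n) (x $ j) (\<sigma> j)) * integral\<^sup>L lborel (\<lambda>t. F t * ?P n \<sigma> t))"
    (is "?L = ?R") for n
  proof -
    have mc: "continuous_on A (mixed_partial (\<lambda>_. 2) (?\<Phi> n))" for A
      unfolding mixed_partial_tensor[of "?\<psi> n", OF sm]
      by (intro continuous_on_prod continuous_intros
          continuous_on_compose2[OF smooth_real_continuous[OF smooth_real_funpow_deriv[OF sm], of UNIV]]) auto
    note [measurable] = borel_measurable_continuous_onI[OF mc[of UNIV]]
    have "?L = integral\<^sup>L (lebesgue_on unit_cube) (\<lambda>t. g t * mixed_partial (\<lambda>_. 2) (?\<Phi> n) t)"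
    proof (rule integral_cong_AE)
      show "AE t in lebesgue_on unit_cube. f t * mixed_partial (\<lambda>_. 2) (?\<Phi> n) t
          = g t * mixed_partial (\<lambda>_. 2) (?\<Phi> n) t"
        using f(2) by eventually_elim simp
    qed (intro borel_measurable_times f measurable_lebesgue_on_continuous g mc)+
    also have "\<dots> = integral\<^sup>L lborel (\<lambda>t. F t * mixed_partial (\<lambda>_. 2) (?\<Phi> n) t)"
    proof -
      have eq: "(\<lambda>t. indicator unit_cube t * (g t * mixed_partial (\<lambda>_. 2) (?\<Phi> n) t)) =
          (\<lambda>t. F t * mixed_partial (\<lambda>_. 2) (?\<Phi> n) t)" by (auto simp: F_def)
      show ?thesis by (subst integral_lebesgue_on_unit_cube) (simp_all add: eq)
    qed
    also have "\<dots> = ?R"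
    proof -
      have "(\<lambda>t. F t * mixed_partial (\<lambda>_. 2) (?\<Phi> n) t) =
        (\<lambda>t. \<Sum>\<sigma>\<in>S. (\<Prod>j\<in>UNIV. slope_jump (e n) (x $ j) (\<sigma> j)) * (F t * ?P n \<sigma> t))"
        by (simp add: mixed sum_distrib_left mult_ac)
      then show ?thesis
        by (simp only: Bochner_Integration.integral_sum[OF integrable_mult_right[OF intP]]
            integral_mult_right_zero)
    qed
    finally show ?thesis .
  qed
  have lim1: "(\<lambda>n. integral\<^sup>L (lebesgue_on unit_cube) (\<lambda>t. f t * mixed_partial (\<lambda>_. 2) (?\<Phi> n) t)) \<longlonglongrightarrow>
     (\<Sum>\<sigma>\<in>S. (\<Prod>j\<in>UNIV. slope_jump 0 (x $ j) (\<sigma> j)) * F (Y0 \<sigma>))"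
    unfolding lhs
  proof (intro tendsto_sum tendsto_mult tendsto_prod)
    fix \<sigma> j
    have kn: "(\<lambda>n. knot (e n) (x $ j) (\<sigma> j)) \<longlonglongrightarrow> knot 0 (x $ j) (\<sigma> j)" for j
      unfolding knot_def using elim tendsto_diff[OF tendsto_const[of 1] tendsto_mult[OF tendsto_const[of 2] elim]]
      by auto
    show "(\<lambda>n. integral\<^sup>L lborel (\<lambda>t. F t * ?P n \<sigma> t)) \<longlonglongrightarrow> F (Y0 \<sigma>)"
      by (rule mollifier_limit[OF F B \<rho> e0 elim])
         (auto simp: Y_def Y0_def intro!: vec_tendstoI kn)
    have "(\<lambda>n. (1 - 2 * e n - x $ j) / (1 - 3 * e n)) \<longlonglongrightarrow> (1 - 2 * 0 - x $ j) / (1 - 3 * 0)"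
      "(\<lambda>n. (x $ j - e n) / (1 - 3 * e n)) \<longlonglongrightarrow> (x $ j - 0) / (1 - 3 * 0)"
      by (intro tendsto_intros elim; simp)+
    then show "(\<lambda>n. slope_jump (e n) (x $ j) (\<sigma> j)) \<longlonglongrightarrow> slope_jump 0 (x $ j) (\<sigma> j)"
      unfolding slope_jump_def by auto
  qed
  \<comment> \<open>Choosing the middle knot everywhere yields the point \<open>x\<close>. Any other
    choice puts a coordinate of the limit point at 0 or 1, where \<open>F\<close> vanishes.\<close>
  have single: "(\<Sum>\<sigma>\<in>S. (\<Prod>j\<in>UNIV. slope_jump 0 (x $ j) (\<sigma> j)) * F (Y0 \<sigma>)) = (-1) ^ CARD('n) * g x"
  proof -
    have "(\<Prod>j\<in>UNIV. slope_jump 0 (x $ j) (\<sigma> j)) * F (Y0 \<sigma>) =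
        (if \<sigma> = (\<lambda>_. 1) then (-1) ^ CARD('n) * g x else 0)" for \<sigma>
    proof (cases "\<sigma> = (\<lambda>_. 1)")
      case True
      then have "Y0 \<sigma> = x" by (simp add: Y0_def knot_def vec_eq_iff)
      moreover have "x \<in> unit_cube" using x box_subset_cbox by (auto simp: unit_cube_def)
      ultimately show ?thesis using True by (simp add: slope_jump_def F_def)
    next
      case False
      then obtain i where "\<sigma> i \<noteq> 1" by auto
      then have i: "Y0 \<sigma> $ i = 0 \<or> Y0 \<sigma> $ i = 1" by (auto simp: Y0_def knot_def)
      have "F (Y0 \<sigma>) = 0"
        using in_frontier_unit_cube[OF _ i] g(2) by (auto simp: F_def)
      then show ?thesis using False by simp
    qed
    moreover have "(\<lambda>_. 1) \<in> S" by (auto simp: S_def)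
    ultimately show ?thesis using finS by simp
  qed
  have G': "G \<in> borel_measurable (lebesgue_on unit_cube)" using G by auto
  have mPhi: "?\<Phi> n \<in> borel_measurable (lebesgue_on unit_cube)" for n
    by (intro measurable_lebesgue_on_continuous continuous_on_prod
        continuous_on_compose2[OF smooth_real_continuous[OF sm, of UNIV]] continuous_intros) auto
  have mgreen: "(\<lambda>t. \<Prod>j\<in>UNIV. green (x $ j) (t $ j)) \<in> borel_measurable (lebesgue_on unit_cube)"
    unfolding green_def by (intro measurable_lebesgue_on_continuous continuous_intros)
  have lim2: "(\<lambda>n. integral\<^sup>L (lebesgue_on unit_cube) (\<lambda>t. G t * ?\<Phi> n t)) \<longlonglongrightarrow>
     integral\<^sup>L (lebesgue_on unit_cube) (\<lambda>t. G t * (\<Prod>j\<in>UNIV. green (x $ j) (t $ j)))"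
  proof (rule integral_dominated_convergence[where w = "\<lambda>t. \<bar>G t\<bar> * 6 ^ CARD('n)"])
    show "integrable (lebesgue_on unit_cube) (\<lambda>t. \<bar>G t\<bar> * 6 ^ CARD('n))"
      using G(1) by (intro integrable_mult_left integrable_abs)
    have cube: "0 \<le> t $ j" "t $ j \<le> 1" if "t \<in> space (lebesgue_on unit_cube)" for t :: "real^'n" and j
      using that by (auto simp: unit_cube_def mem_box_cart)
    show "AE t in lebesgue_on unit_cube. (\<lambda>n. G t * ?\<Phi> n t)
        \<longlonglongrightarrow> G t * (\<Prod>j\<in>UNIV. green (x $ j) (t $ j))"
      using cube x01
      by (intro AE_I2 tendsto_mult tendsto_const tendsto_prod smooth_green_tendsto U e0 elim) auto
    show "AE t in lebesgue_on unit_cube. norm (G t * ?\<Phi> n t) \<le> \<bar>G t\<bar> * 6 ^ CARD('n)" for n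
    proof (rule AE_I2)
      fix t :: "real^'n" assume t: "t \<in> space (lebesgue_on unit_cube)"
      have "\<bar>?\<Phi> n t\<bar> \<le> (\<Prod>j\<in>(UNIV::'n set). 6)"
        unfolding abs_prod using smooth_green_bound[OF U(4) e0 ex] cube[OF t] by (intro prod_mono) auto
      then show "norm (G t * ?\<Phi> n t) \<le> \<bar>G t\<bar> * 6 ^ CARD('n)"
        by (auto simp: abs_mult intro!: mult_left_mono)
    qed
  qed (intro borel_measurable_times G' mPhi mgreen)+
  \<comment> \<open>The total order of the derivative is even, so the weak derivative contributes no
    sign.\<close>
  have "(-1::real) ^ (\<Sum>i\<in>(UNIV::'n set). 2) = 1" by (simp add: minus_one_power_iff)
  then have "integral\<^sup>L (lebesgue_on unit_cube) (\<lambda>t. f t * mixed_partial (\<lambda>_. 2) (?\<Phi> n) t) =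
      integral\<^sup>L (lebesgue_on unit_cube) (\<lambda>t. G t * ?\<Phi> n t)" for n
    using G(2) test[of n] unfolding weak_deriv_def by (simp only: mult_1 simp_thms)
  then have "(-1) ^ CARD('n) * g x =
      integral\<^sup>L (lebesgue_on unit_cube) (\<lambda>t. G t * (\<Prod>j\<in>UNIV. green (x $ j) (t $ j)))"
    using LIMSEQ_unique[OF lim1] lim2 unfolding single by simp
  then have "(-1) ^ CARD('n) * ((-1) ^ CARD('n) * g x) = (-1) ^ CARD('n) *
      integral\<^sup>L (lebesgue_on unit_cube) (\<lambda>t. G t * (\<Prod>j\<in>UNIV. green (x $ j) (t $ j)))" by simp
  moreover have "(-1) ^ CARD('n) * ((-1) ^ CARD('n) * g x) = g x"
    by (simp add: mult.assoc[symmetric] power_mult_distrib[symmetric])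
  ultimately show ?thesis by simp
qed

subsection \<open>The hierarchical expansion of the Green's function\<close>

definition hat :: "real \<Rightarrow> real" where
  "hat u = max 0 (1 - \<bar>u\<bar>)"

definition level_kernel :: "nat \<Rightarrow> real \<Rightarrow> real \<Rightarrow> real" where
  "level_kernel l x t = (\<Sum>i<2^l. hat (2 ^ (l+1) * x - (2 * real i + 1)) * hat (2 ^ (l+1) * t - (2 * real i + 1)))"

lemma hat_bounds: "0 \<le> hat u" "hat u \<le> 1" by (auto simp: hat_def)

lemma green_bounds: "0 \<le> green x t" "green x t \<le> 1"
proof -
  show "0 \<le> green x t" by (simp add: green_def)
  consider "x \<le> 0 \<or> t \<le> 0" | "x \<ge> 1 \<or> t \<ge> 1" | "0 < x" "0 < t" "x < 1" "t < 1" by linarith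
  then show "green x t \<le> 1"
  proof cases
    case 1
    then have "max 0 (min x t) = 0" by auto
    then show ?thesis by (simp add: green_def)
  next
    case 2
    then have "max 0 (1 - max x t) = 0" by auto
    then show ?thesis by (simp add: green_def)
  next
    case 3
    then show ?thesis unfolding green_def by (intro mult_le_one) auto
  qed
qed

lemma green_nonzero: "green x t \<noteq> 0 \<Longrightarrow> 0 < x \<and> x < 1"
  by (auto simp: green_def max_def min_def split: if_splits)

text \<open>With G for \<open>green\<close>, the product of hats is the rank-one part G(x,1/2)
  G(1/2,t) / G(1/2,1/2). Removing it imposes a zero at 1/2 as well and decouples the two halves; on
  each half the Green's function is the original one at double scale, divided by 2.\<close>

lemma green_self_similar:
  "green x t = hat (2 * x - 1) * hat (2 * t - 1) / 4 + green (2 * x) (2 * t) / 2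
     + green (2 * x - 1) (2 * t - 1) / 2"
proof -
  have *: "green x t = hat (2 * x - 1) * hat (2 * t - 1) / 4 + green (2 * x) (2 * t) / 2
     + green (2 * x - 1) (2 * t - 1) / 2" if "x \<le> t" for x t
  proof -
    consider "x \<le> 0" | "t \<ge> 1" "x > 0" | "0 < x" "t \<le> 1/2" | "0 < x" "x < 1/2" "1/2 < t" "t < 1"
      | "x = 1/2" "1/2 < t" "t < 1"
      | "1/2 < x" "t < 1" by linarith
    then show ?thesis
    proof cases
      case 5
      then show ?thesis unfolding 5(1) by (simp add: green_def hat_def max_def min_def abs_if field_simps)
    qed (use that in \<open>simp_all add: green_def hat_def max_def min_def abs_if field_simps\<close>)
  qed
  have sym: "green x t = green t x" for x t by (simp add: green_def min.commute max.commute)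
  show ?thesis
  proof (cases "x \<le> t")
    case False
    then show ?thesis using *[of t x]
      unfolding sym[of x t] sym[of "2*x" "2*t"] sym[of "2*x-1" "2*t-1"] mult.commute[of "hat (2*x-1)"] by simp
  qed (rule *)
qed

lemma sum_even_odd: "(\<Sum>i<n. f (2 * i) + f (2 * i + 1)) = (\<Sum>i<2 * n. f i)" for f :: "nat \<Rightarrow> real"
  by (induction n) auto

lemma green_expansion:
  "green x t = (\<Sum>l<Q. level_kernel l x t / 2 ^ (l + 2))
     + (\<Sum>i<2^Q. green (2 ^ Q * x - real i) (2 ^ Q * t - real i)) / 2 ^ Q"
proof (induction Q)
  case 0
  then show ?case by simp
next
  case (Suc Q)
  let ?F = "\<lambda>i. green (2 ^ Suc Q * x - real i) (2 ^ Suc Q * t - real i)"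
  have "green (2 ^ Q * x - real i) (2 ^ Q * t - real i) =
     hat (2 ^ (Q+1) * x - (2 * real i + 1)) * hat (2 ^ (Q+1) * t - (2 * real i + 1)) / 4
     + (?F (2 * i) + ?F (2 * i + 1)) / 2" for i
    by (subst green_self_similar) (simp add: algebra_simps add_divide_distrib)
  then have "(\<Sum>i<2^Q. green (2 ^ Q * x - real i) (2 ^ Q * t - real i)) =
     level_kernel Q x t / 4 + (\<Sum>i<2^Q. ?F (2 * i) + ?F (2 * i + 1)) / 2"
    by (simp only: level_kernel_def sum.distrib sum_divide_distrib[symmetric])
  also have "(\<Sum>i<2^Q. ?F (2 * i) + ?F (2 * i + 1)) = (\<Sum>i<2^Suc Q. ?F i)"
    using sum_even_odd[of ?F "2^Q"] by simp
  finally have 1: "(\<Sum>i<2^Q. green (2 ^ Q * x - real i) (2 ^ Q * t - real i)) =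
     level_kernel Q x t / 4 + (\<Sum>i<2^Suc Q. ?F i) / 2" .
  show ?case unfolding Suc.IH[unfolded 1] by (simp add: field_simps)
qed

lemma sum_at_most_one_nonzero:
  fixes F :: "nat \<Rightarrow> real"
  assumes "\<And>i. 0 \<le> F i" "\<And>i. F i \<le> 1" "\<And>i j. F i \<noteq> 0 \<Longrightarrow> F j \<noteq> 0 \<Longrightarrow> i = j"
  shows "(\<Sum>i<n. F i) \<le> 1"
proof (cases "\<exists>i<n. F i \<noteq> 0")
  case True
  then obtain i where i: "i < n" "F i \<noteq> 0" by blast
  then have "(\<Sum>j<n. F j) = (\<Sum>j<n. if j = i then F i else 0)"
    using assms(3) by (intro sum.cong) auto
  then show ?thesis using i assms(2) by simp
qed auto

lemma hat_sum_le_1: "(\<Sum>i<n. hat (u - (2 * real i + 1))) \<le> 1"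
proof (rule sum_at_most_one_nonzero)
  fix i j assume "hat (u - (2 * real i + 1)) \<noteq> 0" "hat (u - (2 * real j + 1)) \<noteq> 0"
  then have "\<bar>u - (2 * real i + 1)\<bar> < 1" "\<bar>u - (2 * real j + 1)\<bar> < 1"
    by (auto simp: hat_def max_def split: if_splits)
  then have "real i < real j + 1" "real j < real i + 1" by linarith+
  then show "i = j" by linarith
qed (auto simp: hat_bounds)

text \<open>The dyadic copies in the remainder are nonzero on disjoint intervals of x, so at most
  one of them contributes, and it is at most 1.\<close>

lemma green_expansion_error:
  "\<bar>green x t - (\<Sum>l<Q. level_kernel l x t / 2 ^ (l + 2))\<bar> \<le> 1 / 2 ^ Q"
proof -
  let ?s = "\<Sum>i<2^Q. green (2 ^ Q * x - real i) (2 ^ Q * t - real i)"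
  have "?s \<le> 1"
  proof (rule sum_at_most_one_nonzero)
    fix i j :: nat
    assume "green (2 ^ Q * x - real i) (2 ^ Q * t - real i) \<noteq> 0"
      "green (2 ^ Q * x - real j) (2 ^ Q * t - real j) \<noteq> 0"
    then have "real i < real j + 1" "real j < real i + 1"
      by (auto dest!: green_nonzero)
    then show "i = j" by linarith
  qed (auto simp: green_bounds)
  moreover have "?s \<ge> 0" by (intro sum_nonneg green_bounds)
  ultimately show ?thesis using green_expansion[of x t Q] by (simp add: divide_right_mono)
qed

lemma level_kernel_bounds: "0 \<le> level_kernel l x t" "level_kernel l x t \<le> 1"
proof -
  show "0 \<le> level_kernel l x t" unfolding level_kernel_def
    by (intro sum_nonneg mult_nonneg_nonneg hat_bounds)
  have "level_kernel l x t \<le> (\<Sum>i<2^l. hat (2 ^ (l+1) * x - (2 * real i + 1)) * 1)"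
    unfolding level_kernel_def by (intro sum_mono mult_left_mono hat_bounds)
  also have "\<dots> \<le> 1" using hat_sum_le_1 by simp
  finally show "level_kernel l x t \<le> 1" .
qed

lemma hat_has_bochner_integral: "has_bochner_integral lborel hat 1"
proof -
  have 1: "has_bochner_integral lborel (\<lambda>t. (1 + t) * indicator {-1..0} t) ((0 + 0^2/2) - (-1 + (-1)^2/2) :: real)"
    by (rule has_bochner_integral_FTC_Icc_real[where F = "\<lambda>t. t + t^2/2"]) (auto intro!: derivative_eq_intros)
  have 2: "has_bochner_integral lborel (\<lambda>t. (1 - t) * indicator {0..1} t) ((1 - 1^2/2) - (0 - 0^2/2) :: real)"
    by (rule has_bochner_integral_FTC_Icc_real[where F = "\<lambda>t. t - t^2/2"]) (auto intro!: derivative_eq_intros)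
  have "has_bochner_integral lborel (\<lambda>t. (1 + t) * indicator {-1..0} t + (1 - t) * indicator {0..1} t) (1::real)"
    using has_bochner_integral_add[OF 1 2] by simp
  \<comment> \<open>Both closed intervals contain 0, so the pieces add up to the hat only off that
    point.\<close>
  moreover have "AE t in lborel. (1 + t) * indicator {-1..0} t + (1 - t) * indicator {0..1} t = hat t"
    using AE_lborel_singleton[of "0::real"]
    by eventually_elim (auto simp: hat_def indicator_def)
  ultimately show ?thesis
    using has_bochner_integral_cong_AE[of "\<lambda>t. (1 + t) * indicator {-1..0} t + (1 - t) * indicator {0..1} t" lborel hat 1]
    by (auto simp: hat_def[abs_def])
qed

lemma hat_affine_integral:
  assumes "c > 0"
  shows "integrable lborel (\<lambda>t. hat (c * t - b))" "integral\<^sup>L lborel (\<lambda>t. hat (c * t - b)) = 1 / c"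
proof -
  have "has_bochner_integral lborel (\<lambda>t. hat (- b + c * t)) (1 /\<^sub>R \<bar>c\<bar>)"
    using lborel_has_bochner_integral_real_affine_iff[of c hat 1 "- b"] hat_has_bochner_integral assms by simp
  then have "has_bochner_integral lborel (\<lambda>t. hat (c * t - b)) (1 / c)"
    using assms by (simp add: divide_inverse add.commute)
  then show "integrable lborel (\<lambda>t. hat (c * t - b))" "integral\<^sup>L lborel (\<lambda>t. hat (c * t - b)) = 1 / c"
    by (auto simp: has_bochner_integral_iff)
qed

text \<open>Each hat in t has integral 2^(-l-1), and its weights in x sum to at most 1 because the
  hats of one level do not overlap. This L^1 bound is what enters Hoelder's inequality.\<close>

lemma level_kernel_integral:
  "integrable lborel (level_kernel l x)" "integral\<^sup>L lborel (level_kernel l x) \<le> 1 / 2 ^ (l + 1)"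
proof -
  have c: "(2::real) ^ (l + 1) > 0" by simp
  show "integrable lborel (level_kernel l x)"
    unfolding level_kernel_def[abs_def]
    by (intro Bochner_Integration.integrable_sum integrable_mult_right hat_affine_integral c)
  have "integral\<^sup>L lborel (level_kernel l x) =
      (\<Sum>i<2^l. hat (2 ^ (l+1) * x - (2 * real i + 1)) * (1 / 2 ^ (l + 1)))"
    unfolding level_kernel_def[abs_def]
    by (subst Bochner_Integration.integral_sum)
       (auto intro!: integrable_mult_right hat_affine_integral c sum.cong
             simp only: integral_mult_right_zero hat_affine_integral(2)[OF c])
  also have "\<dots> \<le> 1 * (1 / 2 ^ (l + 1))"
    unfolding sum_distrib_right[symmetric] by (intro mult_right_mono hat_sum_le_1) auto
  finally show "integral\<^sup>L lborel (level_kernel l x) \<le> 1 / 2 ^ (l + 1)" by simp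
qed

subsection \<open>Duality estimate in the unit ball\<close>

lemma powr_le_1_D:
  assumes "x powr a \<le> 1" "a > 0" "x \<ge> 0"
  shows "x \<le> (1::real)"
proof (rule ccontr)
  assume "\<not> x \<le> 1"
  then have "1 powr a < x powr a" using assms by (intro powr_less_mono2) auto
  then show False using assms by simp
qed

text \<open>Young's inequality for (a c) * 1, divided by c. Optimising the free scale c after
  integration yields Hoelder's inequality.\<close>

lemma young_scaled:
  fixes a c q :: real
  assumes "q \<ge> 2" "a \<ge> 0" "c > 0"
  shows "a \<le> c powr (q - 1) * a powr q / q + (1 - 1 / q) / c"
proof -
  have "(a * c) * 1 \<le> (a * c) powr q / q + 1 powr (q / (q - 1)) / (q / (q - 1))"
    using assms by (intro Youngs_inequality) (auto simp: field_simps)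
  also have "\<dots> = c * (c powr (q - 1) * a powr q / q + (1 - 1 / q) / c)"
    using assms by (simp add: powr_mult powr_diff field_simps)
  finally show ?thesis using assms by (simp add: mult.commute)
qed

lemma ereal_ge_2_cases:
  assumes "2 \<le> (p::ereal)"
  obtains "p = \<infinity>" | q where "p = ereal q" "q \<ge> 2"
  using assms by (cases p) auto

lemma (in finite_measure) memLp_integrable:
  assumes "2 \<le> p" "memLp M p G"
  shows "integrable M G"
  using assms(1)
proof (cases rule: ereal_ge_2_cases)
  case 1
  then obtain C where "AE x in M. \<bar>G x\<bar> \<le> C" using assms(2) by (auto simp: memLp_def)
  then show ?thesis using assms(2) by (intro integrable_const_bound[of _ C]) (auto simp: memLp_def)
next
  case (2 q)
  then have int: "integrable M (\<lambda>x. \<bar>G x\<bar> powr q)" and m: "G \<in> borel_measurable M"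
    using assms(2) by (auto simp: memLp_def)
  show ?thesis
  proof (rule Bochner_Integration.integrable_bound)
    show "integrable M (\<lambda>x. 1 powr (q - 1) * \<bar>G x\<bar> powr q / q + (1 - 1 / q) / 1)"
      using int by simp
    show "AE x in M. norm (G x) \<le> norm (1 powr (q - 1) * \<bar>G x\<bar> powr q / q + (1 - 1 / q) / 1)"
      using order_trans[OF young_scaled[OF 2(2) abs_ge_zero, of 1] abs_ge_self] by (intro AE_I2) simp
  qed (rule m)
qed

text \<open>Because 0 \<le> S \<le> 1, the scaled Young inequality can be multiplied by S and the S
  then dropped from the term with the power of G; hence only the integral of S appears. The choice c
  = A^(1/q) makes the two terms add up to A^(1-1/q).\<close>

lemma (in finite_measure) Lp_unit_ball_holder:
  assumes p: "2 \<le> p" "memLp M p G" "Lp_norm M p G \<le> 1"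
    and S: "S \<in> borel_measurable M" "\<And>x. 0 \<le> S x" "\<And>x. S x \<le> 1" "integral\<^sup>L M S \<le> A" "A > 0"
  shows "integrable M (\<lambda>x. G x * S x)" "\<bar>integral\<^sup>L M (\<lambda>x. G x * S x)\<bar> \<le> A powr (1 - inv_exp p)"
proof -
  have G: "integrable M G" using memLp_integrable p by blast
  have Sint: "integrable M S" using S by (intro integrable_const_bound[of _ 1]) auto
  show GS: "integrable M (\<lambda>x. G x * S x)"
  proof (rule Bochner_Integration.integrable_bound[OF G])
    show "AE x in M. norm (G x * S x) \<le> norm (G x)"
      using S by (intro AE_I2) (auto simp: abs_mult intro!: mult_left_le)
  qed (use G S in auto)
  have abs_le: "\<bar>integral\<^sup>L M (\<lambda>x. G x * S x)\<bar> \<le> integral\<^sup>L M (\<lambda>x. \<bar>G x\<bar> * S x)"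
    using integral_abs_bound[of M "\<lambda>x. G x * S x"] S by (simp add: abs_mult)
  have GS': "integrable M (\<lambda>x. \<bar>G x\<bar> * S x)"
    using integrable_abs[OF GS] S by (simp add: abs_mult)
  show "\<bar>integral\<^sup>L M (\<lambda>x. G x * S x)\<bar> \<le> A powr (1 - inv_exp p)"
    using p(1)
  proof (cases rule: ereal_ge_2_cases)
    case 1
    obtain C where C: "AE x in M. \<bar>G x\<bar> \<le> C" using p(2) 1 by (auto simp: memLp_def)
    let ?X = "{C. C \<ge> 0 \<and> (AE x in M. \<bar>G x\<bar> \<le> C)}"
    have "AE x in M. \<bar>G x\<bar> \<le> max C 0" using C by eventually_elim auto
    then have "max C 0 \<in> ?X" by simp
    then have ne: "?X \<noteq> {}" by blast
    \<comment> \<open>The infimum in the definition of the norm is not known to be attained; bounds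
      slightly above 1 are taken and intersected over countably many n.\<close>
    have "AE x in M. \<bar>G x\<bar> \<le> 1 + 1 / real (Suc n)" for n
    proof -
      have "Inf ?X < 1 + 1 / real (Suc n)" using p(3) 1 by (intro le_less_trans[of "Inf ?X" 1]) (auto simp: Lp_norm_def)
      then obtain c where "AE x in M. \<bar>G x\<bar> \<le> c" "c < 1 + 1 / real (Suc n)"
        using cInf_lessD[OF ne] by blast
      then show ?thesis by (auto elim: eventually_mono)
    qed
    then have "AE x in M. \<forall>n. \<bar>G x\<bar> \<le> 1 + 1 / real (Suc n)" by (simp add: AE_all_countable)
    then have "AE x in M. \<bar>G x\<bar> \<le> 1"
    proof eventually_elim
      case (elim x)
      have "(\<lambda>n. 1 + 1 / real (Suc n)) \<longlonglongrightarrow> 1 + 0"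
        by (intro tendsto_intros LIMSEQ_Suc[OF lim_const_over_n])
      then show ?case using elim by (intro LIMSEQ_le_const[of _ 1]) auto
    qed
    then have "AE x in M. \<bar>G x\<bar> * S x \<le> S x"
      by eventually_elim (use S in \<open>auto intro: mult_left_le_one_le\<close>)
    then have "integral\<^sup>L M (\<lambda>x. \<bar>G x\<bar> * S x) \<le> integral\<^sup>L M S"
      by (intro integral_mono_AE GS' Sint)
    then show ?thesis using abs_le S(4,5) 1 by (simp add: inv_exp_def)
  next
    case (2 q)
    have int: "integrable M (\<lambda>x. \<bar>G x\<bar> powr q)" using p(2) 2 by (simp add: memLp_def)
    have le1: "integral\<^sup>L M (\<lambda>x. \<bar>G x\<bar> powr q) \<le> 1"
      by (rule powr_le_1_D[of _ "1 / q"]) (use p(3) 2 in \<open>auto simp: Lp_norm_def\<close>)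
    define c where "c = A powr (1 / q)"
    have c: "c > 0" using S by (simp add: c_def)
    have "integral\<^sup>L M (\<lambda>x. \<bar>G x\<bar> * S x) \<le>
        integral\<^sup>L M (\<lambda>x. c powr (q - 1) / q * \<bar>G x\<bar> powr q + (1 - 1 / q) / c * S x)"
    proof (intro integral_mono GS' Bochner_Integration.integrable_add integrable_mult_right int Sint)
      fix x
      have "\<bar>G x\<bar> * S x \<le> (c powr (q - 1) * \<bar>G x\<bar> powr q / q + (1 - 1 / q) / c) * S x"
        using young_scaled[OF 2(2) abs_ge_zero c] S by (intro mult_right_mono) auto
      also have "\<dots> = (c powr (q - 1) / q * \<bar>G x\<bar> powr q) * S x + (1 - 1 / q) / c * S x"
        by (simp add: distrib_right)
      also have "(c powr (q - 1) / q * \<bar>G x\<bar> powr q) * S x \<le> c powr (q - 1) / q * \<bar>G x\<bar> powr q"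
        using S 2 by (intro mult_left_le) auto
      finally show "\<bar>G x\<bar> * S x \<le> c powr (q - 1) / q * \<bar>G x\<bar> powr q + (1 - 1 / q) / c * S x" by simp
    qed
    also have "\<dots> = c powr (q - 1) / q * integral\<^sup>L M (\<lambda>x. \<bar>G x\<bar> powr q) + (1 - 1 / q) / c * integral\<^sup>L M S"
      using int Sint by simp
    also have "\<dots> \<le> c powr (q - 1) / q * 1 + (1 - 1 / q) / c * A"
      using le1 S 2 c by (intro add_mono mult_left_mono) auto
    also have "c powr (q - 1) = A powr (1 - 1 / q)"
      using 2 by (simp add: c_def powr_powr diff_divide_distrib)
    also have "(1 - 1 / q) / c * A = (1 - 1 / q) * A powr (1 - 1 / q)"
      using S(5) by (simp add: c_def powr_diff)
    also have "A powr (1 - 1 / q) / q * 1 + (1 - 1 / q) * A powr (1 - 1 / q) = A powr (1 - 1 / q)"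
      by (simp add: left_diff_distrib)
    finally show ?thesis using abs_le 2 by (simp add: inv_exp_def)
  qed
qed

lemma finite_mindex2: "finite (mindex2 :: ('n::finite \<Rightarrow> nat) set)"
proof -
  have eq: "(mindex2 :: ('n \<Rightarrow> nat) set) = PiE UNIV (\<lambda>_. {..2})" by (auto simp: mindex2_def PiE_def)
  show ?thesis unfolding eq by (rule finite_PiE) auto
qed

lemma finite_measure_unit_cube: "finite_measure (lebesgue_on (unit_cube :: (real^'n::finite) set))"
  unfolding unit_cube_def by (rule finite_measure_lebesgue_on) (simp add: lmeasurable_cbox)

text \<open>The weak derivative of order 2 in every coordinate supplies \<open>G\<close>, and its
  norm is one term of the Korobov norm. The formula holds at interior points, and the frontier of
  the cube is a null set.\<close>

lemma korobov_unit_ball_green_representation: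
  fixes f :: "real^'n::finite \<Rightarrow> real"
  assumes f: "korobov_unit_ball p f" and p: "2 \<le> p"
  obtains G where "memLp (lebesgue_on unit_cube) p G" "Lp_norm (lebesgue_on unit_cube) p G \<le> 1"
    "AE x in lebesgue_on unit_cube. f x = (-1) ^ CARD('n) *
       integral\<^sup>L (lebesgue_on unit_cube) (\<lambda>t. G t * (\<Prod>j\<in>UNIV. green (x $ j) (t $ j)))"
proof -
  interpret finite_measure "lebesgue_on (unit_cube :: (real^'n) set)" by (rule finite_measure_unit_cube)
  let ?M = "lebesgue_on (unit_cube :: (real^'n) set)"
  obtain g where g: "continuous_on unit_cube g" "\<forall>x\<in>frontier unit_cube. g x = 0"
      "AE x in ?M. f x = g x"
    using f unfolding korobov_unit_ball_def by blast
  from f obtain G where G0: "\<forall>\<alpha>\<in>mindex2. weak_deriv unit_cube \<alpha> f (G \<alpha>) \<and> memLp ?M p (G \<alpha>)"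
    and norm: "if p = \<infinity> then (\<forall>\<alpha>\<in>mindex2. Lp_norm ?M p (G \<alpha>) \<le> 1)
           else (\<Sum>\<alpha>\<in>mindex2. Lp_norm ?M p (G \<alpha>) powr real_of_ereal p)
                  powr (1 / real_of_ereal p) \<le> 1"
    unfolding korobov_unit_ball_def by (elim conjE exE)
  have G: "\<And>\<alpha>. \<alpha> \<in> mindex2 \<Longrightarrow> weak_deriv unit_cube \<alpha> f (G \<alpha>)"
      "\<And>\<alpha>. \<alpha> \<in> mindex2 \<Longrightarrow> memLp ?M p (G \<alpha>)"
    using G0 by auto
  have a: "(\<lambda>_::'n. 2) \<in> mindex2" by (simp add: mindex2_def)
  have n: "Lp_norm ?M p (G (\<lambda>_. 2)) \<le> 1"
    using p
  proof (cases rule: ereal_ge_2_cases)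
    case 1
    then show ?thesis using norm a by simp
  next
    case (2 q)
    let ?N = "\<lambda>\<alpha>. Lp_norm ?M p (G \<alpha>)"
    have "(\<Sum>\<alpha>\<in>mindex2. ?N \<alpha> powr q) \<le> 1"
      by (rule powr_le_1_D[of _ "1 / q"]) (use norm 2 in \<open>auto intro: sum_nonneg\<close>)
    moreover have "?N (\<lambda>_. 2) powr q \<le> (\<Sum>\<alpha>\<in>mindex2. ?N \<alpha> powr q)"
      using a by (intro member_le_sum finite_mindex2) auto
    ultimately have "?N (\<lambda>_. 2) powr q \<le> 1" by linarith
    moreover have "?N (\<lambda>_. 2) \<ge> 0" using 2 by (simp add: Lp_norm_def)
    ultimately show ?thesis using 2 powr_le_1_D[of _ q] by auto
  qed
  have fm: "f \<in> borel_measurable ?M" using f by (simp add: korobov_unit_ball_def memLp_def)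
  have "negligible (frontier (unit_cube :: (real^'n) set))"
    unfolding unit_cube_def by (intro negligible_convex_frontier) simp
  then have "AE x in lebesgue. x \<notin> frontier (unit_cube :: (real^'n) set)"
    by (auto simp: negligible_iff_null_sets intro: AE_not_in)
  then have "AE x in ?M. x \<in> box 0 1"
    by (subst AE_restrict_space_iff)
       (auto simp: unit_cube_def frontier_def interior_cbox elim!: eventually_mono)
  with g(3) have "AE x in ?M. f x = (-1) ^ CARD('n) *
       integral\<^sup>L ?M (\<lambda>t. G (\<lambda>_. 2) t * (\<Prod>j\<in>UNIV. green (x $ j) (t $ j)))"
  proof eventually_elim
    case (elim x)
    then show ?case
      using weak_deriv_green_representation[OF g(1,2) fm g(3) memLp_integrable[OF p G(2)[OF a]] G(1)[OF a]]
      by simp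
  qed
  then show thesis using that G(2)[OF a] n by blast
qed

subsection \<open>Sparse grid approximation\<close>

definition hat_basis :: "('n::finite \<Rightarrow> nat) \<Rightarrow> ('n \<Rightarrow> nat) \<Rightarrow> real^'n \<Rightarrow> real" where
  "hat_basis l i x = (\<Prod>j\<in>UNIV. hat (2 ^ (l j + 1) * x $ j - (2 * real (i j) + 1)))"

text \<open>Levels are counted from 0, so that \<open>l\<close> stands for the mesh width \<open>2\<close> to the power \<open>-(l+1)\<close>.\<close>

definition sparse_levels :: "nat \<Rightarrow> ('n::finite \<Rightarrow> nat) set" where
  "sparse_levels n = {l. sum l UNIV < n}"

definition sparse_index :: "nat \<Rightarrow> (('n::finite \<Rightarrow> nat) \<times> ('n \<Rightarrow> nat)) set" where
  "sparse_index n = Sigma (sparse_levels n) (\<lambda>l. PiE UNIV (\<lambda>j. {..<2 ^ l j}))"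

text \<open>A level vector with prescribed sum is determined by all coordinates but one, and each of
  those is at most \<open>s\<close>.\<close>

lemma card_level_sum:
  "finite {l :: 'n::finite \<Rightarrow> nat. sum l UNIV = s}"
  "card {l :: 'n::finite \<Rightarrow> nat. sum l UNIV = s} \<le> (s + 1) ^ (CARD('n) - 1)"
proof -
  fix j0 :: 'n
  let ?A = "{l :: 'n \<Rightarrow> nat. sum l UNIV = s}" and ?B = "PiE (UNIV - {j0}) (\<lambda>_. {..s})"
  have le: "l j \<le> s" if "l \<in> ?A" for l j
    using that member_le_sum[of j UNIV l] by auto
  have inj: "inj_on (\<lambda>l. restrict l (UNIV - {j0})) ?A"
  proof (rule inj_onI)
    fix l l' :: "'n \<Rightarrow> nat"
    assume l: "l \<in> ?A" "l' \<in> ?A" and eq: "restrict l (UNIV - {j0}) = restrict l' (UNIV - {j0})"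
    have e: "l j = l' j" if "j \<noteq> j0" for j using fun_cong[OF eq, of j] that by simp
    then have "sum l (UNIV - {j0}) = sum l' (UNIV - {j0})" by (intro sum.cong) auto
    moreover have "l j0 + sum l (UNIV - {j0}) = l' j0 + sum l' (UNIV - {j0})"
      using l by (simp add: sum.remove[symmetric])
    ultimately show "l = l'" using e by (metis add_right_cancel ext)
  qed
  have sub: "(\<lambda>l. restrict l (UNIV - {j0})) ` ?A \<subseteq> ?B"
  proof (intro image_subsetI restrict_PiE_iff[THEN iffD2] ballI)
    show "l j \<in> {..s}" if "l \<in> ?A" for l j using le[OF that] by simp
  qed
  have fin: "finite ?B" by (intro finite_PiE) auto
  then show "finite ?A" using inj sub finite_imageD finite_subset by blast
  have "card ?A \<le> card ?B" by (rule card_inj_on_le[OF inj sub fin])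
  then show "card ?A \<le> (s + 1) ^ (CARD('n) - 1)" by (simp add: card_PiE card_Diff_singleton)
qed

lemma finite_sparse_levels: "finite (sparse_levels n :: ('n::finite \<Rightarrow> nat) set)"
proof -
  have "sparse_levels n = (\<Union>s<n. {l :: 'n \<Rightarrow> nat. sum l UNIV = s})" by (auto simp: sparse_levels_def)
  then show ?thesis by (simp add: card_level_sum)
qed

text \<open>A level vector of sum s carries 2^s hats; grouping by s leaves a geometric sum.\<close>

lemma sparse_index_card:
  "finite (sparse_index n :: (('n::finite \<Rightarrow> nat) \<times> _) set)"
  "card (sparse_index n :: (('n::finite \<Rightarrow> nat) \<times> _) set) \<le> n ^ (CARD('n) - 1) * 2 ^ n"
proof -
  have fin: "finite (PiE UNIV (\<lambda>j::'n. {..<(2::nat) ^ l j}))" for l by (intro finite_PiE) auto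
  show "finite (sparse_index n :: (('n::finite \<Rightarrow> nat) \<times> _) set)"
    unfolding sparse_index_def using finite_sparse_levels fin by blast
  have "card (sparse_index n :: (('n::finite \<Rightarrow> nat) \<times> _) set) =
      (\<Sum>l\<in>sparse_levels n. \<Prod>j\<in>(UNIV::'n set). 2 ^ l j)"
    unfolding sparse_index_def
    by (subst card_SigmaI[OF finite_sparse_levels]) (use fin in \<open>auto simp: card_PiE\<close>)
  also have "\<dots> = (\<Sum>l\<in>(sparse_levels n :: ('n \<Rightarrow> nat) set). 2 ^ sum l UNIV)"
    by (simp add: power_sum)
  also have "\<dots> = (\<Sum>s<n. \<Sum>l\<in>{l \<in> (sparse_levels n :: ('n \<Rightarrow> nat) set). sum l UNIV = s}. 2 ^ sum l UNIV)"
    by (rule sum.group[symmetric]) (rule finite_sparse_levels, auto simp: sparse_levels_def)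
  also have "\<dots> \<le> (\<Sum>s<n. n ^ (CARD('n) - 1) * 2 ^ s)"
  proof (rule sum_mono)
    fix s assume s: "s \<in> {..<n}"
    have "{l \<in> (sparse_levels n :: ('n \<Rightarrow> nat) set). sum l UNIV = s} = {l. sum l UNIV = s}"
      using s by (auto simp: sparse_levels_def)
    then have "(\<Sum>l\<in>{l \<in> (sparse_levels n :: ('n \<Rightarrow> nat) set). sum l UNIV = s}. 2 ^ sum l UNIV) =
        card {l :: 'n \<Rightarrow> nat. sum l UNIV = s} * 2 ^ s" by simp
    also have "\<dots> \<le> (s + 1) ^ (CARD('n) - 1) * 2 ^ s" by (intro mult_right_mono card_level_sum) simp
    also have "\<dots> \<le> n ^ (CARD('n) - 1) * 2 ^ s" using s by (intro mult_right_mono power_mono) auto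
    finally show "(\<Sum>l\<in>{l \<in> (sparse_levels n :: ('n \<Rightarrow> nat) set). sum l UNIV = s}. 2 ^ sum l UNIV)
        \<le> n ^ (CARD('n) - 1) * 2 ^ s" .
  qed
  also have "\<dots> = n ^ (CARD('n) - 1) * (2 ^ n - 1)"
    by (simp add: sum_distrib_left[symmetric] mask_eq_sum_exp_nat lessThan_def)
  also have "\<dots> \<le> n ^ (CARD('n) - 1) * 2 ^ n" by (intro mult_left_mono) auto
  finally show "card (sparse_index n :: (('n::finite \<Rightarrow> nat) \<times> _) set) \<le> n ^ (CARD('n) - 1) * 2 ^ n" .
qed

text \<open>The factors are nonnegative, so the integral over the cube can be enlarged to the whole
  space, where it factorises; the duality estimate then applies to the product.\<close>

lemma Lp_unit_ball_tensor:
  fixes G :: "real^'n::finite \<Rightarrow> real" and h :: "'n \<Rightarrow> real \<Rightarrow> real"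
  assumes p: "2 \<le> p" "memLp (lebesgue_on unit_cube) p G" "Lp_norm (lebesgue_on unit_cube) p G \<le> 1"
    and h: "\<And>j t. 0 \<le> h j t" "\<And>j t. h j t \<le> 1" "\<And>j. integrable lborel (h j)"
      "\<And>j. integral\<^sup>L lborel (h j) \<le> a j" "\<And>j. a j > 0"
  shows "integrable (lebesgue_on unit_cube) (\<lambda>t. G t * (\<Prod>j\<in>UNIV. h j (t $ j)))"
    "\<bar>integral\<^sup>L (lebesgue_on unit_cube) (\<lambda>t. G t * (\<Prod>j\<in>UNIV. h j (t $ j)))\<bar>
       \<le> (\<Prod>j\<in>UNIV. a j) powr (1 - inv_exp p)"
proof -
  interpret finite_measure "lebesgue_on (unit_cube :: (real^'n) set)" by (rule finite_measure_unit_cube)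
  let ?H = "\<lambda>t::real^'n. \<Prod>j\<in>UNIV. h j (t $ j)"
  have int: "integrable lborel ?H" by (intro integrable_lborel_tensor h)
  then have m: "?H \<in> borel_measurable borel" by auto
  have "?H \<in> borel_measurable lebesgue" using m by (simp add: measurable_completion)
  then have m': "?H \<in> borel_measurable (lebesgue_on unit_cube)" by (rule measurable_restrict_space1)
  have ind: "integrable lborel (\<lambda>t. indicator unit_cube t * ?H t)"
    using integrable_mult_indicator[OF _ int, of unit_cube] unit_cube_lebesgue by simp
  have "integral\<^sup>L (lebesgue_on unit_cube) ?H = integral\<^sup>L lborel (\<lambda>t. indicator unit_cube t * ?H t)"
    using ind by (intro integral_lebesgue_on_unit_cube) auto
  also have "\<dots> \<le> integral\<^sup>L lborel ?H"
    by (intro integral_mono ind int) (auto simp: indicator_def intro!: prod_nonneg h)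
  also have "\<dots> \<le> (\<Prod>j\<in>UNIV. a j)"
    unfolding integral_lborel_tensor[of h, OF h(3)]
    by (intro prod_mono conjI h Bochner_Integration.integral_nonneg)
  finally have le: "integral\<^sup>L (lebesgue_on unit_cube) ?H \<le> (\<Prod>j\<in>UNIV. a j)" .
  have "0 \<le> ?H t" "?H t \<le> 1" "0 < (\<Prod>j\<in>UNIV. a j)" for t
    by (auto intro!: prod_nonneg prod_le_1 prod_pos h)
  then show "integrable (lebesgue_on unit_cube) (\<lambda>t. G t * ?H t)"
    "\<bar>integral\<^sup>L (lebesgue_on unit_cube) (\<lambda>t. G t * ?H t)\<bar> \<le> (\<Prod>j\<in>UNIV. a j) powr (1 - inv_exp p)"
    using Lp_unit_ball_holder[OF p m' _ _ le] by auto
qed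

text \<open>The contribution of one level vector of sum \<open>s\<close> in dimension
  \<open>D\<close>, with r = 1 - 1/p: the product of the weights 2^(-l-2), times the L^1 bound
  2^(-s-D) of the product kernel raised to the Hoelder exponent.\<close>

definition level_error :: "nat \<Rightarrow> real \<Rightarrow> nat \<Rightarrow> real" where
  "level_error D r s = 1 / 2 ^ (s + 2 * D) * (1 / 2 ^ (s + D)) powr r"

lemma sum_levels_beyond:
  fixes P :: "('n::finite \<Rightarrow> nat) set" and w :: "nat \<Rightarrow> real"
  assumes P: "finite P" "\<And>l. l \<in> P \<Longrightarrow> n \<le> sum l UNIV \<and> sum l UNIV < m" and w: "\<And>s. w s \<ge> 0"
  shows "(\<Sum>l\<in>P. w (sum l UNIV)) \<le> (\<Sum>s=n..<m. real (s + 1) ^ (CARD('n) - 1) * w s)"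
proof -
  have "(\<Sum>l\<in>P. w (sum l UNIV)) = (\<Sum>s=n..<m. \<Sum>l\<in>{l \<in> P. sum l UNIV = s}. w (sum l UNIV))"
    by (rule sum.group[symmetric]) (use P in auto)
  also have "\<dots> \<le> (\<Sum>s=n..<m. real (s + 1) ^ (CARD('n) - 1) * w s)"
  proof (rule sum_mono)
    fix s
    have "card {l \<in> P. sum l UNIV = s} \<le> card {l :: 'n \<Rightarrow> nat. sum l UNIV = s}"
      by (intro card_mono card_level_sum) auto
    also have "\<dots> \<le> (s + 1) ^ (CARD('n) - 1)" by (rule card_level_sum)
    finally have "real (card {l \<in> P. sum l UNIV = s}) \<le> real (s + 1) ^ (CARD('n) - 1)"
      by (metis of_nat_le_iff of_nat_power)
    moreover have "(\<Sum>l\<in>{l \<in> P. sum l UNIV = s}. w (sum l UNIV)) = real (card {l \<in> P. sum l UNIV = s}) * w s"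
      by simp
    ultimately show "(\<Sum>l\<in>{l \<in> P. sum l UNIV = s}. w (sum l UNIV)) \<le> real (s + 1) ^ (CARD('n) - 1) * w s"
      using w by (simp add: mult_right_mono)
  qed
  finally show ?thesis .
qed

text \<open>Finite boxes of levels below Q replace the infinite expansion. The box differs from the
  exact kernel by an error that vanishes as Q grows, and its levels outside the sparse set cost at
  most \<open>E\<close>, which bounds all finite tails at once.\<close>

lemma sparse_grid_approximation:
  fixes f :: "real^'n::finite \<Rightarrow> real"
  assumes f: "korobov_unit_ball p f" and p: "2 \<le> p"
    and E: "\<And>m. (\<Sum>s=n..<m. real (s + 1) ^ (CARD('n) - 1) * level_error CARD('n) (1 - inv_exp p) s) \<le> E"
  obtains v :: "('n \<Rightarrow> nat) \<times> ('n \<Rightarrow> nat) \<Rightarrow> real" where "\<And>a. \<bar>v a\<bar> \<le> 1"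
    "AE x in lebesgue_on unit_cube. \<bar>f x - (\<Sum>(l, i)\<in>sparse_index n. v (l, i) * hat_basis l i x)\<bar> \<le> E"
proof -
  let ?M = "lebesgue_on (unit_cube :: (real^'n) set)" and ?D = "CARD('n)"
  interpret finite_measure ?M by (rule finite_measure_unit_cube)
  obtain G where G: "memLp ?M p G" "Lp_norm ?M p G \<le> 1"
    and fG: "AE x in ?M. f x = (-1) ^ ?D * integral\<^sup>L ?M (\<lambda>t. G t * (\<Prod>j\<in>UNIV. green (x $ j) (t $ j)))"
    using korobov_unit_ball_green_representation[OF f p] by blast
  have Gint: "integrable ?M G" by (rule memLp_integrable[OF p G(1)])
  define c where "c l = (\<Prod>j\<in>UNIV. 1 / 2 ^ (l j + 2) :: real)" for l :: "'n \<Rightarrow> nat"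
  define K where "K l x t = (\<Prod>j\<in>UNIV. level_kernel (l j) (x $ j) (t $ j))" for l and x t :: "real^'n"
  define T where "T l x = integral\<^sup>L ?M (\<lambda>t. G t * K l x t)" for l x
  \<comment> \<open>Each coefficient is \<open>G\<close> integrated against the t-factor of the
    expansion, with the weight of its level and the sign of the representation formula.\<close>
  define v where "v = (\<lambda>(l, i). (-1) ^ ?D * c l * integral\<^sup>L ?M (\<lambda>t. G t * hat_basis l i t))"
  have pow: "(\<Prod>j\<in>UNIV. 1 / 2 ^ (l j + b) :: real) = 1 / 2 ^ (sum l UNIV + b * ?D)" for l :: "'n \<Rightarrow> nat" and b
    by (simp add: prod_dividef power_add prod.distrib power_sum power_mult)
  have c: "0 \<le> c l" "c l \<le> 1" "c l = 1 / 2 ^ (sum l UNIV + 2 * ?D)" for l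
    using pow[of l 2] by (auto simp: c_def intro!: prod_nonneg)
  have hb: "integrable ?M (\<lambda>t. G t * hat_basis l i t)" "\<bar>integral\<^sup>L ?M (\<lambda>t. G t * hat_basis l i t)\<bar> \<le> 1"
    for l i :: "'n \<Rightarrow> nat"
  proof -
    have pos: "(2::real) ^ (l j + 1) > 0" for j by simp
    note t = Lp_unit_ball_tensor[OF p G, where a = "\<lambda>_. 1"
        and h = "\<lambda>j t. hat (2 ^ (l j + 1) * t - (2 * real (i j) + 1))",
        OF hat_bounds hat_affine_integral(1)[OF pos]]
    have "integral\<^sup>L lborel (\<lambda>t. hat (2 ^ (l j + 1) * t - (2 * real (i j) + 1))) \<le> 1" for j
      unfolding hat_affine_integral(2)[OF pos] using one_le_power[of "2::real" "l j + 1"] by simp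
    then show "integrable ?M (\<lambda>t. G t * hat_basis l i t)" "\<bar>integral\<^sup>L ?M (\<lambda>t. G t * hat_basis l i t)\<bar> \<le> 1"
      using t unfolding hat_basis_def by auto
  qed
  have v1: "\<bar>v a\<bar> \<le> 1" for a
  proof (cases a)
    case (Pair l i)
    have "\<bar>c l\<bar> * \<bar>integral\<^sup>L ?M (\<lambda>t. G t * hat_basis l i t)\<bar> \<le> 1 * 1"
      using c[of l] hb(2)[of l i] by (intro mult_mono) auto
    then show ?thesis by (simp add: Pair v_def abs_mult power_abs)
  qed
  have TK: "integrable ?M (\<lambda>t. G t * K l x t)"
    "\<bar>T l x\<bar> \<le> (1 / 2 ^ (sum l UNIV + ?D)) powr (1 - inv_exp p)" for l x
    using Lp_unit_ball_tensor[OF p G, where h = "\<lambda>j. level_kernel (l j) (x $ j)"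
        and a = "\<lambda>j. 1 / 2 ^ (l j + 1)", OF level_kernel_bounds level_kernel_integral] pow[of l 1]
    unfolding T_def K_def by auto
  have T_basis: "c l * T l x = (-1) ^ ?D * (\<Sum>i\<in>PiE UNIV (\<lambda>j. {..<2 ^ l j}). v (l, i) * hat_basis l i x)" for l x
  proof -
    have "K l x t = (\<Sum>i\<in>PiE UNIV (\<lambda>j. {..<2 ^ l j}). hat_basis l i x * hat_basis l i t)" for t
      unfolding K_def level_kernel_def hat_basis_def by (subst prod_sum_PiE) (auto simp: prod.distrib)
    then have "(\<lambda>t. G t * K l x t) =
        (\<lambda>t. \<Sum>i\<in>PiE UNIV (\<lambda>j. {..<2 ^ l j}). hat_basis l i x * (G t * hat_basis l i t))"
      by (simp add: sum_distrib_left mult_ac)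
    then have "T l x = (\<Sum>i\<in>PiE UNIV (\<lambda>j. {..<2 ^ l j}). hat_basis l i x * integral\<^sup>L ?M (\<lambda>t. G t * hat_basis l i t))"
      unfolding T_def using hb(1)
      by (simp only: Bochner_Integration.integral_sum[OF integrable_mult_right[OF hb(1)]] integral_mult_right_zero)
    moreover have "(-1) ^ ?D * (-1) ^ ?D = (1::real)" by (simp add: power_mult_distrib[symmetric])
    ultimately show ?thesis by (simp add: v_def sum_distrib_left mult_ac)
  qed
  have sparse: "(\<Sum>(l, i)\<in>sparse_index n. v (l, i) * hat_basis l i x) = (-1) ^ ?D * (\<Sum>l\<in>sparse_levels n. c l * T l x)" for x
  proof -
    have "finite (PiE UNIV (\<lambda>j::'n. {..<(2::nat) ^ l j}))" for l by (intro finite_PiE) auto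
    then have "(\<Sum>(l, i)\<in>sparse_index n. v (l, i) * hat_basis l i x) =
        (\<Sum>l\<in>sparse_levels n. \<Sum>i\<in>PiE UNIV (\<lambda>j. {..<2 ^ l j}). v (l, i) * hat_basis l i x)"
      unfolding sparse_index_def by (subst sum.Sigma) (auto simp: finite_sparse_levels)
    moreover have "(-1) ^ ?D * (-1) ^ ?D = (1::real)" by (simp add: power_mult_distrib[symmetric])
    ultimately show ?thesis by (simp add: T_basis sum_distrib_left mult.assoc[symmetric])
  qed
  have main: "\<bar>integral\<^sup>L ?M (\<lambda>t. G t * (\<Prod>j\<in>UNIV. green (x $ j) (t $ j))) - (\<Sum>l\<in>sparse_levels n. c l * T l x)\<bar> \<le> E" for x
  proof (rule LIMSEQ_le_const)
    let ?I = "integral\<^sup>L ?M (\<lambda>t. G t * (\<Prod>j\<in>UNIV. green (x $ j) (t $ j)))"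
    let ?N = "integral\<^sup>L ?M (\<lambda>t. \<bar>G t\<bar>)"
    have "(\<lambda>Q. E + real ?D * ?N * (1 / 2) ^ Q) \<longlonglongrightarrow> E + real ?D * ?N * 0"
      by (intro tendsto_intros LIMSEQ_realpow_zero) auto
    then show "(\<lambda>Q. E + real ?D * ?N * (1 / 2) ^ Q) \<longlonglongrightarrow> E" by simp
    show "\<exists>Q0. \<forall>Q\<ge>Q0. \<bar>?I - (\<Sum>l\<in>sparse_levels n. c l * T l x)\<bar> \<le> E + real ?D * ?N * (1 / 2) ^ Q"
    proof (intro exI[of _ n] allI impI)
      fix Q assume Q: "n \<le> Q"
      define P where "P = PiE (UNIV :: 'n set) (\<lambda>_. {..<Q})"
      have finP: "finite P" unfolding P_def by (intro finite_PiE) auto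
      let ?S = "\<lambda>t. \<Prod>j\<in>UNIV. \<Sum>l<Q. level_kernel l (x $ j) (t $ j) / 2 ^ (l + 2)"
      have S: "?S t = (\<Sum>l\<in>P. c l * K l x t)" for t :: "real^'n"
        unfolding P_def c_def K_def by (subst prod_sum_PiE) (simp_all flip: prod.distrib)
      have GS: "(\<lambda>t. G t * ?S t) = (\<lambda>t. \<Sum>l\<in>P. c l * (G t * K l x t))"
        unfolding S by (simp add: sum_distrib_left mult_ac)
      have intS: "integrable ?M (\<lambda>t. G t * ?S t)"
        unfolding GS by (intro Bochner_Integration.integrable_sum integrable_mult_right TK)
      have valS: "integral\<^sup>L ?M (\<lambda>t. G t * ?S t) = (\<Sum>l\<in>P. c l * T l x)"
        unfolding GS T_def
        by (simp only: Bochner_Integration.integral_sum[OF integrable_mult_right[OF TK(1)]] integral_mult_right_zero)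
      have mgreen: "(\<lambda>t. \<Prod>j\<in>UNIV. green (x $ j) (t $ j)) \<in> borel_measurable ?M"
        unfolding green_def by (intro measurable_lebesgue_on_continuous continuous_intros)
      have intI: "integrable ?M (\<lambda>t. G t * (\<Prod>j\<in>UNIV. green (x $ j) (t $ j)))"
      proof (rule Bochner_Integration.integrable_bound[OF Gint])
        show "AE t in ?M. norm (G t * (\<Prod>j\<in>UNIV. green (x $ j) (t $ j))) \<le> norm (G t)"
          by (intro AE_I2) (auto simp: abs_mult abs_prod green_bounds intro!: mult_left_le prod_le_1)
      qed (use Gint mgreen in auto)
      have diff: "\<bar>(\<Prod>j\<in>UNIV. green (x $ j) (t $ j)) - ?S t\<bar> \<le> real ?D * (1 / 2) ^ Q" for t :: "real^'n"
      proof -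
        \<comment> \<open>Comparing products factor by factor needs factors of size at most 1. A
          partial sum is below \<open>green\<close> because the remainder of the expansion is
          nonnegative.\<close>
        have "norm (\<Sum>l<Q. level_kernel l (x $ j) (t $ j) / 2 ^ (l + 2)) \<le> 1" for j
        proof -
          have "0 \<le> (\<Sum>l<Q. level_kernel l (x $ j) (t $ j) / 2 ^ (l + 2))"
            by (intro sum_nonneg divide_nonneg_nonneg level_kernel_bounds) auto
          moreover have "0 \<le> (\<Sum>i<2^Q. green (2 ^ Q * x $ j - real i) (2 ^ Q * t $ j - real i)) / 2 ^ Q"
            by (intro divide_nonneg_nonneg sum_nonneg green_bounds) auto
          ultimately show ?thesis
            using green_expansion[of "x $ j" "t $ j" Q] green_bounds(2)[of "x $ j" "t $ j"]
            by (simp only: real_norm_def)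
        qed
        then have "norm ((\<Prod>j\<in>UNIV. green (x $ j) (t $ j)) - ?S t) \<le>
            (\<Sum>j\<in>UNIV. norm (green (x $ j) (t $ j) - (\<Sum>l<Q. level_kernel l (x $ j) (t $ j) / 2 ^ (l + 2))))"
          by (intro norm_prod_diff) (auto simp: green_bounds)
        also have "\<dots> \<le> (\<Sum>j\<in>(UNIV::'n set). 1 / 2 ^ Q)"
          unfolding real_norm_def by (intro sum_mono green_expansion_error)
        finally show ?thesis by (simp add: power_one_over)
      qed
      have "\<bar>?I - (\<Sum>l\<in>P. c l * T l x)\<bar> =
          \<bar>integral\<^sup>L ?M (\<lambda>t. G t * (\<Prod>j\<in>UNIV. green (x $ j) (t $ j)) - G t * ?S t)\<bar>"
        unfolding valS[symmetric] using intI intS by simp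
      also have "\<dots> \<le> integral\<^sup>L ?M (\<lambda>t. \<bar>G t * (\<Prod>j\<in>UNIV. green (x $ j) (t $ j)) - G t * ?S t\<bar>)"
        by (rule integral_abs_bound)
      also have "\<dots> \<le> integral\<^sup>L ?M (\<lambda>t. \<bar>G t\<bar> * (real ?D * (1 / 2) ^ Q))"
      proof (intro integral_mono integrable_abs Bochner_Integration.integrable_diff intI intS integrable_mult_left Gint)
        show "\<bar>G t * (\<Prod>j\<in>UNIV. green (x $ j) (t $ j)) - G t * ?S t\<bar> \<le> \<bar>G t\<bar> * (real ?D * (1 / 2) ^ Q)" for t
          unfolding right_diff_distrib[symmetric] abs_mult by (intro mult_left_mono diff) auto
      qed
      finally have 1: "\<bar>?I - (\<Sum>l\<in>P. c l * T l x)\<bar> \<le> real ?D * ?N * (1 / 2) ^ Q"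
        by (simp add: mult_ac)
      have sub: "sparse_levels n \<subseteq> P"
      proof
        fix l :: "'n \<Rightarrow> nat" assume "l \<in> sparse_levels n"
        then have "l j < Q" for j using member_le_sum[of j UNIV l] Q by (simp add: sparse_levels_def)
        then show "l \<in> P" by (auto simp: P_def)
      qed
      then have split: "(\<Sum>l\<in>P. c l * T l x) = (\<Sum>l\<in>sparse_levels n. c l * T l x) + (\<Sum>l\<in>P - sparse_levels n. c l * T l x)"
        using sum.subset_diff[OF sub finP, of "\<lambda>l. c l * T l x"] by linarith
      have "\<bar>\<Sum>l\<in>P - sparse_levels n. c l * T l x\<bar> \<le> (\<Sum>l\<in>P - sparse_levels n. \<bar>c l * T l x\<bar>)"
        by (rule sum_abs)
      also have "\<dots> \<le> (\<Sum>l\<in>P - sparse_levels n. level_error ?D (1 - inv_exp p) (sum l UNIV))"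
        unfolding level_error_def abs_mult using TK(2) c by (intro sum_mono mult_mono) auto
      also have "\<dots> \<le> (\<Sum>s=n..<?D * Q + 1. real (s + 1) ^ (?D - 1) * level_error ?D (1 - inv_exp p) s)"
      proof (rule sum_levels_beyond)
        fix l assume l: "l \<in> P - sparse_levels n"
        then have "sum l UNIV \<le> (\<Sum>j\<in>(UNIV::'n set). Q)"
          by (intro sum_mono) (auto simp: P_def PiE_iff less_imp_le)
        then show "n \<le> sum l UNIV \<and> sum l UNIV < ?D * Q + 1" using l by (auto simp: sparse_levels_def)
      qed (use finP in \<open>auto simp: level_error_def\<close>)
      also have "\<dots> \<le> E" by (rule E)
      finally show "\<bar>?I - (\<Sum>l\<in>sparse_levels n. c l * T l x)\<bar> \<le> E + real ?D * ?N * (1 / 2) ^ Q"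
        using 1 split by linarith
    qed
  qed
  have "AE x in ?M. \<bar>f x - (\<Sum>(l, i)\<in>sparse_index n. v (l, i) * hat_basis l i x)\<bar> \<le> E"
    using fG
  proof eventually_elim
    case (elim x)
    show ?case unfolding elim sparse right_diff_distrib[symmetric]
      using main[of x] by (simp add: abs_mult power_abs)
  qed
  then show thesis using that v1 by blast
qed

subsection \<open>Sparsely specified convolutional layers\<close>

text \<open>Channels come in \<open>M\<close> blocks of width \<open>w\<close>: channel \<open>b * w + r + 1\<close> is channel \<open>r\<close> of block \<open>b\<close>.
  A layer is described sparsely by giving, for each such channel, a list of entries
  (coefficient, source channel, spatial offsets) together with a bias; \<open>src b i\<close> is the absolute number
  of the source channel \<open>i\<close> of block \<open>b\<close> in the previous layer.\<close>

type_synonym layer_spec = "nat \<Rightarrow> nat \<Rightarrow> (real \<times> nat \<times> int \<times> int) list \<times> real"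

definition block_layer :: "nat \<Rightarrow> nat \<Rightarrow> (nat \<Rightarrow> nat \<Rightarrow> nat) \<Rightarrow> layer_spec \<Rightarrow> kernel \<times> (nat \<Rightarrow> real)" where
  "block_layer w M src sp =
    (\<lambda>p q s t. if (p - 1) div w < M
       then \<Sum>(a, i, s', t')\<leftarrow>fst (sp ((p - 1) div w) ((p - 1) mod w)).
              (if q = src ((p - 1) div w) i \<and> s = s' \<and> t = t' then a else 0)
       else 0,
     \<lambda>p. if (p - 1) div w < M then snd (sp ((p - 1) div w) ((p - 1) mod w)) else 0)"

lemma sum_single_entry:
  fixes Z :: "nat \<Rightarrow> int \<Rightarrow> int \<Rightarrow> real"
  assumes "q0 \<in> {1..c}" "s0 \<in> {-int k..int k}" "t0 \<in> {-int k..int k}"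
  shows "(\<Sum>q\<in>{1..c}. \<Sum>s\<in>{-int k..int k}. \<Sum>t\<in>{-int k..int k}.
     (if q = q0 \<and> s = s0 \<and> t = t0 then a else 0) * Z q s t) = a * Z q0 s0 t0"
proof -
  have "(if q = q0 \<and> s = s0 \<and> t = t0 then a else 0) * Z q s t =
     (if q = q0 then if s = s0 then if t = t0 then a * Z q s t else 0 else 0 else 0)" for q s t
    by simp
  then have "(\<Sum>t\<in>{-int k..int k}. (if q = q0 \<and> s = s0 \<and> t = t0 then a else 0) * Z q s t) =
      (if q = q0 then if s = s0 then a * Z q s t0 else 0 else 0)" for q s
    using assms(3) by (simp add: sum.delta)
  then have "(\<Sum>s\<in>{-int k..int k}. \<Sum>t\<in>{-int k..int k}. (if q = q0 \<and> s = s0 \<and> t = t0 then a else 0) * Z q s t) =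
      (if q = q0 then a * Z q s0 t0 else 0)" for q
    using assms(2) by (simp add: sum.delta)
  then show ?thesis using assms(1) by (simp add: sum.delta)
qed

text \<open>The kernel adds up coefficients of repeated list entries, so by linearity the
  convolution is a sum over the list, with one surviving summand of the triple sum for each
  entry.\<close>

lemma block_layer_eval:
  assumes r: "r < w" and b: "b < M" "M * w \<le> W" and mn: "m \<in> {1..d}" "n \<in> {1..d}"
    and valid: "\<And>a i s t. (a, i, s, t) \<in> set (fst (sp b r)) \<Longrightarrow>
      src b i \<in> {1..c} \<and> s \<in> {-int k..int k} \<and> t \<in> {-int k..int k}"
  shows "cnn_layer d k c W (block_layer w M src sp) Y (b * w + r + 1) m n =
    relu ((\<Sum>(a, i, s, t)\<leftarrow>fst (sp b r). a * zpad d Y (src b i) (int m + s) (int n + t)) + snd (sp b r))"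
proof -
  let ?p = "b * w + r + 1"
  have div: "(?p - 1) div w = b" "(?p - 1) mod w = r" using r by auto
  have "(b + 1) * w \<le> M * w" using b by (intro mult_right_mono) auto
  then have p: "?p \<in> {1..W}" using r b by auto
  have *: "(\<Sum>q\<in>{1..c}. \<Sum>s\<in>{-int k..int k}. \<Sum>t\<in>{-int k..int k}.
      (\<Sum>(a, i, s', t')\<leftarrow>es. if q = src b i \<and> s = s' \<and> t = t' then a else 0) * Z q s t)
      = (\<Sum>(a, i, s, t)\<leftarrow>es. a * Z (src b i) s t)"
    if "\<And>a i s t. (a, i, s, t) \<in> set es \<Longrightarrow>
      src b i \<in> {1..c} \<and> s \<in> {-int k..int k} \<and> t \<in> {-int k..int k}"
    for es and Z :: "nat \<Rightarrow> int \<Rightarrow> int \<Rightarrow> real"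
    using that
  proof (induction es)
    case Nil
    then show ?case by simp
  next
    case (Cons x es)
    obtain a i s0 t0 where x: "x = (a, i, s0, t0)" by (cases x) auto
    have v: "src b i \<in> {1..c}" "s0 \<in> {-int k..int k}" "t0 \<in> {-int k..int k}"
      using Cons.prems[of a i s0 t0] x by auto
    have IH: "(\<Sum>q\<in>{1..c}. \<Sum>s\<in>{-int k..int k}. \<Sum>t\<in>{-int k..int k}.
      (\<Sum>(a, i, s', t')\<leftarrow>es. if q = src b i \<and> s = s' \<and> t = t' then a else 0) * Z q s t)
      = (\<Sum>(a, i, s, t)\<leftarrow>es. a * Z (src b i) s t)"
      by (rule Cons.IH) (use Cons.prems in auto)
    show ?case
      unfolding x list.map sum_list.Cons prod.case distrib_right sum.distrib
      unfolding IH sum_single_entry[OF v] ..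
  qed
  have "conv d k c (fst (block_layer w M src sp)) Y ?p m n =
      (\<Sum>(a, i, s, t)\<leftarrow>fst (sp b r). a * zpad d Y (src b i) (int m + s) (int n + t))"
    unfolding conv_def block_layer_def fst_conv div using b(1) *[OF valid] by simp
  moreover have "snd (block_layer w M src sp) ?p = snd (sp b r)"
    unfolding block_layer_def snd_conv div using b(1) by simp
  ultimately show ?thesis using p mn by (simp add: cnn_layer_def)
qed

lemma sum_list_nonzeroD: "(\<Sum>x\<leftarrow>xs. f x) \<noteq> 0 \<Longrightarrow> \<exists>x\<in>set xs. f x \<noteq> 0"
  for f :: "'a \<Rightarrow> real"
  by (induction xs) auto

text \<open>Each nonzero kernel entry comes from a pair of a channel and a list position; the extra
  1 for each channel pays for its bias.\<close>

lemma block_layer_nnz: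
  assumes w: "w > 0" and len: "\<And>b r. length (fst (sp b r)) \<le> s"
  shows "layer_nnz k c W (block_layer w M src sp) \<le> (s + 1) * (M * w)"
proof -
  let ?es = "\<lambda>u. fst (sp (u div w) (u mod w))"
  let ?K = "{(p, q, s, t). p \<in> {1..W} \<and> q \<in> {1..c} \<and> s \<in> {-int k..int k} \<and> t \<in> {-int k..int k}
                         \<and> fst (block_layer w M src sp) p q s t \<noteq> 0}"
  let ?f = "\<lambda>(u, j). case ?es u ! j of (a, i, s, t) \<Rightarrow> (u + 1, src (u div w) i, s, t)"
  let ?J = "Sigma {..<M * w} (\<lambda>u. {..<length (?es u)})"
  have "?K \<subseteq> ?f ` ?J"
  proof
    fix z assume "z \<in> ?K"
    then obtain p q s0 t0 where z: "z = (p, q, s0, t0)" "p \<ge> 1"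
      and nz: "fst (block_layer w M src sp) p q s0 t0 \<noteq> 0" by auto
    let ?u = "p - 1"
    have blk: "?u div w < M" using nz by (auto simp: block_layer_def split: if_splits)
    then have u: "?u < M * w" using w by (simp add: div_less_iff_less_mult)
    have "(\<Sum>(a, i, s', t')\<leftarrow>?es ?u. if q = src (?u div w) i \<and> s0 = s' \<and> t0 = t' then a else 0) \<noteq> 0"
      using nz blk by (simp add: block_layer_def)
    then have "\<exists>e\<in>set (?es ?u). (case e of (a, i, s', t') \<Rightarrow>
        if q = src (?u div w) i \<and> s0 = s' \<and> t0 = t' then a else 0) \<noteq> 0"
      by (rule sum_list_nonzeroD)
    then obtain a i where "(a, i, s0, t0) \<in> set (?es ?u)" "q = src (?u div w) i"
      by (auto split: if_splits)
    then obtain j where "j < length (?es ?u)" "?es ?u ! j = (a, i, s0, t0)" by (auto simp: in_set_conv_nth)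
    then show "z \<in> ?f ` ?J" using u z \<open>q = _\<close> by (intro image_eqI[of _ _ "(?u, j)"]) auto
  qed
  then have "card ?K \<le> card ?J" by (rule surj_card_le[rotated]) auto
  also have "\<dots> = (\<Sum>u<M * w. length (?es u))" by simp
  also have "\<dots> \<le> (\<Sum>u<M * w. s)" by (intro sum_mono len)
  finally have K: "card ?K \<le> s * (M * w)" by (simp add: mult.commute)
  have "{p \<in> {1..W}. snd (block_layer w M src sp) p \<noteq> 0} \<subseteq> (\<lambda>u. u + 1) ` {..<M * w}"
  proof
    fix p assume p: "p \<in> {p \<in> {1..W}. snd (block_layer w M src sp) p \<noteq> 0}"
    then have "(p - 1) div w < M" by (auto simp: block_layer_def split: if_splits)
    then have "p - 1 < M * w" using w by (simp add: div_less_iff_less_mult)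
    then show "p \<in> (\<lambda>u. u + 1) ` {..<M * w}" using p by (intro image_eqI[of _ _ "p - 1"]) auto
  qed
  then have "card {p \<in> {1..W}. snd (block_layer w M src sp) p \<noteq> 0} \<le> card {..<M * w}"
    by (rule surj_card_le[rotated]) simp
  then show ?thesis using K unfolding layer_nnz_def by simp
qed

lemma cnn_eval_constant_width:
  "cnn_eval d k (W # replicate (length Ls) W) Ls Y = fold (cnn_layer d k W W) Ls Y"
  by (induction Ls arbitrary: Y) auto

subsection \<open>Approximate products by ReLU networks\<close>

definition tent :: "real \<Rightarrow> real" where
  "tent z = 2 * z - 4 * relu (z - 1 / 2)"

text \<open>On [0,1] this is the piecewise linear interpolant of the square at the multiples of
  2^(-m), written as a sum of sawtooth corrections.\<close>

definition approx_square :: "nat \<Rightarrow> real \<Rightarrow> real" where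
  "approx_square m z = z - (\<Sum>s<m. (tent ^^ Suc s) z / 4 ^ Suc s)"

definition approx_mult :: "nat \<Rightarrow> real \<Rightarrow> real \<Rightarrow> real" where
  "approx_mult m x y = relu (approx_square m ((x + y) / 2) - approx_square m (\<bar>x - y\<bar> / 2))"

primrec product_tree :: "nat \<Rightarrow> (nat \<Rightarrow> real) \<Rightarrow> nat \<Rightarrow> nat \<Rightarrow> real" where
  "product_tree m f 0 j = f j"
| "product_tree m f (Suc h) j = approx_mult m (product_tree m f h (2 * j)) (product_tree m f h (2 * j + 1))"

lemma tent_bounds: "0 \<le> z \<Longrightarrow> z \<le> 1 \<Longrightarrow> 0 \<le> tent z \<and> tent z \<le> 1"
  by (auto simp: tent_def relu_def max_def)

lemma funpow_tent_bounds: "0 \<le> z \<Longrightarrow> z \<le> 1 \<Longrightarrow> 0 \<le> (tent ^^ s) z \<and> (tent ^^ s) z \<le> 1"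
  by (induction s) (auto simp: tent_bounds)

lemma approx_square_Suc: "approx_square (Suc m) z = z - tent z / 2 + approx_square m (tent z) / 4"
  unfolding approx_square_def sum.lessThan_Suc_shift
  by (simp add: funpow_swap1 sum_divide_distrib diff_divide_distrib)

text \<open>Since z - tent z / 2 - z^2 = - (tent z)^2 / 4, the error at z with m + 1 corrections is
  a quarter of the error at \<open>tent z\<close> with m. The induction starts from z - z^2 \<le>
  1/4.\<close>

lemma approx_square_error:
  assumes "0 \<le> z" "z \<le> 1"
  shows "0 \<le> approx_square m z - z\<^sup>2" "approx_square m z - z\<^sup>2 \<le> 1 / 4 ^ Suc m"
proof -
  have "0 \<le> approx_square m z - z\<^sup>2 \<and> approx_square m z - z\<^sup>2 \<le> 1 / 4 ^ Suc m"
    using assms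
  proof (induction m arbitrary: z)
    case 0
    have "0 \<le> z * (1 - z)" using 0 by (intro mult_nonneg_nonneg) auto
    moreover have "0 \<le> (z - 1 / 2)\<^sup>2" by simp
    ultimately show ?case by (simp add: approx_square_def power2_eq_square algebra_simps)
  next
    case (Suc m)
    have "z - tent z / 2 - z\<^sup>2 = - (tent z)\<^sup>2 / 4"
    proof (cases "z \<le> 1 / 2")
      case True
      then have "tent z = 2 * z" by (simp add: tent_def relu_def)
      then show ?thesis by (simp add: power2_eq_square)
    next
      case False
      then have "tent z = 2 - 2 * z" by (simp add: tent_def relu_def)
      then show ?thesis by (simp only:) (simp add: power2_eq_square field_simps)
    qed
    then have "approx_square (Suc m) z - z\<^sup>2 = (approx_square m (tent z) - (tent z)\<^sup>2) / 4"
      unfolding approx_square_Suc by (simp add: field_simps)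
    then show ?case using Suc.IH[of "tent z"] tent_bounds[OF Suc.prems] by simp
  qed
  then show "0 \<le> approx_square m z - z\<^sup>2" "approx_square m z - z\<^sup>2 \<le> 1 / 4 ^ Suc m" by auto
qed

lemma approx_square_bounds:
  assumes "0 \<le> z" "z \<le> 1"
  shows "0 \<le> approx_square m z" "approx_square m z \<le> 1"
proof -
  show "0 \<le> approx_square m z" using approx_square_error(1)[OF assms, of m] zero_le_power2[of z] by linarith
  have "0 \<le> (\<Sum>s<m. (tent ^^ Suc s) z / 4 ^ Suc s)"
    by (intro sum_nonneg divide_nonneg_nonneg conjunct1[OF funpow_tent_bounds[OF assms]]) auto
  then show "approx_square m z \<le> 1" using assms by (simp add: approx_square_def)
qed

text \<open>Both squares are overestimated, so the two errors have opposite effect in the difference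
  and never exceed a single one. Clipping at 0 cannot increase the distance to the nonnegative
  product.\<close>

lemma approx_mult_error:
  assumes "0 \<le> x" "x \<le> 1" "0 \<le> y" "y \<le> 1"
  shows "0 \<le> approx_mult m x y" "approx_mult m x y \<le> 1" "\<bar>approx_mult m x y - x * y\<bar> \<le> 1 / 4 ^ Suc m"
proof -
  have a: "0 \<le> (x + y) / 2" "(x + y) / 2 \<le> 1" and b: "0 \<le> \<bar>x - y\<bar> / 2" "\<bar>x - y\<bar> / 2 \<le> 1"
    using assms by auto
  show "0 \<le> approx_mult m x y" by (simp add: approx_mult_def relu_def)
  show "approx_mult m x y \<le> 1"
    using approx_square_bounds(2)[OF a, of m] approx_square_bounds(1)[OF b, of m] by (simp add: approx_mult_def relu_def)
  have xy: "x * y = ((x + y) / 2)\<^sup>2 - (\<bar>x - y\<bar> / 2)\<^sup>2"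
    by (simp add: power_divide power2_eq_square field_simps)
  have "0 \<le> x * y" using assms by simp
  then show "\<bar>approx_mult m x y - x * y\<bar> \<le> 1 / 4 ^ Suc m"
    using approx_square_error[OF a, of m] approx_square_error[OF b, of m] unfolding approx_mult_def relu_def xy
    by linarith
qed

lemma product_tree_bounds:
  assumes "\<And>j. 0 \<le> f j \<and> f j \<le> 1"
  shows "0 \<le> product_tree m f h j \<and> product_tree m f h j \<le> 1"
  using assms by (induction h arbitrary: j) (auto intro!: approx_mult_error)

lemma abs_mult_diff_le:
  fixes a b a' b' :: real
  assumes "0 \<le> a" "a \<le> 1" "0 \<le> b'" "b' \<le> 1"
  shows "\<bar>a * b - a' * b'\<bar> \<le> \<bar>a - a'\<bar> + \<bar>b - b'\<bar>"
proof -
  have "a * b - a' * b' = (a - a') * b' + a * (b - b')" by (simp add: algebra_simps)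
  also have "\<bar>\<dots>\<bar> \<le> \<bar>a - a'\<bar> * b' + a * \<bar>b - b'\<bar>"
    using assms abs_triangle_ineq[of "(a - a') * b'" "a * (b - b')"] by (simp add: abs_mult)
  also have "\<dots> \<le> \<bar>a - a'\<bar> + \<bar>b - b'\<bar>"
    using assms by (intro add_mono mult_left_le mult_left_le_one_le) auto
  finally show ?thesis .
qed

text \<open>All values lie in [0,1], so the errors of two factors add with weight at most 1. A
  subtree of height \<open>h\<close> contains 2^h - 1 multiplications, each contributing
  4^(-m-1).\<close>

lemma product_tree_error:
  assumes f: "\<And>j. 0 \<le> f j \<and> f j \<le> 1"
  shows "\<bar>product_tree m f h j - (\<Prod>i\<in>{j * 2 ^ h..<(j + 1) * 2 ^ h}. f i)\<bar> \<le> (2 ^ h - 1) / 4 ^ Suc m"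
proof (induction h arbitrary: j)
  case 0
  then show ?case by simp
next
  case (Suc h)
  let ?T = "product_tree m f h" and ?P = "\<lambda>j. \<Prod>i\<in>{j * 2 ^ h..<(j + 1) * 2 ^ h}. f i"
  have T: "0 \<le> ?T j" "?T j \<le> 1" for j using product_tree_bounds[of f m h j] f by auto
  have P: "0 \<le> ?P j" "?P j \<le> 1" for j using f by (auto intro!: prod_nonneg prod_le_1)
  have split: "(\<Prod>i\<in>{j * 2 ^ Suc h..<(j + 1) * 2 ^ Suc h}. f i) = ?P (2 * j) * ?P (2 * j + 1)"
    using prod.atLeastLessThan_concat[of "2 * j * 2 ^ h" "(2 * j + 1) * 2 ^ h" "(2 * j + 2) * 2 ^ h" f]
    by (simp add: algebra_simps)
  have "\<bar>?T (2 * j) * ?T (2 * j + 1) - ?P (2 * j) * ?P (2 * j + 1)\<bar>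
      \<le> \<bar>?T (2 * j) - ?P (2 * j)\<bar> + \<bar>?T (2 * j + 1) - ?P (2 * j + 1)\<bar>"
    by (intro abs_mult_diff_le T P)
  also have "\<dots> \<le> (2 ^ h - 1) / 4 ^ Suc m + (2 ^ h - 1) / 4 ^ Suc m"
    by (rule add_mono[OF Suc.IH Suc.IH])
  finally have 1: "\<bar>?T (2 * j) * ?T (2 * j + 1) - ?P (2 * j) * ?P (2 * j + 1)\<bar> \<le> 2 * ((2 ^ h - 1) / 4 ^ Suc m)"
    unfolding mult_2 .
  have "\<bar>approx_mult m (?T (2 * j)) (?T (2 * j + 1)) - ?T (2 * j) * ?T (2 * j + 1)\<bar> \<le> 1 / 4 ^ Suc m"
    by (intro approx_mult_error T)
  then have "\<bar>approx_mult m (?T (2 * j)) (?T (2 * j + 1)) - ?P (2 * j) * ?P (2 * j + 1)\<bar>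
      \<le> 1 / 4 ^ Suc m + 2 * ((2 ^ h - 1) / 4 ^ Suc m)" using 1 by linarith
  also have "\<dots> = (2 ^ Suc h - 1) / 4 ^ Suc m" by (simp add: field_simps)
  finally show ?case unfolding split product_tree.simps .
qed

subsection \<open>A network computing tensor products of hat functions\<close>

text \<open>There are \<open>M\<close> blocks, one for each basis function, and \<open>m\<close>
  sawtooth corrections per multiplication. The d^2 pixels are padded to 4^q leaves of a complete
  binary tree of height 2q; six channels per leaf hold the two squarings run in parallel.
  \<open>A\<close> and \<open>B\<close> give the scale and the offset of the hat for each block and
  pixel.\<close>

locale tensor_network =
  fixes d k q m M W :: nat and A B :: "nat \<Rightarrow> nat \<Rightarrow> real"
  assumes d: "1 \<le> d" and k: "1 \<le> k" and dq: "d \<le> 2 ^ q" and W: "M * (6 * 4 ^ q) \<le> W"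
begin

abbreviation P :: nat where "P \<equiv> 4 ^ q"

definition step :: "layer_spec \<Rightarrow> tensor \<Rightarrow> tensor" where
  "step sp = cnn_layer d k W W (block_layer (6 * P) M (\<lambda>b i. b * (6 * P) + i + 1) sp)"

text \<open>From the hat functions on, only the corner pixel matters. The \<open>6 P\<close> channels of a block are
  organised as \<open>P\<close> units of \<open>6\<close> components each; component \<open>c\<close> of unit \<open>j\<close> is channel \<open>c * P + j\<close>.\<close>

definition unit_spec :: "(nat \<Rightarrow> nat \<Rightarrow> nat \<Rightarrow> (real \<times> nat \<times> nat) list \<times> real) \<Rightarrow> layer_spec" where
  "unit_spec F b r = (map (\<lambda>(a, c, j). (a, c * P + j, 0, 0)) (fst (F b (r div P) (r mod P))),
     snd (F b (r div P) (r mod P)))"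

definition unit_val :: "tensor \<Rightarrow> nat \<Rightarrow> nat \<Rightarrow> nat \<Rightarrow> real" where
  "unit_val Y b c j = Y (b * (6 * P) + (c * P + j) + 1) 1 1"

lemma P_pos: "P > 0" by simp

lemma dd_le_P: "d * d \<le> P"
proof -
  have "d * d \<le> 2 ^ q * 2 ^ q" by (intro mult_mono dq) auto
  also have "\<dots> = (4::nat) ^ q" by (simp add: power_mult_distrib[symmetric])
  finally show ?thesis .
qed

lemma unit_channel: "c < 6 \<Longrightarrow> j < P \<Longrightarrow> c * P + j < 6 * P"
proof -
  assume "c < 6" "j < P"
  then have "c * P + j < (c + 1) * P" "(c + 1) * P \<le> 6 * P" by (simp, intro mult_right_mono) auto
  then show ?thesis by linarith
qed

lemma block_channel: "b < M \<Longrightarrow> r < 6 * P \<Longrightarrow> b * (6 * P) + r + 1 \<in> {1..W}"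
proof -
  assume "b < M" "r < 6 * P"
  moreover have "(b + 1) * (6 * P) \<le> M * (6 * P)" using \<open>b < M\<close> by (intro mult_right_mono) auto
  ultimately show ?thesis using W by auto
qed

lemma unit_step:
  assumes "b < M" "c < 6" "j < P"
    and valid: "\<And>a c' j'. (a, c', j') \<in> set (fst (F b c j)) \<Longrightarrow> c' < 6 \<and> j' < P"
  shows "unit_val (step (unit_spec F) Y) b c j =
    relu ((\<Sum>(a, c', j')\<leftarrow>fst (F b c j). a * unit_val Y b c' j') + snd (F b c j))"
proof -
  have dm: "(c * P + j) div P = c" "(c * P + j) mod P = j" using assms(3) by auto
  have v: "b * (6 * P) + i + 1 \<in> {1..W} \<and> s \<in> {-int k..int k} \<and> t \<in> {-int k..int k}"
    if "(a, i, s, t) \<in> set (fst (unit_spec F b (c * P + j)))" for a i s t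
    using that valid unit_channel block_channel[OF assms(1)] unfolding unit_spec_def dm by fastforce
  have z: "zpad d Y p (int 1 + 0) (int 1 + 0) = Y p 1 1" for p using d by (simp add: zpad_def)
  have "unit_val (step (unit_spec F) Y) b c j =
    relu ((\<Sum>(a, i, s, t)\<leftarrow>fst (unit_spec F b (c * P + j)).
        a * zpad d Y (b * (6 * P) + i + 1) (int 1 + s) (int 1 + t)) + snd (unit_spec F b (c * P + j)))"
    unfolding unit_val_def step_def
    by (rule block_layer_eval[OF unit_channel[OF assms(2,3)] assms(1) W]) (use d in simp, use d in simp, rule v)
  also have "(\<Sum>(a, i, s, t)\<leftarrow>fst (unit_spec F b (c * P + j)).
        a * zpad d Y (b * (6 * P) + i + 1) (int 1 + s) (int 1 + t)) =
      (\<Sum>(a, c', j')\<leftarrow>fst (F b c j). a * unit_val Y b c' j')"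
    unfolding unit_spec_def dm fst_conv map_map
    by (intro arg_cong[where f = sum_list] map_cong refl) (auto simp: unit_val_def z[simplified])
  also have "snd (unit_spec F b (c * P + j)) = snd (F b c j)" unfolding unit_spec_def dm by simp
  finally show ?thesis .
qed

text \<open>The input layer copies the image into every channel of a block. It is used with the
  constant source map 1, so the source 0 is a dummy.\<close>

definition input_spec :: layer_spec where
  "input_spec b r = ([(1, 0, 0, 0)], 0)"

text \<open>Channel \<open>j\<close> moves pixel \<open>(j div d + 1, j mod d + 1)\<close> to the corner, one step per layer.\<close>

definition shift_spec :: "nat \<Rightarrow> layer_spec" where
  "shift_spec T b r = (if r < d * d
     then [(1, r, if T < r div d then 1 else 0, if T < r mod d then 1 else 0)] else [], 0)"

text \<open>Components 0 and 1 receive the positive and the negative part of the argument of the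
  hat; their sum is its absolute value.\<close>

definition hat1_spec where
  "hat1_spec b c j = (if j < d * d \<and> c = 0 then ([(A b j, 0::nat, j)], - B b j)
     else if j < d * d \<and> c = (1::nat) then ([(- A b j, 0, j)], B b j) else ([], 0))"

text \<open>For units beyond the pixels the empty list with bias 1 produces the neutral leaf
  1.\<close>

definition hat2_spec where
  "hat2_spec (b::nat) c j = (if c = (0::nat) \<and> j < d * d then [(- 1 :: real, 0::nat, j), (- 1, 1, j)] else [], 1 :: real)"

text \<open>For x, y in the units 2j and 2j + 1, components 0, 1, 2 of unit j become (x + y)/2 and
  the positive and negative parts of (x - y)/2.\<close>

definition pre1_spec where
  "pre1_spec (b::nat) c j = (if 2 * j + 1 < P \<and> c < (3::nat)
     then [(if c = 2 then - 1 / 2 else 1 / 2 :: real, 0::nat, 2 * j), (if c = 1 then - 1 / 2 else 1 / 2, 0, 2 * j + 1)]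
     else [], 0 :: real)"

text \<open>Prepares two squaring states, in components 0 to 2 for (x + y)/2 and 3 to 5 for |x -
  y|/2. A state consists of z, relu(z - 1/2) and an accumulator that starts at z.\<close>

definition pre2_spec where
  "pre2_spec (b::nat) c (j::nat) = (if c < (3::nat) then ([(1 :: real, 0::nat, j)], if c = 1 then - 1 / 2 else 0 :: real)
     else ([(1, 1, j), (1, 2, j)], if c = 4 then - 1 / 2 else 0))"

text \<open>\<open>c0\<close> is the first component of the state containing \<open>c\<close>. The
  first two components advance by the tent map, while the third subtracts the new tent value divided
  by 4^(s+1).\<close>

definition square_spec where
  "square_spec s (b::nat) c (j::nat) =
     (let c0 = (if c < (3::nat) then 0 else 3) in
      if c = c0 + 2 then ([(1 :: real, c0 + 2, j), (- 2 / 4 ^ Suc s, c0, j), (4 / 4 ^ Suc s, c0 + 1, j)], 0 :: real)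
      else ([(2, c0, j), (- 4, c0 + 1, j)], if c = c0 + 1 then - 1 / 2 else 0))"

definition final_spec where
  "final_spec (b::nat) c (j::nat) = (if c = (0::nat) then [(1 :: real, 2::nat, j), (- 1, 5, j)] else [], 0 :: real)"

definition level_specs :: "layer_spec list" where
  "level_specs = [unit_spec pre1_spec, unit_spec pre2_spec] @
     map (\<lambda>s. unit_spec (square_spec s)) [0..<m] @ [unit_spec final_spec]"

text \<open>Together with the input layer the depth is 1 + (6d - 3) + 2 + 2q(m + 3) = 2q(m + 3) +
  6d, as prescribed. The moves are complete after d - 1 shift layers; the later ones have offset 0
  and merely copy.\<close>

definition specs :: "layer_spec list" where
  "specs = map shift_spec [0..<6 * d - 3] @ [unit_spec hat1_spec, unit_spec hat2_spec] @
     concat (replicate (2 * q) level_specs)"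

lemma square_step:
  assumes "b < M" "j < P" and c0: "c0 = 0 \<or> c0 = 3"
  shows "unit_val (step (unit_spec (square_spec s)) Y) b c0 j =
      relu (2 * unit_val Y b c0 j - 4 * unit_val Y b (c0 + 1) j)"
    "unit_val (step (unit_spec (square_spec s)) Y) b (c0 + 1) j =
      relu (2 * unit_val Y b c0 j - 4 * unit_val Y b (c0 + 1) j - 1 / 2)"
    "unit_val (step (unit_spec (square_spec s)) Y) b (c0 + 2) j =
      relu (unit_val Y b (c0 + 2) j + (- 2 / 4 ^ Suc s * unit_val Y b c0 j + 4 / 4 ^ Suc s * unit_val Y b (c0 + 1) j))"
proof -
  have c: "c0 < 6" "c0 + 1 < 6" "c0 + 2 < 6" using c0 by auto
  have spec: "square_spec s b c0 j = ([(2, c0, j), (- 4, c0 + 1, j)], 0)"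
    "square_spec s b (c0 + 1) j = ([(2, c0, j), (- 4, c0 + 1, j)], - 1 / 2)"
    "square_spec s b (c0 + 2) j = ([(1, c0 + 2, j), (- 2 / 4 ^ Suc s, c0, j), (4 / 4 ^ Suc s, c0 + 1, j)], 0)"
    using c0 by (auto simp: square_spec_def Let_def)
  show "unit_val (step (unit_spec (square_spec s)) Y) b c0 j =
      relu (2 * unit_val Y b c0 j - 4 * unit_val Y b (c0 + 1) j)"
    by (subst unit_step[OF assms(1) c(1) assms(2)]) (use c assms(2) in \<open>auto simp: spec\<close>)
  show "unit_val (step (unit_spec (square_spec s)) Y) b (c0 + 1) j =
      relu (2 * unit_val Y b c0 j - 4 * unit_val Y b (c0 + 1) j - 1 / 2)"
    by (subst unit_step[OF assms(1) c(2) assms(2)], unfold spec) (use c assms(2) in auto)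
  show "unit_val (step (unit_spec (square_spec s)) Y) b (c0 + 2) j =
      relu (unit_val Y b (c0 + 2) j + (- 2 / 4 ^ Suc s * unit_val Y b c0 j + 4 / 4 ^ Suc s * unit_val Y b (c0 + 1) j))"
    by (subst unit_step[OF assms(1) c(3) assms(2)], unfold spec) (use c assms(2) in auto)
qed

text \<open>Iterated tent values and approximate squares are nonnegative on [0,1], so ReLU leaves
  the first and third components intact, and the second is meant to be clipped.\<close>

lemma square_phase:
  assumes "b < M" "j < P" and z: "0 \<le> z" "z \<le> 1" and c0: "c0 = 0 \<or> c0 = 3"
    and Y: "unit_val Y b c0 j = z" "unit_val Y b (c0 + 1) j = relu (z - 1 / 2)" "unit_val Y b (c0 + 2) j = z"
  shows "unit_val (fold step (map (\<lambda>s. unit_spec (square_spec s)) [0..<s]) Y) b c0 j = (tent ^^ s) z \<and>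
    unit_val (fold step (map (\<lambda>s. unit_spec (square_spec s)) [0..<s]) Y) b (c0 + 1) j = relu ((tent ^^ s) z - 1 / 2) \<and>
    unit_val (fold step (map (\<lambda>s. unit_spec (square_spec s)) [0..<s]) Y) b (c0 + 2) j = approx_square s z"
proof (induction s)
  case 0
  then show ?case using Y by (simp add: approx_square_def)
next
  case (Suc s)
  let ?Y = "fold step (map (\<lambda>s. unit_spec (square_spec s)) [0..<s]) Y"
  let ?t = "(tent ^^ s) z"
  have t: "0 \<le> tent ?t" using funpow_tent_bounds[OF z, of "Suc s"] by simp
  have tent: "2 * ?t - 4 * relu (?t - 1 / 2) = tent ?t" by (simp add: tent_def)
  have acc: "approx_square s z + (- 2 / 4 ^ Suc s * ?t + 4 / 4 ^ Suc s * relu (?t - 1 / 2)) = approx_square (Suc s) z"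
    by (simp add: approx_square_def tent_def field_simps)
  have st: "unit_val (step (unit_spec (square_spec s)) ?Y) b c0 j = relu (2 * ?t - 4 * relu (?t - 1 / 2))"
    "unit_val (step (unit_spec (square_spec s)) ?Y) b (c0 + 1) j = relu (2 * ?t - 4 * relu (?t - 1 / 2) - 1 / 2)"
    "unit_val (step (unit_spec (square_spec s)) ?Y) b (c0 + 2) j =
      relu (approx_square s z + (- 2 / 4 ^ Suc s * ?t + 4 / 4 ^ Suc s * relu (?t - 1 / 2)))"
    unfolding square_step[OF assms(1,2) c0] using Suc.IH by auto
  have "fold step (map (\<lambda>s. unit_spec (square_spec s)) [0..<Suc s]) Y = step (unit_spec (square_spec s)) ?Y" by simp
  then show ?case
    using st unfolding tent acc using t approx_square_bounds(1)[OF z, of "Suc s"] by (simp add: relu_def)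
qed

lemma pre2_step:
  assumes "b < M" "j < P"
  shows "c < 3 \<Longrightarrow> unit_val (step (unit_spec pre2_spec) Y) b c j =
      relu (unit_val Y b 0 j + (if c = 1 then - 1 / 2 else 0))"
    "3 \<le> c \<Longrightarrow> c < 6 \<Longrightarrow> unit_val (step (unit_spec pre2_spec) Y) b c j =
      relu (unit_val Y b 1 j + unit_val Y b 2 j + (if c = 4 then - 1 / 2 else 0))"
proof -
  assume c: "c < 3"
  then have spec: "pre2_spec b c j = ([(1, 0, j)], if c = 1 then - 1 / 2 else 0)" by (simp add: pre2_spec_def)
  show "unit_val (step (unit_spec pre2_spec) Y) b c j =
      relu (unit_val Y b 0 j + (if c = 1 then - 1 / 2 else 0))"
    by (subst unit_step[OF assms(1) _ assms(2)], unfold spec) (use c assms(2) in auto)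
next
  assume c: "3 \<le> c" "c < 6"
  then have spec: "pre2_spec b c j = ([(1, 1, j), (1, 2, j)], if c = 4 then - 1 / 2 else 0)"
    by (simp add: pre2_spec_def)
  show "unit_val (step (unit_spec pre2_spec) Y) b c j =
      relu (unit_val Y b 1 j + unit_val Y b 2 j + (if c = 4 then - 1 / 2 else 0))"
    by (subst unit_step[OF assms(1) _ assms(2)], unfold spec) (use c assms(2) in \<open>auto simp: add.assoc\<close>)
qed

lemma level_eval:
  assumes b: "b < M" and j: "2 * j + 1 < P"
    and xy: "unit_val Y b 0 (2 * j) = x" "unit_val Y b 0 (2 * j + 1) = y"
      "0 \<le> x" "x \<le> 1" "0 \<le> y" "y \<le> 1"
  shows "unit_val (fold step level_specs Y) b 0 j = approx_mult m x y"
proof -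
  have j': "j < P" using j by linarith
  let ?Y1 = "step (unit_spec pre1_spec) Y"
  let ?Y2 = "step (unit_spec pre2_spec) ?Y1"
  let ?Y3 = "fold step (map (\<lambda>s. unit_spec (square_spec s)) [0..<m]) ?Y2"
  let ?a = "(x + y) / 2" and ?b = "\<bar>x - y\<bar> / 2"
  have y1: "unit_val ?Y1 b 0 j = ?a"
    by (subst unit_step[OF b _ j']) (use j xy in \<open>auto simp: pre1_spec_def relu_def\<close>)
  have y1': "unit_val ?Y1 b 1 j = relu ((x - y) / 2)"
    by (subst unit_step[OF b _ j']) (use j xy in \<open>auto simp: pre1_spec_def diff_divide_distrib\<close>)
  have y1'': "unit_val ?Y1 b 2 j = relu ((y - x) / 2)"
    by (subst unit_step[OF b _ j']) (use j xy in \<open>auto simp: pre1_spec_def diff_divide_distrib\<close>)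
  have ab: "relu ((x - y) / 2) + relu ((y - x) / 2) = ?b" by (auto simp: relu_def max_def abs_if field_simps)
  note p2 = pre2_step[OF b j', of _ ?Y1, unfolded y1 y1' y1'' ab]
  have a: "unit_val ?Y2 b 0 j = ?a" "unit_val ?Y2 b (0 + 1) j = relu (?a - 1 / 2)" "unit_val ?Y2 b (0 + 2) j = ?a"
    unfolding add_0 using p2(1)[of 0] p2(1)[of 1] p2(1)[of 2] xy(3,5) by (auto simp: relu_def)
  have bb: "unit_val ?Y2 b 3 j = ?b" "unit_val ?Y2 b (3 + 1) j = relu (?b - 1 / 2)" "unit_val ?Y2 b (3 + 2) j = ?b"
    using p2(2)[of 3] p2(2)[of 4] p2(2)[of 5] by (auto simp: relu_def)
  have sq: "unit_val ?Y3 b 2 j = approx_square m ?a" "unit_val ?Y3 b 5 j = approx_square m ?b"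
    using square_phase[OF b j' _ _ _ a, of m, unfolded add_0] square_phase[OF b j' _ _ _ bb, of m] xy by auto
  have "unit_val (step (unit_spec final_spec) ?Y3) b 0 j = approx_mult m x y"
    by (subst unit_step[OF b _ j']) (use j' in \<open>auto simp: final_spec_def approx_mult_def sq\<close>)
  then show ?thesis by (simp add: level_specs_def)
qed

text \<open>After \<open>h\<close> levels the tree nodes occupy the units below 2^(2q-h); nothing is
  claimed about the contents of the other units.\<close>

lemma levels_eval:
  assumes b: "b < M" and f: "\<And>j. 0 \<le> f j \<and> f j \<le> 1"
    and Y: "\<And>j. j < P \<Longrightarrow> unit_val Y b 0 j = f j"
  shows "h \<le> 2 * q \<Longrightarrow> j < 2 ^ (2 * q - h) \<Longrightarrow>
    unit_val (fold step (concat (replicate h level_specs)) Y) b 0 j = product_tree m f h j"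
proof (induction h arbitrary: j)
  case 0
  then show ?case using Y by (simp add: power_mult)
next
  case (Suc h)
  let ?Y = "fold step (concat (replicate h level_specs)) Y"
  have "(2::nat) ^ (2 * q - h) = 2 * 2 ^ (2 * q - Suc h)"
    using Suc.prems by (metis Suc_diff_le diff_Suc_Suc power_Suc)
  then have j: "2 * j + 1 < 2 ^ (2 * q - h)" using Suc.prems by linarith
  also have "(2::nat) ^ (2 * q - h) \<le> 2 ^ (2 * q)" by (intro power_increasing) auto
  finally have jP: "2 * j + 1 < P" by (simp add: power_mult)
  have v: "unit_val ?Y b 0 (2 * j) = product_tree m f h (2 * j)"
    "unit_val ?Y b 0 (2 * j + 1) = product_tree m f h (2 * j + 1)"
    using Suc.IH[of "2 * j"] Suc.IH[of "2 * j + 1"] Suc.prems j by auto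
  have "concat (replicate (Suc h) level_specs) = concat (replicate h level_specs) @ level_specs"
    by (simp add: replicate_append_same[symmetric])
  then show ?case
    using level_eval[OF b jP v] product_tree_bounds[of f m h, OF f] by simp
qed

lemma input_eval:
  assumes "b < M" "r < 6 * P" "i \<in> {1..d}" "j \<in> {1..d}" "X 1 i j \<ge> 0"
  shows "cnn_layer d k 1 W (block_layer (6 * P) M (\<lambda>_ _. 1) input_spec) X (b * (6 * P) + r + 1) i j = X 1 i j"
proof -
  have "cnn_layer d k 1 W (block_layer (6 * P) M (\<lambda>_ _. 1) input_spec) X (b * (6 * P) + r + 1) i j =
    relu ((\<Sum>(a, c, s, t)\<leftarrow>fst (input_spec b r). a * zpad d X 1 (int i + s) (int j + t)) + snd (input_spec b r))"
    by (rule block_layer_eval[OF assms(2,1) W assms(3,4)]) (auto simp: input_spec_def)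
  then show ?thesis using assms by (simp add: input_spec_def zpad_def relu_def)
qed

text \<open>Successive moves compose to one read of the original image at offsets capped by the
  target. Reads beyond the edge give the padding 0 both before and after composition, and
  nonnegative pixels pass ReLU unchanged.\<close>

lemma shift_phase:
  assumes b: "b < M" and r: "r < d * d"
    and X: "\<And>i j. i \<in> {1..d} \<Longrightarrow> j \<in> {1..d} \<Longrightarrow> X 1 i j \<ge> 0"
    and Y: "\<And>i j. i \<in> {1..d} \<Longrightarrow> j \<in> {1..d} \<Longrightarrow> Y (b * (6 * P) + r + 1) i j = X 1 i j"
    and ij: "i \<in> {1..d}" "j \<in> {1..d}"
  shows "fold step (map shift_spec [0..<T]) Y (b * (6 * P) + r + 1) i j =
    zpad d X 1 (int i + int (min T (r div d))) (int j + int (min T (r mod d)))"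
  using ij
proof (induction T arbitrary: i j)
  case 0
  then show ?case using Y by (simp add: zpad_def)
next
  case (Suc T)
  let ?Y = "fold step (map shift_spec [0..<T]) Y" and ?p = "b * (6 * P) + r + 1"
  define s where "s = (if T < r div d then 1 else 0 :: nat)"
  define t where "t = (if T < r mod d then 1 else 0 :: nat)"
  have sp: "shift_spec T b r = ([(1, r, int s, int t)], 0)" using r by (auto simp: shift_spec_def s_def t_def)
  have s: "s + min T (r div d) = min (Suc T) (r div d)" by (auto simp: s_def)
  have t: "t + min T (r mod d) = min (Suc T) (r mod d)" by (auto simp: t_def)
  have r6: "r < 6 * P" using r dd_le_P P_pos by linarith
  have "step (shift_spec T) ?Y ?p i j = relu ((\<Sum>(a, c, s, t)\<leftarrow>fst (shift_spec T b r).
      a * zpad d ?Y (b * (6 * P) + c + 1) (int i + s) (int j + t)) + snd (shift_spec T b r))"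
    unfolding step_def
    by (rule block_layer_eval[OF r6 b W Suc.prems])
       (use block_channel[OF b r6] k in \<open>auto simp: sp s_def t_def\<close>)
  then have 1: "step (shift_spec T) ?Y ?p i j = relu (zpad d ?Y ?p (int (i + s)) (int (j + t)))"
    by (simp add: sp)
  have 2: "zpad d ?Y ?p (int (i + s)) (int (j + t)) =
      zpad d X 1 (int i + int (min (Suc T) (r div d))) (int j + int (min (Suc T) (r mod d)))"
  proof (cases "i + s \<le> d \<and> j + t \<le> d")
    case True
    then have "zpad d ?Y ?p (int (i + s)) (int (j + t)) = ?Y ?p (i + s) (j + t)"
      using Suc.prems unfolding zpad_def by (simp del: of_nat_add)
    also have "\<dots> = zpad d X 1 (int (i + s) + int (min T (r div d))) (int (j + t) + int (min T (r mod d)))"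
      using True Suc.prems by (intro Suc.IH) auto
    finally show ?thesis unfolding s[symmetric] t[symmetric] by (simp add: add.assoc)
  next
    case False
    then have "d < i + min (Suc T) (r div d) \<or> d < j + min (Suc T) (r mod d)"
      unfolding s[symmetric] t[symmetric] by linarith
    then have "zpad d X 1 (int i + int (min (Suc T) (r div d))) (int j + int (min (Suc T) (r mod d))) = 0"
      unfolding zpad_def by auto
    moreover have "zpad d ?Y ?p (int (i + s)) (int (j + t)) = 0" using False unfolding zpad_def by auto
    ultimately show ?thesis by simp
  qed
  have "nat u \<in> {1..d}" if "1 \<le> u" "u \<le> int d" for u using that by (simp, linarith)
  then have "zpad d X 1 u v \<ge> 0" for u v unfolding zpad_def using X by simp
  then have "step (shift_spec T) ?Y ?p i j =
      zpad d X 1 (int i + int (min (Suc T) (r div d))) (int j + int (min (Suc T) (r mod d)))"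
    unfolding 1 2 by (simp add: relu_def)
  then show ?case by simp
qed

definition leaf :: "tensor \<Rightarrow> nat \<Rightarrow> nat \<Rightarrow> real" where
  "leaf X b j = (if j < d * d then hat (A b j * X 1 (j div d + 1) (j mod d + 1) - B b j) else 1)"

lemma leaf_bounds: "0 \<le> leaf X b j \<and> leaf X b j \<le> 1"
  by (simp add: leaf_def hat_bounds)

lemma hat_phase:
  assumes b: "b < M" and j: "j < P"
    and Y: "\<And>j. j < d * d \<Longrightarrow> unit_val Y b 0 j = X 1 (j div d + 1) (j mod d + 1)"
  shows "unit_val (step (unit_spec hat2_spec) (step (unit_spec hat1_spec) Y)) b 0 j = leaf X b j"
proof (cases "j < d * d")
  case True
  let ?u = "A b j * X 1 (j div d + 1) (j mod d + 1) - B b j"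
  let ?Y1 = "step (unit_spec hat1_spec) Y"
  have s: "hat1_spec b 0 j = ([(A b j, 0, j)], - B b j)" "hat1_spec b 1 j = ([(- A b j, 0, j)], B b j)"
    "hat2_spec b 0 j = ([(- 1, 0, j), (- 1, 1, j)], 1)"
    using True by (auto simp: hat1_spec_def hat2_spec_def)
  have 1: "unit_val ?Y1 b 0 j = relu ?u"
    by (subst unit_step[OF b _ j], unfold s) (use j True in \<open>auto simp: Y\<close>)
  have 2: "unit_val ?Y1 b 1 j = relu (- ?u)"
    by (subst unit_step[OF b _ j], unfold s) (use j True in \<open>auto simp: Y\<close>)
  have "unit_val (step (unit_spec hat2_spec) ?Y1) b 0 j = relu (- unit_val ?Y1 b 0 j - unit_val ?Y1 b 1 j + 1)"
    by (subst unit_step[OF b _ j], unfold s) (use j in auto)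
  also have "\<dots> = hat ?u" unfolding 1 2 by (auto simp: relu_def hat_def max_def)
  finally show ?thesis using True by (simp add: leaf_def)
next
  case False
  then have s: "hat2_spec b 0 j = ([], 1)" by (simp add: hat2_spec_def)
  show ?thesis
    by (subst unit_step[OF b _ j], unfold s) (use False in \<open>auto simp: leaf_def relu_def\<close>)
qed

lemma network_value:
  assumes b: "b < M" and X: "\<And>i j. i \<in> {1..d} \<Longrightarrow> j \<in> {1..d} \<Longrightarrow> X 1 i j \<ge> 0"
    and Y: "Y = cnn_layer d k 1 W (block_layer (6 * P) M (\<lambda>_ _. 1) input_spec) X"
  shows "unit_val (fold step specs Y) b 0 0 = product_tree m (leaf X b) (2 * q) 0"
proof -
  let ?Y1 = "fold step (map shift_spec [0..<6 * d - 3]) Y"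
  have "unit_val ?Y1 b 0 j = X 1 (j div d + 1) (j mod d + 1)" if j: "j < d * d" for j
  proof -
    have dm: "j div d < d" "j mod d < d" using j d by (auto simp: div_less_iff_less_mult)
    then have mn: "min (6 * d - 3) (j div d) = j div d" "min (6 * d - 3) (j mod d) = j mod d" by linarith+
    have "j < 6 * P" using j dd_le_P P_pos by linarith
    then have "?Y1 (b * (6 * P) + j + 1) 1 1 = zpad d X 1 (int 1 + int (j div d)) (int 1 + int (j mod d))"
      using shift_phase[where X = X and Y = Y and b = b and r = j and i = 1 and j = 1 and T = "6 * d - 3"]
        b j X input_eval[where X = X, OF b] d
      unfolding mn Y by simp
    then show ?thesis using dm by (simp add: unit_val_def zpad_def nat_add_distrib)
  qed
  then have "unit_val (step (unit_spec hat2_spec) (step (unit_spec hat1_spec) ?Y1)) b 0 j = leaf X b j"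
    if "j < P" for j using that by (intro hat_phase b) auto
  from levels_eval[OF b leaf_bounds this, where h = "2 * q" and j = 0] show ?thesis
    by (simp add: specs_def)
qed

lemma network_error:
  assumes "b < M" "\<And>i j. i \<in> {1..d} \<Longrightarrow> j \<in> {1..d} \<Longrightarrow> X 1 i j \<ge> 0"
    "Y = cnn_layer d k 1 W (block_layer (6 * P) M (\<lambda>_ _. 1) input_spec) X"
  shows "\<bar>unit_val (fold step specs Y) b 0 0 -
     (\<Prod>j<d * d. hat (A b j * X 1 (j div d + 1) (j mod d + 1) - B b j))\<bar> \<le> 4 ^ q / 4 ^ Suc m"
proof -
  have "(\<Prod>i\<in>{0..<P}. leaf X b i) = (\<Prod>i<d * d. leaf X b i)"
    using dd_le_P by (intro prod.mono_neutral_right) (auto simp: leaf_def)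
  also have "\<dots> = (\<Prod>j<d * d. hat (A b j * X 1 (j div d + 1) (j mod d + 1) - B b j))"
    by (intro prod.cong) (auto simp: leaf_def)
  finally have p: "(\<Prod>i\<in>{0..<P}. leaf X b i) = (\<Prod>j<d * d. hat (A b j * X 1 (j div d + 1) (j mod d + 1) - B b j))" .
  have "\<bar>product_tree m (leaf X b) (2 * q) 0 - (\<Prod>i\<in>{0..<P}. leaf X b i)\<bar> \<le> (4 ^ q - 1) / 4 ^ Suc m"
    using product_tree_error[of "leaf X b" m "2 * q" 0, OF leaf_bounds] by (simp add: power_mult)
  also have "\<dots> \<le> 4 ^ q / 4 ^ Suc m" by (intro divide_right_mono) auto
  finally have "\<bar>product_tree m (leaf X b) (2 * q) 0 - (\<Prod>i\<in>{0..<P}. leaf X b i)\<bar> \<le> 4 ^ q / 4 ^ Suc m" .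
  moreover have "unit_val (fold step specs Y) b 0 0 = product_tree m (leaf X b) (2 * q) 0"
    by (rule network_value) (use assms in auto)
  ultimately show ?thesis by (simp only: p)
qed

lemma length_specs: "length specs = 2 * q * (m + 3) + 6 * d - 1"
proof -
  have "length (concat (replicate n level_specs)) = n * (m + 3)" for n
    by (induction n) (auto simp: level_specs_def)
  then show ?thesis using d by (simp add: specs_def)
qed

lemma specs_sparse:
  assumes "sp \<in> insert input_spec (set specs)"
  shows "length (fst (sp b r)) \<le> 3"
proof -
  have u: "length (fst (unit_spec F b r)) \<le> 3" if "\<And>b c j. length (fst (F b c j)) \<le> 3" for F
    using that by (simp add: unit_spec_def)
  have "set (concat (replicate (2 * q) level_specs)) \<subseteq> set level_specs" by auto
  then consider "sp = input_spec" | T where "sp = shift_spec T" | "sp = unit_spec hat1_spec" | "sp = unit_spec hat2_spec"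
    | "sp = unit_spec pre1_spec" | "sp = unit_spec pre2_spec" | s where "sp = unit_spec (square_spec s)"
    | "sp = unit_spec final_spec"
    using assms unfolding specs_def level_specs_def by auto
  then show ?thesis
  proof cases
    case 1 then show ?thesis by (simp add: input_spec_def)
  next
    case 2 then show ?thesis by (simp add: shift_spec_def)
  next
    case 3 then show ?thesis by (simp only:) (rule u, simp add: hat1_spec_def)
  next
    case 4 then show ?thesis by (simp only:) (rule u, simp add: hat2_spec_def)
  next
    case 5 then show ?thesis by (simp only:) (rule u, simp add: pre1_spec_def)
  next
    case 6 then show ?thesis by (simp only:) (rule u, simp add: pre2_spec_def)
  next
    case 7 then show ?thesis by (simp only:) (rule u, simp add: square_spec_def Let_def)
  next
    case 8 then show ?thesis by (simp only:) (rule u, simp add: final_spec_def)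
  qed
qed

text \<open>Entry b * 6P * d^2 + 1 of the vectorisation is the corner pixel of the first channel of
  block b, so one coefficient per block reads off its product.\<close>

lemma readout:
  fixes v :: "nat \<Rightarrow> real" and Z :: tensor
  defines "\<alpha> \<equiv> \<lambda>i. if (i - 1) mod (6 * P * (d * d)) = 0 \<and> (i - 1) div (6 * P * (d * d)) < M
    then v ((i - 1) div (6 * P * (d * d))) else 0"
  shows "(\<Sum>i\<in>{1..W * d * d}. \<alpha> i * tvec d Z i) = (\<Sum>b<M. v b * unit_val Z b 0 0)"
    "card {i \<in> {1..W * d * d}. \<alpha> i \<noteq> 0} \<le> M"
proof -
  let ?w = "6 * P * (d * d)" and ?f = "\<lambda>b. b * (6 * P * (d * d)) + 1"
  have w: "?w > 0" using d by simp
  have sub: "?f ` {..<M} \<subseteq> {1..W * d * d}"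
  proof
    fix i assume "i \<in> ?f ` {..<M}"
    then obtain b where b: "b < M" "i = b * ?w + 1" by auto
    have "(b + 1) * ?w \<le> M * ?w" using b by (intro mult_right_mono) auto
    also have "M * ?w = M * (6 * P) * (d * d)" by simp
    also have "\<dots> \<le> W * (d * d)" by (intro mult_right_mono W) simp
    finally have "b * ?w + ?w \<le> W * (d * d)" by simp
    then have "i \<le> W * (d * d)" unfolding b using w by linarith
    then show "i \<in> {1..W * d * d}" using b by (simp add: mult.assoc)
  qed
  have supp: "i \<in> ?f ` {..<M}" if "i \<in> {1..W * d * d}" "\<alpha> i \<noteq> 0" for i
  proof -
    have "(i - 1) mod ?w = 0" "(i - 1) div ?w < M" using that(2) by (auto simp: \<alpha>_def split: if_splits)
    then have "i = ?f ((i - 1) div ?w)" using that(1) div_mult_mod_eq[of "i - 1" ?w] by simp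
    then show ?thesis using \<open>(i - 1) div ?w < M\<close> by blast
  qed
  have inj: "inj_on ?f {..<M}" using w by (auto simp: inj_on_def)
  have tv: "tvec d Z (?f b) = unit_val Z b 0 0" for b
  proof -
    have "b * ?w = (b * (6 * P)) * (d * d)" by simp
    moreover have "(b * (6 * P)) * (d * d) mod d = 0" by simp
    ultimately show ?thesis using d unfolding tvec_def unit_val_def by (simp del: mult.assoc)
  qed
  have "(\<Sum>i\<in>{1..W * d * d}. \<alpha> i * tvec d Z i) = (\<Sum>i\<in>?f ` {..<M}. \<alpha> i * tvec d Z i)"
  proof (intro sum.mono_neutral_right sub ballI)
    fix i assume "i \<in> {1..W * d * d} - ?f ` {..<M}"
    then have "\<alpha> i = 0" using supp[of i] by blast
    then show "\<alpha> i * tvec d Z i = 0" by simp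
  qed simp
  also have "\<dots> = (\<Sum>b<M. \<alpha> (?f b) * tvec d Z (?f b))" by (simp only: sum.reindex[OF inj] o_def)
  also have "\<dots> = (\<Sum>b<M. v b * unit_val Z b 0 0)"
  proof (intro sum.cong refl)
    fix b assume "b \<in> {..<M}"
    then have "\<alpha> (?f b) = v b" using d by (simp add: \<alpha>_def)
    then show "\<alpha> (?f b) * tvec d Z (?f b) = v b * unit_val Z b 0 0" by (simp only: tv)
  qed
  finally show "(\<Sum>i\<in>{1..W * d * d}. \<alpha> i * tvec d Z i) = (\<Sum>b<M. v b * unit_val Z b 0 0)" .
  have "card {i \<in> {1..W * d * d}. \<alpha> i \<noteq> 0} \<le> card (?f ` {..<M})"
    using supp by (intro card_mono subsetI) blast+
  also have "\<dots> = M" using card_image[OF inj] by simp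
  finally show "card {i \<in> {1..W * d * d}. \<alpha> i \<noteq> 0} \<le> M" .
qed

lemma network_exists:
  fixes v :: "nat \<Rightarrow> real"
  assumes "W \<ge> 1" and L: "L = 2 * q * (m + 3) + 6 * d"
  obtains \<alpha> cs Ls where "cnn_shape cs Ls W L" "hyp_size d k 0 \<alpha> cs Ls \<le> L * (4 * (M * (6 * P))) + M"
    "\<forall>X. (\<forall>i\<in>{1..d}. \<forall>j\<in>{1..d}. X 1 i j \<ge> 0) \<longrightarrow>
      \<bar>hyp_eval d k 0 \<alpha> cs Ls X - (\<Sum>b<M. v b * (\<Prod>j<d * d. hat (A b j * X 1 (j div d + 1) (j mod d + 1) - B b j)))\<bar>
        \<le> (\<Sum>b<M. \<bar>v b\<bar>) * (4 ^ q / 4 ^ Suc m)"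
proof -
  define \<alpha> where "\<alpha> = (\<lambda>i. if (i - 1) mod (6 * P * (d * d)) = 0 \<and> (i - 1) div (6 * P * (d * d)) < M
    then v ((i - 1) div (6 * P * (d * d))) else 0)"
  define L0 where "L0 = block_layer (6 * P) M (\<lambda>_ _. 1) input_spec"
  define Ls where "Ls = L0 # map (block_layer (6 * P) M (\<lambda>b i. b * (6 * P) + i + 1)) specs"
  define cs where "cs = 1 # replicate L W"
  have len: "length Ls = L" using d by (simp add: Ls_def length_specs L)
  have L1: "L \<ge> 1" using d L by simp
  then have tl: "set (tl cs) = {W}" by (auto simp: cs_def)
  have last: "last cs = W" using L1 by (simp add: cs_def last_replicate)
  have shape: "cnn_shape cs Ls W L"
    unfolding cnn_shape_def using len L1 tl assms(1) by (auto simp: cs_def)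
  \<comment> \<open>At most three kernel entries and one bias for each channel in use give the
    factor 4.\<close>
  have "layer_nnz k c c' (Ls ! l) \<le> 4 * (M * (6 * P))" if "l < L" for l c c'
  proof -
    have "Ls ! l \<in> set Ls" using that len by simp
    then obtain src sp where "Ls ! l = block_layer (6 * P) M src sp" "sp \<in> insert input_spec (set specs)"
      by (auto simp: Ls_def L0_def)
    then show ?thesis using block_layer_nnz[of "6 * P" sp 3 k c c' M src] specs_sparse by simp
  qed
  then have "(\<Sum>l<L. layer_nnz k (cs ! l) (cs ! Suc l) (Ls ! l)) \<le> (\<Sum>l<L. 4 * (M * (6 * P)))"
    by (intro sum_mono) auto
  then have size: "hyp_size d k 0 \<alpha> cs Ls \<le> L * (4 * (M * (6 * P))) + M"
    using readout(2)[of v] unfolding hyp_size_def len last \<alpha>_def by simp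
  have "\<bar>hyp_eval d k 0 \<alpha> cs Ls X - (\<Sum>b<M. v b * (\<Prod>j<d * d. hat (A b j * X 1 (j div d + 1) (j mod d + 1) - B b j)))\<bar>
        \<le> (\<Sum>b<M. \<bar>v b\<bar>) * (4 ^ q / 4 ^ Suc m)"
    if X: "\<And>i j. i \<in> {1..d} \<Longrightarrow> j \<in> {1..d} \<Longrightarrow> X 1 i j \<ge> 0" for X
  proof -
    let ?Y = "cnn_layer d k 1 W L0 X"
    let ?Z = "fold step specs ?Y"
    let ?h = "\<lambda>b. \<Prod>j<d * d. hat (A b j * X 1 (j div d + 1) (j mod d + 1) - B b j)"
    have "replicate L W = W # replicate (length specs) W"
      using len by (simp add: Ls_def flip: replicate_Suc)
    then have "cnn_eval d k cs Ls X = fold (cnn_layer d k W W) (map (block_layer (6 * P) M (\<lambda>b i. b * (6 * P) + i + 1)) specs) ?Y"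
      using cnn_eval_constant_width[of d k W "map (block_layer (6 * P) M (\<lambda>b i. b * (6 * P) + i + 1)) specs" ?Y]
      by (simp add: cs_def Ls_def)
    also have "\<dots> = ?Z" unfolding fold_map by (intro arg_cong[where f = "\<lambda>f. fold f specs ?Y"]) (auto simp: step_def fun_eq_iff)
    finally have "hyp_eval d k 0 \<alpha> cs Ls X = (\<Sum>b<M. v b * unit_val ?Z b 0 0)"
      unfolding hyp_eval_def last \<alpha>_def using readout(1)[of v ?Z] by simp
    then have "\<bar>hyp_eval d k 0 \<alpha> cs Ls X - (\<Sum>b<M. v b * ?h b)\<bar> = \<bar>\<Sum>b<M. v b * (unit_val ?Z b 0 0 - ?h b)\<bar>"
      by (simp add: sum_subtractf right_diff_distrib)
    also have "\<dots> \<le> (\<Sum>b<M. \<bar>v b\<bar> * (4 ^ q / 4 ^ Suc m))"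
    proof (intro order_trans[OF sum_abs] sum_mono)
      fix b assume "b \<in> {..<M}"
      then show "\<bar>v b * (unit_val ?Z b 0 0 - ?h b)\<bar> \<le> \<bar>v b\<bar> * (4 ^ q / 4 ^ Suc m)"
        unfolding abs_mult using X by (intro mult_left_mono network_error) (auto simp: L0_def)
    qed
    also have "\<dots> = (\<Sum>b<M. \<bar>v b\<bar>) * (4 ^ q / 4 ^ Suc m)" by (rule sum_distrib_right[symmetric])
    finally show ?thesis .
  qed
  then have "\<forall>X. (\<forall>i\<in>{1..d}. \<forall>j\<in>{1..d}. X 1 i j \<ge> 0) \<longrightarrow>
      \<bar>hyp_eval d k 0 \<alpha> cs Ls X - (\<Sum>b<M. v b * (\<Prod>j<d * d. hat (A b j * X 1 (j div d + 1) (j mod d + 1) - B b j)))\<bar>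
        \<le> (\<Sum>b<M. \<bar>v b\<bar>) * (4 ^ q / 4 ^ Suc m)" by blast
  then show thesis by (rule that[OF shape size])
qed

end

subsection \<open>The approximation rate\<close>

lemma level_error_nonneg: "level_error D r s \<ge> 0"
  by (simp add: level_error_def)

lemma half_powr_le: "r \<ge> 1 / 2 \<Longrightarrow> (1 / 2) powr r \<le> (3 / 4 :: real)"
proof -
  assume "r \<ge> 1 / 2"
  then have "(1 / 2) powr r \<le> (1 / 2 :: real) powr (1 / 2)" by (intro powr_mono') auto
  also have "\<dots> = sqrt (1 / 2)" by (simp add: powr_half_sqrt)
  also have "\<dots> \<le> 3 / 4" by (rule real_le_lsqrt) (auto simp: power2_eq_square)
  finally show ?thesis .
qed

text \<open>Consecutive terms shrink by 4/3 * 1/2 * 3/4 = 1/2: the growth of the polynomial, the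
  weight, and the Hoelder factor (1/2)^r with r \<ge> 1/2. The tail is thus at most twice its first
  term.\<close>

lemma tail_sum_le:
  assumes r: "r \<ge> 1 / 2" and ratio: "\<And>s. s \<ge> n \<Longrightarrow> real (s + 2) ^ e \<le> 4 / 3 * real (s + 1) ^ e"
  shows "(\<Sum>s=n..<m. real (s + 1) ^ e * level_error D r s) \<le> 2 * (real (n + 1) ^ e * level_error D r n)"
proof (cases "n \<le> m")
  case True
  let ?x = "\<lambda>s. real (s + 1) ^ e * level_error D r s"
  have dec: "2 * ?x (Suc s) \<le> ?x s" if "s \<ge> n" for s
  proof -
    have "(1 / 2 ^ (Suc s + D) :: real) = (1 / 2) * (1 / 2 ^ (s + D))" by simp
    then have "level_error D r (Suc s) = 1 / 2 * (1 / 2) powr r * level_error D r s"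
      unfolding level_error_def by (simp only: powr_mult) simp
    also have "\<dots> \<le> 1 / 2 * (3 / 4) * level_error D r s"
      by (intro mult_right_mono mult_left_mono half_powr_le r level_error_nonneg) auto
    finally have "level_error D r (Suc s) \<le> 3 / 8 * level_error D r s" by simp
    then have "?x (Suc s) \<le> (4 / 3 * real (s + 1) ^ e) * (3 / 8 * level_error D r s)"
      using ratio[OF that] by (intro mult_mono) (auto simp: level_error_nonneg)
    then show ?thesis by (simp add: mult_ac)
  qed
  \<comment> \<open>The added term 2 * \<open>?x m\<close> makes the halving estimate telescope in
    the induction.\<close>
  have "(\<Sum>s=n..<m. ?x s) + 2 * ?x m \<le> 2 * ?x n"
    using True
  proof (induction m rule: dec_induct)
    case (step i)
    then show ?case using dec[of i] by simp
  qed simp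
  moreover have "?x m \<ge> 0" by (intro mult_nonneg_nonneg level_error_nonneg) auto
  ultimately show ?thesis by linarith
qed (auto simp: level_error_nonneg)

text \<open>The chosen n is the largest level whose crude count of basis functions is at most N/16.
  Maximality gives the lower bound on 2^n that converts level errors into powers of N; such a level
  exists because n \<le> N for all candidates.\<close>

lemma maximal_level_exists:
  fixes N n0 e :: nat
  assumes "16 * n0 ^ e * 2 ^ n0 \<le> N"
  obtains n where "n0 \<le> n" "16 * n ^ e * 2 ^ n \<le> N" "N < 16 * (n + 1) ^ e * 2 ^ (n + 1)"
proof -
  let ?Q = "\<lambda>n. 16 * n ^ e * 2 ^ n \<le> N"
  have bd: "n \<le> N" if Q: "?Q n" for n
  proof (cases "n = 0")
    case False
    then have "1 * 2 ^ n \<le> 16 * n ^ e * 2 ^ n" by (intro mult_right_mono) auto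
    then show ?thesis using Q less_exp[of n] by linarith
  qed simp
  define n where "n = Greatest ?Q"
  have "?Q n" unfolding n_def by (rule GreatestI_nat[of ?Q, OF assms bd])
  moreover have "n0 \<le> n" unfolding n_def by (rule Greatest_le_nat[of ?Q, OF assms bd])
  moreover have "\<not> ?Q (n + 1)" using Greatest_le_nat[of ?Q "n + 1", OF _ bd] unfolding n_def by auto
  ultimately show thesis using that by (meson not_le)
qed

text \<open>With a = n^(D-1), maximality of n gives 2^(-n) \<le> 43 a / N, since 16 * 4/3 * 2 =
  128/3. As 1 + r \<le> 2, the constant becomes at most 43^2 = 1849, which together with 8/3 is
  absorbed by 4^D \<ge> 4^9 = 262144. The remaining power a^(2+r) becomes the logarithmic factor
  because 2^n \<le> N.\<close>

lemma sparse_error_le_rate: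
  fixes n N D :: nat and r :: real
  assumes n: "n \<ge> 1" and D: "D \<ge> 9" and r: "1 / 2 \<le> r" "r \<le> 1"
    and ratio: "real (n + 1) ^ (D - 1) \<le> 4 / 3 * real n ^ (D - 1)"
    and N: "16 * n ^ (D - 1) * 2 ^ n \<le> N" "N < 16 * (n + 1) ^ (D - 1) * 2 ^ (n + 1)"
  shows "2 * (real (n + 1) ^ (D - 1) * level_error D r n)
    \<le> 2 / 2 powr (r * D) * (log 2 N) powr ((2 + r) * (real D - 1)) / N powr (1 + r)"
proof -
  define a where "a = real n ^ (D - 1)"
  define t where "t = 1 / (2::real) ^ n"
  have a1: "a \<ge> 1" using n by (simp add: a_def)
  have t0: "t > 0" by (simp add: t_def)
  have "1 * 2 ^ n \<le> 16 * n ^ (D - 1) * 2 ^ n" using n by (intro mult_right_mono) auto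
  then have nN: "2 ^ n \<le> N" using N(1) by linarith
  then have N0: "real N > 0" by (metis of_nat_0_less_iff less_le_trans zero_less_numeral zero_less_power)
  have "real N < real (16 * (n + 1) ^ (D - 1) * 2 ^ (n + 1))" using N(2) by (simp only: of_nat_less_iff)
  then have "real N < 16 * real (n + 1) ^ (D - 1) * 2 ^ (n + 1)" by simp
  also have "\<dots> \<le> 16 * (4 / 3 * real n ^ (D - 1)) * 2 ^ (n + 1)"
    by (intro mult_right_mono mult_left_mono ratio) auto
  also have "\<dots> = 128 / 3 * a / t" by (simp add: a_def t_def)
  also have "\<dots> \<le> 43 * a / t" using a1 t0 by (intro divide_right_mono) auto
  finally have t: "t \<le> 43 * a / N" using N0 t0 by (simp add: field_simps)
  have le: "level_error D r n = t powr (1 + r) / 4 ^ D / 2 powr (r * D)"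
  proof -
    have "(1 / 2 ^ (n + D) :: real) = t / 2 powr real D" by (simp add: t_def power_add powr_realpow)
    then have "(1 / 2 ^ (n + D)) powr r = t powr r / 2 powr (r * D)"
      using t0 by (simp add: powr_divide powr_powr mult.commute)
    moreover have "1 / 2 ^ (n + 2 * D) = t / 4 ^ D" by (simp add: t_def power_add power_mult)
    ultimately show ?thesis unfolding level_error_def using t0 by (simp add: powr_add)
  qed
  have "t powr (1 + r) \<le> (43 * a / N) powr (1 + r)" using t t0 r by (intro powr_mono2) auto
  also have "\<dots> = 43 powr (1 + r) * a powr (1 + r) / N powr (1 + r)"
    using a1 N0 by (simp add: powr_divide powr_mult)
  also have "\<dots> \<le> 43 powr 2 * a powr (1 + r) / N powr (1 + r)"
    using r by (intro divide_right_mono mult_right_mono powr_mono) auto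
  finally have tp: "t powr (1 + r) \<le> 1849 * a powr (1 + r) / N powr (1 + r)" by simp
  have "4 ^ 9 \<le> (4::real) ^ D" using D by (intro power_increasing) auto
  then have D4: "262144 \<le> (4::real) ^ D" by simp
  have "2 * (real (n + 1) ^ (D - 1) * level_error D r n) \<le> 2 * (4 / 3 * a * level_error D r n)"
    using ratio by (intro mult_left_mono mult_right_mono level_error_nonneg) (auto simp: a_def)
  also have "\<dots> = 8 / 3 * a * t powr (1 + r) / 4 ^ D / 2 powr (r * D)" by (simp add: le)
  also have "\<dots> \<le> 8 / 3 * a * (1849 * a powr (1 + r) / N powr (1 + r)) / 262144 / 2 powr (r * D)"
    using a1 tp D4 by (intro divide_right_mono frac_le mult_left_mono) auto
  also have "\<dots> = (8 / 3 * 1849 / 262144) * (a * a powr (1 + r) / N powr (1 + r) / 2 powr (r * D))" by simp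
  also have "\<dots> \<le> 2 * (a * a powr (1 + r) / N powr (1 + r) / 2 powr (r * D))"
    using a1 by (intro mult_right_mono) auto
  also have "a * a powr (1 + r) = a powr (2 + r)" using a1 powr_add[of a 1 "1 + r"] by simp
  also have "a = real n powr (real D - 1)"
    using n D by (simp add: a_def powr_realpow[symmetric] of_nat_diff)
  also have "(real n powr (real D - 1)) powr (2 + r) = real n powr ((2 + r) * (real D - 1))"
    by (simp add: powr_powr mult.commute)
  also have "2 * (real n powr ((2 + r) * (real D - 1)) / N powr (1 + r) / 2 powr (r * D))
     \<le> 2 * ((log 2 N) powr ((2 + r) * (real D - 1)) / N powr (1 + r) / 2 powr (r * D))"
  proof (intro mult_left_mono divide_right_mono powr_mono2)
    have "real (2 ^ n) \<le> real N" using nN by (simp only: of_nat_le_iff)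
    then show "real n \<le> log 2 N" using N0 by (simp add: le_log_iff powr_realpow)
  qed (use r D in auto)
  finally show ?thesis by (simp add: field_simps)
qed

text \<open>The assumption D 2^D \<le> N trades one power of N for 2^(-D) \<le> 2^(-rD); what
  remains is N^(-2) \<le> N^(-(1+r)).\<close>

lemma network_error_le_rate:
  fixes N D :: nat and r l :: real
  assumes N: "D * 2 ^ D \<le> N" "N \<ge> 1" and r: "0 \<le> r" "r \<le> 1" and l: "l \<ge> 1" and D: "D \<ge> 1"
  shows "real D / real N ^ 3 \<le> 2 / 2 powr (r * D) * l powr ((2 + r) * (real D - 1)) / N powr (1 + r)"
proof -
  have N0: "real N > 0" using N by simp
  have "real (D * 2 ^ D) \<le> real N" using N(1) by (simp only: of_nat_le_iff)
  then have "real D * 2 ^ D \<le> real N" by simp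
  then have "real D / real N ^ 3 \<le> 1 / 2 ^ D / real N ^ 2"
    using N0 by (simp add: field_simps power2_eq_square power3_eq_cube)
  also have "\<dots> = 1 / 2 powr (real D) / N powr 2" using N0 by (simp add: powr_realpow)
  also have "\<dots> \<le> 2 / 2 powr (r * D) / N powr (1 + r)"
    using N r by (intro frac_le powr_mono) (auto intro: mult_left_le_one_le)
  also have "\<dots> \<le> 2 / 2 powr (r * D) * l powr ((2 + r) * (real D - 1)) / N powr (1 + r)"
  proof (intro divide_right_mono)
    have "l powr ((2 + r) * (real D - 1)) \<ge> 1"
      using l r D by (intro ge_one_powr_ge_zero mult_nonneg_nonneg) auto
    then show "2 / 2 powr (r * D) \<le> 2 / 2 powr (r * D) * l powr ((2 + r) * (real D - 1))"
      using mult_left_mono[of 1 "l powr ((2 + r) * (real D - 1))" "2 / 2 powr (r * D)"] by simp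
  qed simp
  finally show ?thesis .
qed

lemma power_ratio_eventually_le:
  obtains n1 :: nat where "\<And>s. s \<ge> n1 \<Longrightarrow> real (s + 2) ^ e \<le> 4 / 3 * real (s + 1) ^ e"
proof -
  have "(\<lambda>s. 1 + 1 / real (Suc s)) \<longlonglongrightarrow> 1 + 0" by (intro tendsto_intros LIMSEQ_Suc[OF lim_const_over_n])
  then have "(\<lambda>s. (1 + 1 / real (Suc s)) ^ e) \<longlonglongrightarrow> 1 ^ e" by (intro tendsto_power) simp
  then have "\<forall>\<^sub>F s in sequentially. (1 + 1 / real (Suc s)) ^ e < 4 / 3"
    by (intro order_tendstoD(2)[of _ 1]) auto
  then obtain n1 where n1: "\<And>s. s \<ge> n1 \<Longrightarrow> (1 + 1 / real (Suc s)) ^ e < 4 / 3"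
    by (auto simp: eventually_sequentially)
  show thesis
  proof (rule that)
    fix s assume "s \<ge> n1"
    have "real (s + 2) = (1 + 1 / real (Suc s)) * real (s + 1)" by (simp add: field_simps)
    then have "real (s + 2) ^ e = (1 + 1 / real (Suc s)) ^ e * real (s + 1) ^ e"
      by (simp only: power_mult_distrib)
    also have "\<dots> \<le> 4 / 3 * real (s + 1) ^ e"
      using n1[OF \<open>s \<ge> n1\<close>] by (intro mult_right_mono) auto
    finally show "real (s + 2) ^ e \<le> 4 / 3 * real (s + 1) ^ e" .
  qed
qed

lemma (in finite_measure) Lp_norm_le:
  assumes M: "measure M (space M) \<le> 1" and p: "2 \<le> p" and E: "E \<ge> 0" and le: "AE x in M. \<bar>g x\<bar> \<le> E"
  shows "Lp_norm M p g \<le> E"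
  using p
proof (cases rule: ereal_ge_2_cases)
  case 1
  have "E \<in> {C. C \<ge> 0 \<and> (AE x in M. \<bar>g x\<bar> \<le> C)}" using E le by simp
  then show ?thesis using 1 unfolding Lp_norm_def by (auto intro!: cInf_lower bdd_belowI[of _ 0])
next
  case (2 q)
  have "integral\<^sup>L M (\<lambda>x. \<bar>g x\<bar> powr q) \<le> E powr q"
  proof (cases "integrable M (\<lambda>x. \<bar>g x\<bar> powr q)")
    case True
    have "AE x in M. \<bar>g x\<bar> powr q \<le> E powr q"
      using le by eventually_elim (use 2 in \<open>auto intro: powr_mono2\<close>)
    then have "integral\<^sup>L M (\<lambda>x. \<bar>g x\<bar> powr q) \<le> integral\<^sup>L M (\<lambda>_. E powr q)"
      by (intro integral_mono_AE True) auto
    also have "\<dots> = measure M (space M) * E powr q" by simp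
    also have "\<dots> \<le> E powr q" using M by (intro mult_left_le_one_le) auto
    finally show ?thesis .
  \<comment> \<open>If the power is not integrable, its Bochner integral is 0 by convention and the
    bound is trivial.\<close>
  qed (simp add: not_integrable_integral_eq)
  then have "integral\<^sup>L M (\<lambda>x. \<bar>g x\<bar> powr q) powr (1 / q) \<le> (E powr q) powr (1 / q)"
    using 2 by (intro powr_mono2) (auto intro!: Bochner_Integration.integral_nonneg)
  then show ?thesis using 2 E by (simp add: Lp_norm_def powr_powr)
qed

lemma measure_unit_cube: "measure (lebesgue_on unit_cube) (unit_cube :: (real^'n::finite) set) = 1"
proof -
  have "measure lebesgue (cbox 0 1 :: (real^'n) set) = 1"
    using content_cbox_cart[of "0 :: real^'n" 1] by (simp add: interval_eq_empty_cart)
  then show ?thesis by (simp add: measure_restrict_space unit_cube_def)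
qed

lemma two_power_ceiling_log:
  assumes "x \<ge> (1::nat)"
  shows "x \<le> 2 ^ nat \<lceil>log 2 x\<rceil>" "2 ^ nat \<lceil>log 2 x\<rceil> \<le> 2 * x" "real (nat \<lceil>log 2 x\<rceil>) \<le> log 2 x + 1"
proof -
  let ?c = "nat \<lceil>log 2 x\<rceil>"
  have l0: "log 2 x \<ge> 0" using assms by simp
  then have c: "log 2 x \<le> real ?c" "real ?c \<le> log 2 x + 1" by linarith+
  have x: "2 powr (log 2 x) = real x" using assms by simp
  have "real x \<le> 2 powr (real ?c)" using c(1) x by (metis powr_mono one_le_numeral)
  then have "real x \<le> real (2 ^ ?c)" by (simp add: powr_realpow)
  then show "x \<le> 2 ^ ?c" by (simp only: of_nat_le_iff)
  have "2 powr (real ?c) \<le> 2 powr (log 2 x + 1)" using c(2) by (intro powr_mono) auto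
  also have "\<dots> = real (2 * x)" using x by (simp add: powr_add)
  finally have "real (2 ^ ?c) \<le> real (2 * x)" by (simp add: powr_realpow)
  then show "2 ^ ?c \<le> 2 * x" by (simp only: of_nat_le_iff)
  show "real ?c \<le> log 2 x + 1" by (rule c)
qed

text \<open>Pixel (j div d + 1, j mod d + 1) has index j + 1 in the vectorisation, so
  \<open>e\<close> reindexes the product over pixels into the product over coordinates.\<close>

lemma hat_basis_image:
  fixes x :: "real^'n::finite"
  assumes e: "bij_betw e {1..d * d} UNIV" and d: "d \<ge> 1"
  shows "(\<Prod>j<d * d. hat (2 ^ (l (e (j + 1)) + 1) * img_of d e x 1 (j div d + 1) (j mod d + 1)
      - (2 * real (i (e (j + 1))) + 1))) = hat_basis l i x"
proof -
  have "bij_betw (\<lambda>j. j + 1) {..<d * d} {1..d * d}"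
    by (rule bij_betwI[where g = "\<lambda>j. j - 1"]) auto
  then have b: "bij_betw (\<lambda>j. e (j + 1)) {..<d * d} UNIV"
    using bij_betw_trans[OF _ e, of "\<lambda>j. j + 1" "{..<d * d}"] by (simp add: o_def)
  have "img_of d e x 1 (j div d + 1) (j mod d + 1) = x $ e (j + 1)" for j
    by (simp add: img_of_def)
  then show ?thesis
    unfolding hat_basis_def using prod.reindex_bij_betw[OF b, of "\<lambda>c. hat (2 ^ (l c + 1) * x $ c - (2 * real (i c) + 1))"]
    by simp
qed

text \<open>The depth is at most 20 d log N because log N \<ge> 1. Four nonzero entries on each of
  at most 2 N d^2 channels per layer give 160 d^3 N log N; the readout raises 160 to 161, which is
  below 24 * 9 as 2k + 1 \<ge> 3.\<close>

lemma network_size_le: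
  fixes d k N S M L :: nat
  assumes d: "d \<ge> 3" and k: "k \<ge> 1" and N: "N \<ge> 2"
    and L: "L = 2 * (2 * nat \<lceil>log 2 N\<rceil> + 3) * nat \<lceil>log 2 d\<rceil> + 6 * d"
    and M: "M \<le> 2 * N * d\<^sup>2" "m \<le> N" and S: "S \<le> L * (4 * M) + m"
  shows "real S \<le> 24 * (2 * real k + 1)\<^sup>2 * real d ^ 5 * real N * log 2 N"
proof -
  let ?l = "log 2 (real N)"
  have l1: "?l \<ge> 1" using N by (simp add: le_log_iff)
  have "d < 2 ^ d" by (rule less_exp)
  then have "real d \<le> 2 powr real d" by (simp add: powr_realpow less_imp_le)
  then have "log 2 (real d) \<le> real d" using d by (simp add: log_le_iff)
  then have q: "real (nat \<lceil>log 2 d\<rceil>) \<le> real d" by simp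
  have c: "real (nat \<lceil>log 2 N\<rceil>) \<le> ?l + 1" using two_power_ceiling_log(3)[of N] N by simp
  have "real L = 2 * (2 * real (nat \<lceil>log 2 N\<rceil>) + 3) * real (nat \<lceil>log 2 d\<rceil>) + 6 * real d"
    by (simp add: L)
  also have "\<dots> \<le> 2 * (2 * (?l + 1) + 3) * real d + 6 * real d"
    using q c l1 by (intro add_mono mult_mono) auto
  also have "\<dots> = (4 * ?l + 16) * real d" by (simp add: algebra_simps)
  also have "\<dots> \<le> (20 * ?l) * real d" using l1 by (intro mult_right_mono) auto
  finally have L': "real L \<le> 20 * ?l * real d" .
  have "real M \<le> real (2 * N * d\<^sup>2)" using M by (simp only: of_nat_le_iff)
  then have M4: "4 * real M \<le> 4 * (2 * real N * real d ^ 2)" by simp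
  have "real S \<le> real (L * (4 * M) + m)" using S by (simp only: of_nat_le_iff)
  also have "\<dots> = real L * (4 * real M) + real m" by simp
  also have "\<dots> \<le> (20 * ?l * real d) * (4 * (2 * real N * real d ^ 2)) + real N"
    using M(2) l1 by (intro add_mono mult_mono[OF L' M4]) auto
  also have "\<dots> = 160 * (real d ^ 3 * (real N * ?l)) + real N"
    by (simp add: power2_eq_square power3_eq_cube)
  also have "\<dots> \<le> 160 * (real d ^ 5 * (real N * ?l)) + real d ^ 5 * (real N * ?l)"
  proof (intro add_mono mult_left_mono[of _ _ 160])
    show "real d ^ 3 * (real N * ?l) \<le> real d ^ 5 * (real N * ?l)"
      using d l1 by (intro mult_right_mono power_increasing) auto
    have "1 * (real N * 1) \<le> real d ^ 5 * (real N * ?l)"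
      using d l1 by (intro mult_mono[of 1] mult_left_mono one_le_power) auto
    then show "real N \<le> real d ^ 5 * (real N * ?l)" by simp
  qed simp
  also have "\<dots> = 161 * (real d ^ 5 * (real N * ?l))" by simp
  also have "\<dots> \<le> (24 * (2 * real k + 1)\<^sup>2) * (real d ^ 5 * (real N * ?l))"
  proof (rule mult_right_mono)
    have "3\<^sup>2 \<le> (2 * real k + 1)\<^sup>2" using k by (intro power_mono) auto
    then show "161 \<le> 24 * (2 * real k + 1)\<^sup>2" by simp
  qed (use l1 in auto)
  finally show ?thesis by (simp add: mult_ac)
qed

text \<open>The number of leaves satisfies 4^q \<le> 4 d^2, and 2 ceil(log N) sawtooth corrections
  give 4^(m+1) \<ge> 4 N^4. One power of N is lost to the sum of at most N coefficients of size at
  most 1.\<close>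

lemma network_tolerance:
  fixes N M d :: nat
  assumes N: "N \<ge> 1" and M: "M \<le> N" and d: "d \<ge> 1" and v: "\<And>b. \<bar>v b\<bar> \<le> (1::real)"
  shows "(\<Sum>b<M. \<bar>v b\<bar>) * (4 ^ nat \<lceil>log 2 d\<rceil> / 4 ^ Suc (2 * nat \<lceil>log 2 N\<rceil>)) \<le> real (d * d) / real N ^ 3"
proof -
  have "(4::nat) ^ nat \<lceil>log 2 d\<rceil> = (2 ^ nat \<lceil>log 2 d\<rceil>)\<^sup>2" by (simp add: power2_eq_square power_mult_distrib[symmetric])
  also have "\<dots> \<le> (2 * d)\<^sup>2" by (intro power_mono two_power_ceiling_log d) auto
  finally have "real (4 ^ nat \<lceil>log 2 d\<rceil>) \<le> real ((2 * d)\<^sup>2)" by (simp only: of_nat_le_iff)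
  then have q: "(4::real) ^ nat \<lceil>log 2 d\<rceil> \<le> 4 * real (d * d)" by (simp add: power2_eq_square)
  have "N ^ 4 \<le> (2 ^ nat \<lceil>log 2 N\<rceil>) ^ 4" by (intro power_mono two_power_ceiling_log N) auto
  also have "\<dots> = 4 ^ (2 * nat \<lceil>log 2 N\<rceil>)"
    by (simp add: power_mult[symmetric] mult.commute[of _ 4] flip: power_mult) (simp add: power_mult)
  finally have "real (N ^ 4) \<le> real (4 ^ (2 * nat \<lceil>log 2 N\<rceil>))" by (simp only: of_nat_le_iff)
  then have N4: "4 * real N ^ 4 \<le> 4 ^ Suc (2 * nat \<lceil>log 2 N\<rceil>)" by simp
  have "(\<Sum>b<M. \<bar>v b\<bar>) \<le> real M" using sum_mono[of "{..<M}" "\<lambda>b. \<bar>v b\<bar>" "\<lambda>_. 1"] v by simp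
  then have "(\<Sum>b<M. \<bar>v b\<bar>) \<le> real N" using M by linarith
  then have "(\<Sum>b<M. \<bar>v b\<bar>) * (4 ^ nat \<lceil>log 2 d\<rceil> / 4 ^ Suc (2 * nat \<lceil>log 2 N\<rceil>))
      \<le> real N * (4 * real (d * d) / (4 * real N ^ 4))"
    using q N4 N by (intro mult_mono frac_le) auto
  also have "\<dots> = real (d * d) / real N ^ 3"
    using N by (simp add: field_simps power3_eq_cube power4_eq_xxxx)
  finally show ?thesis .
qed

theorem theorem1:
  fixes d :: nat
  assumes "d \<ge> 3"
    and "CARD('n::finite) = d * d"
  shows "\<exists>N\<^sub>0::nat. \<forall>(k::nat) (p::ereal) (f :: real^'n \<Rightarrow> real) (e :: nat \<Rightarrow> 'n).
     k \<ge> 1 \<longrightarrow> bij_betw e {1..d * d} UNIV \<longrightarrow> 2 \<le> p \<longrightarrow> korobov_unit_ball p f \<longrightarrow>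
     (\<forall>N::nat. N \<ge> N\<^sub>0 \<longrightarrow>
        (\<exists>(\<beta>::real) (\<alpha>::nat \<Rightarrow> real) (cs::nat list) (Ls::(kernel \<times> (nat \<Rightarrow> real)) list).
           cnn_shape cs Ls (2 * N * d\<^sup>2)
             (2 * (2 * nat \<lceil>log 2 N\<rceil> + 3) * nat \<lceil>log 2 d\<rceil> + 6 * d) \<and>
           Lp_norm (lebesgue_on unit_cube) p
              (\<lambda>x. f x - hyp_eval d k \<beta> \<alpha> cs Ls (img_of d e x))
             \<le> 4 / 2 powr ((1 - inv_exp p) * d\<^sup>2)
                 * (log 2 N) powr ((3 - inv_exp p) * (real (d\<^sup>2) - 1)) / N powr (2 - inv_exp p) \<and>
           real (hyp_size d k \<beta> \<alpha> cs Ls) \<le> 24 * (2 * k + 1)\<^sup>2 * d ^ 5 * N * log 2 N))"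
proof -
  define D where "D = d * d"
  have cardD: "CARD('n) = D" using assms(2) by (simp add: D_def)
  have D9: "D \<ge> 9" using mult_mono[OF assms(1) assms(1)] by (simp add: D_def)
  obtain n1 where ratio: "\<And>s. s \<ge> n1 \<Longrightarrow> real (s + 2) ^ (D - 1) \<le> 4 / 3 * real (s + 1) ^ (D - 1)"
    using power_ratio_eventually_le[of "D - 1"] by blast
  define n0 where "n0 = n1 + 1"
  \<comment> \<open>The first bound forces the chosen level up to n0, one above n1 because the ratio
    is used at n - 1; the second absorbs the network error. Both depend on d alone.\<close>
  define N0 where "N0 = max (16 * n0 ^ (D - 1) * 2 ^ n0) (D * 2 ^ D)"
  show ?thesis
  proof (intro exI[of _ N0] allI impI)
    fix k :: nat and p :: ereal and f :: "real^'n \<Rightarrow> real" and e :: "nat \<Rightarrow> 'n" and N :: nat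
    assume k: "k \<ge> 1" and e: "bij_betw e {1..d * d} UNIV" and p: "2 \<le> p" and f: "korobov_unit_ball p f"
      and NN0: "N \<ge> N0"
    define r where "r = 1 - inv_exp p"
    have r: "1 / 2 \<le> r" "r \<le> 1"
      using p by (cases rule: ereal_ge_2_cases; simp add: r_def inv_exp_def divide_simps)+
    have N2D: "D * 2 ^ D \<le> N" using NN0 by (simp add: N0_def)
    have "D * 1 \<le> D * 2 ^ D" by (intro mult_left_mono) auto
    then have N9: "N \<ge> 9" using N2D D9 by linarith
    obtain n where n: "n0 \<le> n" "16 * n ^ (D - 1) * 2 ^ n \<le> N" "N < 16 * (n + 1) ^ (D - 1) * 2 ^ (n + 1)"
      using maximal_level_exists[of n0 "D - 1" N] NN0 by (auto simp: N0_def)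
    have n1: "n \<ge> 1" "n - 1 \<ge> n1" using n(1) by (auto simp: n0_def)
    define l where "l = log 2 (real N)"
    have l1: "l \<ge> 1" using N9 by (simp add: l_def le_log_iff)
    \<comment> \<open>Half of the admissible error: one \<open>H\<close> for truncating to the
      sparse grid, one for the approximate multiplications.\<close>
    define H where "H = 2 / 2 powr (r * D) * l powr ((2 + r) * (real D - 1)) / N powr (1 + r)"
    define E where "E = 2 * (real (n + 1) ^ (D - 1) * level_error D r n)"
    have EH: "E \<le> H"
      unfolding E_def H_def l_def
    proof (rule sparse_error_le_rate[OF n1(1) D9 r _ n(2,3)])
      show "real (n + 1) ^ (D - 1) \<le> 4 / 3 * real n ^ (D - 1)" using ratio[OF n1(2)] n1(1) by simp
    qed
    have "(\<Sum>s=n..<m. real (s + 1) ^ (D - 1) * level_error D r s) \<le> E" for m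
      unfolding E_def by (rule tail_sum_le[OF r(1) ratio]) (use n1 in auto)
    then obtain v :: "('n \<Rightarrow> nat) \<times> ('n \<Rightarrow> nat) \<Rightarrow> real" where v: "\<And>a. \<bar>v a\<bar> \<le> 1"
      and vf: "AE x in lebesgue_on unit_cube. \<bar>f x - (\<Sum>(l, i)\<in>sparse_index n. v (l, i) * hat_basis l i x)\<bar> \<le> E"
      using sparse_grid_approximation[OF f p, of n E] unfolding cardD r_def by blast
    define I where "I = (sparse_index n :: (('n \<Rightarrow> nat) \<times> ('n \<Rightarrow> nat)) set)"
    define M where "M = card I"
    have "finite I" by (simp add: I_def sparse_index_card)
    then obtain \<phi> where \<phi>: "bij_betw \<phi> {..<M} I"
      using ex_bij_betw_nat_finite[of I] by (auto simp: M_def atLeast0LessThan)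
    have "M \<le> n ^ (D - 1) * 2 ^ n" using sparse_index_card(2)[where 'n = 'n, of n] by (simp add: M_def I_def cardD)
    then have MN: "16 * M \<le> N" using n(2) by simp
    define q where "q = nat \<lceil>log 2 d\<rceil>"
    define m where "m = 2 * nat \<lceil>log 2 N\<rceil>"
    define L where "L = 2 * (2 * nat \<lceil>log 2 N\<rceil> + 3) * nat \<lceil>log 2 d\<rceil> + 6 * d"
    define A where "A b j = (2::real) ^ (fst (\<phi> b) (e (j + 1)) + 1)" for b j
    define B where "B b j = 2 * real (snd (\<phi> b) (e (j + 1))) + 1" for b j
    have d1: "d \<ge> 1" using assms(1) by simp
    have "(4::nat) ^ q = (2 ^ q)\<^sup>2" by (simp add: power2_eq_square power_mult_distrib[symmetric])
    also have "\<dots> \<le> (2 * d)\<^sup>2" unfolding q_def by (intro power_mono two_power_ceiling_log d1) auto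
    finally have q4: "4 ^ q \<le> 4 * d\<^sup>2" by (simp add: power_mult_distrib)
    \<comment> \<open>Six channels per leaf and 4^q \<le> 4 d^2 need 24 d^2 channels per block, and
      16 M \<le> N makes 24 M at most 2 N.\<close>
    have "M * (6 * 4 ^ q) \<le> M * (6 * (4 * d\<^sup>2))" by (intro mult_left_mono q4) auto
    also have "\<dots> = (24 * M) * d\<^sup>2" by simp
    also have "\<dots> \<le> (2 * N) * d\<^sup>2" using MN by (intro mult_right_mono) auto
    finally have W: "M * (6 * 4 ^ q) \<le> 2 * N * d\<^sup>2" .
    interpret tensor_network d k q m M "2 * N * d\<^sup>2" A B
      by unfold_locales (use d1 k W two_power_ceiling_log(1)[OF d1] in \<open>auto simp: q_def\<close>)
    have W1: "2 * N * d\<^sup>2 \<ge> 1" using N9 d1 by simp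
    have L': "L = 2 * q * (m + 3) + 6 * d" by (simp add: L_def q_def m_def)
    obtain \<alpha> cs Ls where shape: "cnn_shape cs Ls (2 * N * d\<^sup>2) L"
      and size: "hyp_size d k 0 \<alpha> cs Ls \<le> L * (4 * (M * (6 * 4 ^ q))) + M"
      and net: "\<forall>X. (\<forall>i\<in>{1..d}. \<forall>j\<in>{1..d}. X 1 i j \<ge> 0) \<longrightarrow>
      \<bar>hyp_eval d k 0 \<alpha> cs Ls X - (\<Sum>b<M. v (\<phi> b) * (\<Prod>j<d * d. hat (A b j * X 1 (j div d + 1) (j mod d + 1) - B b j)))\<bar>
        \<le> (\<Sum>b<M. \<bar>v (\<phi> b)\<bar>) * (4 ^ q / 4 ^ Suc m)"
      by (rule network_exists[OF W1 L', where v = "\<lambda>b. v (\<phi> b)"]) (rule that)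
    have tol: "(\<Sum>b<M. \<bar>v (\<phi> b)\<bar>) * (4 ^ q / 4 ^ Suc m) \<le> H"
    proof -
      have "(\<Sum>b<M. \<bar>v (\<phi> b)\<bar>) * (4 ^ q / 4 ^ Suc m) \<le> real D / real N ^ 3"
        unfolding q_def m_def D_def by (rule network_tolerance) (use N9 MN d1 v in auto)
      also have "\<dots> \<le> H"
        unfolding H_def by (rule network_error_le_rate[OF N2D]) (use N9 r l1 D9 in auto)
      finally show ?thesis .
    qed
    have basis: "(\<Sum>b<M. v (\<phi> b) * (\<Prod>j<d * d. hat (A b j * img_of d e x 1 (j div d + 1) (j mod d + 1) - B b j)))
        = (\<Sum>(l, i)\<in>sparse_index n. v (l, i) * hat_basis l i x)" for x
    proof -
      have "(\<Sum>b<M. v (\<phi> b) * (\<Prod>j<d * d. hat (A b j * img_of d e x 1 (j div d + 1) (j mod d + 1) - B b j)))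
          = (\<Sum>b<M. case \<phi> b of (l, i) \<Rightarrow> v (l, i) * hat_basis l i x)"
        unfolding A_def B_def hat_basis_image[OF e d1] by (simp add: case_prod_beta)
      also have "\<dots> = (\<Sum>(l, i)\<in>I. v (l, i) * hat_basis l i x)"
        by (rule sum.reindex_bij_betw[OF \<phi>])
      finally show ?thesis by (simp add: I_def)
    qed
    have "AE x in lebesgue_on unit_cube. \<bar>f x - hyp_eval d k 0 \<alpha> cs Ls (img_of d e x)\<bar> \<le> 2 * H"
      using vf AE_space
    proof eventually_elim
      case (elim x)
      \<comment> \<open>Nonnegativity of the pixels on the cube is what lets the input and shift
        layers copy them through ReLU.\<close>
      have "\<forall>i\<in>{1..d}. \<forall>j\<in>{1..d}. img_of d e x 1 i j \<ge> 0"
        using elim(2) by (simp add: img_of_def unit_cube_def mem_box_cart)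
      from net[THEN spec[of _ "img_of d e x"], THEN mp, OF this] show ?case
        using elim(1) EH tol unfolding basis by linarith
    qed
    moreover have "H \<ge> 0" by (simp add: H_def)
    ultimately have "Lp_norm (lebesgue_on unit_cube) p (\<lambda>x. f x - hyp_eval d k 0 \<alpha> cs Ls (img_of d e x)) \<le> 2 * H"
      by (intro finite_measure.Lp_norm_le finite_measure_unit_cube p) (simp_all add: measure_unit_cube)
    \<comment> \<open>Here 1 + r = 2 - 1/p and 2 + r = 3 - 1/p, with 1/p read as 0 for p
      infinite.\<close>
    also have "2 * H = 4 / 2 powr ((1 - inv_exp p) * d\<^sup>2)
        * (log 2 N) powr ((3 - inv_exp p) * (real (d\<^sup>2) - 1)) / N powr (2 - inv_exp p)"
      by (simp add: H_def r_def l_def D_def power2_eq_square)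
    finally have err: "Lp_norm (lebesgue_on unit_cube) p (\<lambda>x. f x - hyp_eval d k 0 \<alpha> cs Ls (img_of d e x))
      \<le> 4 / 2 powr ((1 - inv_exp p) * d\<^sup>2)
        * (log 2 N) powr ((3 - inv_exp p) * (real (d\<^sup>2) - 1)) / N powr (2 - inv_exp p)" .
    have "real (hyp_size d k 0 \<alpha> cs Ls) \<le> 24 * (2 * real k + 1)\<^sup>2 * real d ^ 5 * real N * log 2 N"
      by (rule network_size_le[OF assms(1) k _ L_def W _ size]) (use N9 MN in auto)
    then have "real (hyp_size d k 0 \<alpha> cs Ls) \<le> 24 * (2 * k + 1)\<^sup>2 * d ^ 5 * N * log 2 N"
      by (simp add: add.commute)
    then show "\<exists>(\<beta>::real) (\<alpha>::nat \<Rightarrow> real) (cs::nat list) (Ls::(kernel \<times> (nat \<Rightarrow> real)) list).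
           cnn_shape cs Ls (2 * N * d\<^sup>2)
             (2 * (2 * nat \<lceil>log 2 N\<rceil> + 3) * nat \<lceil>log 2 d\<rceil> + 6 * d) \<and>
           Lp_norm (lebesgue_on unit_cube) p
              (\<lambda>x. f x - hyp_eval d k \<beta> \<alpha> cs Ls (img_of d e x))
             \<le> 4 / 2 powr ((1 - inv_exp p) * d\<^sup>2)
                 * (log 2 N) powr ((3 - inv_exp p) * (real (d\<^sup>2) - 1)) / N powr (2 - inv_exp p) \<and>
           real (hyp_size d k \<beta> \<alpha> cs Ls) \<le> 24 * (2 * k + 1)\<^sup>2 * d ^ 5 * N * log 2 N"
      using shape err unfolding L_def by blast
  qed
qed

end
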